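(* There are bounded functions $e_5, e_7, e_{11}$ on the positive integers such that for all positive integers $n$, $M(5, n) = \lfloor n/5\rfloor + e_5(n)$, $M(7, n) = \lfloor n/7\rfloor + e_7(n)$, and $M(11, n) = \lfloor n/35\rfloor + e_{11}(n)$.
   Context: The $T$-tetromino is the polyomino formed by four unit squares: three in a row together with a fourth square attached to the middle square of that row. A tiling of an $m\times n$ rectangle (of unit cells) by $T$-tetrominos and monominos is a partition of its cells into copies of the $T$-tetromino (in any rotation or reflection, aligned with the grid) and single cells (monominos). The gap number $M(m,n)$ is the least number of monominos occurring in such a tiling of the $m\times n$ rectangle. *)

theory Defs
  imports Complex_Main "HOL-Library.Disjoint_Sets"
begin

text \<open>A cell is named by the integer coordinates of one of its corners.\<close>

type_synonym cell = "int \<times> int"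

definition base_T :: "cell set" where
  "base_T = {(-1, 0), (0, 0), (1, 0), (0, 1)}"

text \<open>The eight rotations and reflections of the grid that fix the origin.\<close>

definition grid_symmetries :: "(cell \<Rightarrow> cell) set" where
  "grid_symmetries =
     {\<lambda>(x, y). (s * x, t * y) | s t. s \<in> {-1, 1} \<and> t \<in> {-1, 1}} \<union>
     {\<lambda>(x, y). (s * y, t * x) | s t. s \<in> {-1, 1} \<and> t \<in> {-1, 1}}"

definition translate :: "cell \<Rightarrow> cell \<Rightarrow> cell" where
  "translate v c = (fst v + fst c, snd v + snd c)"

definition is_T_tetromino :: "cell set \<Rightarrow> bool" where
  "is_T_tetromino S \<longleftrightarrow> (\<exists>g\<in>grid_symmetries. \<exists>v. S = translate v ` g ` base_T)"

definition is_monomino :: "cell set \<Rightarrow> bool" where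
  "is_monomino S \<longleftrightarrow> (\<exists>c. S = {c})"

definition rectangle :: "nat \<Rightarrow> nat \<Rightarrow> cell set" where
  "rectangle m n = {0..<int m} \<times> {0..<int n}"

definition is_tiling :: "nat \<Rightarrow> nat \<Rightarrow> cell set set \<Rightarrow> bool" where
  "is_tiling m n P \<longleftrightarrow>
     partition_on (rectangle m n) P \<and> (\<forall>S\<in>P. is_T_tetromino S \<or> is_monomino S)"

definition gap_number :: "nat \<Rightarrow> nat \<Rightarrow> nat" where
  "gap_number m n =
     (LEAST k. \<exists>P. is_tiling m n P \<and> card {S \<in> P. is_monomino S} = k)"

text \<open>The minimum defining \<^const>\<open>gap_number\<close> is attained: the all-monomino tiling exists.\<close>

lemma gap_number_attained:
  "\<exists>P. is_tiling m n P \<and> card {S \<in> P. is_monomino S} = gap_number m n"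
proof -
  have "is_tiling m n ((\<lambda>c. {c}) ` rectangle m n)"
    by (auto simp: is_tiling_def is_monomino_def partition_on_def disjoint_def)
  then have "\<exists>k P. is_tiling m n P \<and> card {S \<in> P. is_monomino S} = k"
    by blast
  then show ?thesis
    unfolding gap_number_def by (rule LeastI_ex)
qed

end

theory Submission
  imports Defs
begin

text \<open>For the upper bounds, the strips of width 5, 7 and 11 have periodic tilings with one gap per 5, 7
  and 35 columns.

  For the lower bounds, cut the strip between two columns and record the cells to the right of the cut that are
  covered by tiles crossing it. These states form a finite automaton whose steps are the ways to
  complete a column, weighted by the number of gaps left in it. A gapless run has bounded
  length from every state: at most 6, 8 and 42 columns. Let \<open>P\<close> be 5, 7 or 35. A run of fewer than \<open>P\<close>
  columns followed by a gap is consistent with one gap per \<open>P\<close> columns, whatever follows. Longer runs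
  end in few states, and the excess is compensated by what is possible after the next gap. This
  is expressed by potentials: \<open>m\<close> columns entered in state \<open>s\<close> satisfy \<open>m \<le> P * gaps + i\<close>, where \<open>i\<close>
  depends on \<open>s\<close> only, and each such inequality follows from those of the successors of \<open>s\<close>.\<close>

section \<open>Packings of a strip\<close>

subsection \<open>Orientations of the T-tetromino\<close>

text \<open>Give a step of the automaton that leaves \<open>g\<close> gaps the weight
  \<open>1 - P * g\<close>. Suitable constants exist just when no cycle has positive weight; the
  best ones are maximal path weights. Proving them by induction meets cycles of weight zero, around
  which a bound depends on itself. Hence two kinds of bounds. A gapless step lowers the constant by
  one, so the successors are settled beforehand, in the order of the constants. A step through one
  gap raises it by \<open>P - 1\<close>, and there the bounds assumed for fewer columns may be used.
  Once the raised constant reaches the one valid for arbitrary states, the state behind the gap need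
  not be known; only below this threshold are single gaps examined.

  The areas 25, 49 and 385 of one period are 1 modulo 4, so a single gap is the least that
  tetrominoes can leave in a period. The lists of codes name states only; all their transitions are
  recomputed by rewriting.\<close>

text \<open>The first cell listed is the least one when cells are ordered by column and then by row; the
  transfer argument always places the tile covering the least uncovered cell.\<close>

definition tcells :: "nat \<Rightarrow> int \<Rightarrow> int \<Rightarrow> cell list" where
  "tcells k r x =
    (if k = 0 then [(r, x), (r, x + 1), (r, x + 2), (r + 1, x + 1)]
     else if k = 1 then [(r, x), (r, x + 1), (r, x + 2), (r - 1, x + 1)]
     else if k = 2 then [(r, x), (r + 1, x), (r + 2, x), (r + 1, x + 1)]
     else [(r, x), (r - 1, x + 1), (r, x + 1), (r + 1, x + 1)])"

text \<open>The base tile is symmetric about its stem, so only the sign along the stem matters and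
  the eight symmetries give four orientations.\<close>

lemma is_T_tetromino_image:
  assumes "s \<in> {-1, 1}" "t \<in> {-1, 1::int}"
  shows "translate (a, b) ` (\<lambda>(x, y). (s * x, t * y)) ` base_T
           = set (if t = 1 then tcells 2 (a - 1) b else tcells 3 a (b - 1))"
    and "translate (a, b) ` (\<lambda>(x, y). (s * y, t * x)) ` base_T
           = set (if s = 1 then tcells 0 a (b - 1) else tcells 1 a (b - 1))"
  using assms by (auto simp: base_T_def translate_def tcells_def)

lemma is_T_tetromino_iff:
  "is_T_tetromino S \<longleftrightarrow> (\<exists>k<4. \<exists>r x. S = set (tcells k r x))"
proof
  assume "is_T_tetromino S"
  then obtain g v where g: "g \<in> grid_symmetries" and S: "S = translate v ` g ` base_T"
    by (auto simp: is_T_tetromino_def)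
  obtain a b where v: "v = (a, b)" by (cases v)
  from g consider
      (A) s t where "s \<in> {-1, 1}" "t \<in> {-1, 1}" "g = (\<lambda>(x, y). (s * x, t * y))"
    | (B) s t where "s \<in> {-1, 1}" "t \<in> {-1, 1}" "g = (\<lambda>(x, y). (s * y, t * x))"
    unfolding grid_symmetries_def by blast
  then show "\<exists>k<4. \<exists>r x. S = set (tcells k r x)"
  proof cases
    case A
    then show ?thesis
      unfolding S v A(3) is_T_tetromino_image(1)[OF A(1,2)]
      by (cases "t = 1") (force intro: exI[of _ 2] exI[of _ 3])+
  next
    case B
    then show ?thesis
      unfolding S v B(3) is_T_tetromino_image(2)[OF B(1,2)]
      by (cases "s = 1") (force intro: exI[of _ 0] exI[of _ 1])+
  qed
next
  assume "\<exists>k<4. \<exists>r x. S = set (tcells k r x)"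
  then obtain k r x where "k < 4" and S: "S = set (tcells k r x)" by blast
  then consider "k = 0" | "k = 1" | "k = 2" | "k = 3" by linarith
  then show "is_T_tetromino S"
  proof cases
    case 1
    have "S = translate (r, x + 1) ` (\<lambda>(x, y). (1 * y, 1 * x)) ` base_T"
      using is_T_tetromino_image(2)[of 1 1 r "x + 1"] by (simp add: S 1)
    then show ?thesis unfolding is_T_tetromino_def grid_symmetries_def by blast
  next
    case 2
    have "S = translate (r, x + 1) ` (\<lambda>(x, y). (- 1 * y, 1 * x)) ` base_T"
      using is_T_tetromino_image(2)[of "-1" 1 r "x + 1"] by (simp add: S 2)
    then show ?thesis unfolding is_T_tetromino_def grid_symmetries_def by blast
  next
    case 3
    have "S = translate (r + 1, x) ` (\<lambda>(x, y). (1 * x, 1 * y)) ` base_T"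
      using is_T_tetromino_image(1)[of 1 1 "r + 1" x] by (simp add: S 3)
    then show ?thesis unfolding is_T_tetromino_def grid_symmetries_def by blast
  next
    case 4
    have "S = translate (r, x + 1) ` (\<lambda>(x, y). (1 * x, - 1 * y)) ` base_T"
      using is_T_tetromino_image(1)[of 1 "-1" r "x + 1"] by (simp add: S 4)
    then show ?thesis unfolding is_T_tetromino_def grid_symmetries_def by blast
  qed
qed

lemma card_T_tetromino: "is_T_tetromino S \<Longrightarrow> finite S \<and> card S = 4"
  by (auto simp: is_T_tetromino_iff tcells_def)

section \<open>Packings of the infinite strip and their gaps\<close>

text \<open>The strip is infinite in both directions, so a window of columns may start anywhere and
  tiles may cross both of its ends.\<close>

definition packing :: "nat \<Rightarrow> cell set set \<Rightarrow> bool" where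
  "packing W S \<longleftrightarrow> disjoint S \<and> (\<forall>t\<in>S. is_T_tetromino t \<and> t \<subseteq> {0..<int W} \<times> UNIV)"

lemma packing_tile: "packing W S \<Longrightarrow> t \<in> S \<Longrightarrow> \<exists>k<4. \<exists>r x. t = set (tcells k r x)"
  by (simp add: packing_def is_T_tetromino_iff)

definition gaps :: "nat \<Rightarrow> cell set set \<Rightarrow> int \<Rightarrow> nat \<Rightarrow> nat" where
  "gaps W S x m = card ({0..<int W} \<times> {x..<x + int m} - \<Union>S)"

lemma gaps_0 [simp]: "gaps W S x 0 = 0"
  by (simp add: gaps_def)

lemma gaps_Suc: "gaps W S x (Suc m) = gaps W S x 1 + gaps W S (x + 1) m"
proof -
  have "{0..<int W} \<times> {x..<x + int (Suc m)} - \<Union>S =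
      ({0..<int W} \<times> {x..<x + int 1} - \<Union>S) \<union> ({0..<int W} \<times> {x + 1..<x + 1 + int m} - \<Union>S)"
    by auto
  then show ?thesis
    unfolding gaps_def by (simp only:) (subst card_Un_disjoint, auto)
qed

section \<open>Tiles begun before a cell, in the order by columns and then rows\<close>

text \<open>Whole tiles are collected, including the parts that protrude past \<open>(r, x)\<close>;
  these parts are what a transfer state has to remember.\<close>

definition begun :: "cell set set \<Rightarrow> int \<Rightarrow> int \<Rightarrow> cell set" where
  "begun S x r = \<Union>{t \<in> S. \<exists>c\<in>t. snd c < x \<or> snd c = x \<and> fst c < r}"

lemma begunI: "t \<in> S \<Longrightarrow> d \<in> t \<Longrightarrow> snd d < x \<or> snd d = x \<and> fst d < r \<Longrightarrow> c \<in> t \<Longrightarrow> c \<in> begun S x r"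
  unfolding begun_def by blast

lemma begunE:
  assumes "c \<in> begun S x r"
  obtains t d where "t \<in> S" "d \<in> t" "snd d < x \<or> snd d = x \<and> fst d < r" "c \<in> t"
  using assms unfolding begun_def by blast

lemma packing_unique: "packing W S \<Longrightarrow> t \<in> S \<Longrightarrow> u \<in> S \<Longrightarrow> c \<in> t \<Longrightarrow> c \<in> u \<Longrightarrow> t = u"
  unfolding packing_def disjoint_def by blast

lemma begun_mono: "begun S x r \<subseteq> begun S x (r + 1)"
  unfolding begun_def by (intro Union_mono) auto

lemma begun_Suc_cases:
  assumes "c \<in> begun S x (r + 1)"
  obtains "c \<in> begun S x r" | t where "t \<in> S" "(r, x) \<in> t" "c \<in> t"
proof -
  from assms obtain t d where t: "t \<in> S" "d \<in> t" "snd d < x \<or> snd d = x \<and> fst d < r + 1" "c \<in> t"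
    by (rule begunE)
  show ?thesis
  proof (cases "d = (r, x)")
    case True
    then show ?thesis using t that(2) by simp
  next
    case False
    then have "snd d < x \<or> snd d = x \<and> fst d < r" using t(3) by (cases d) auto
    then show ?thesis using begunI[OF t(1,2) _ t(4)] that(1) by simp
  qed
qed

lemma begun_next_column:
  assumes "packing W S"
  shows "begun S x (int W) = begun S (x + 1) 0"
proof -
  have "c \<in> {0..<int W} \<times> UNIV" if "t \<in> S" "c \<in> t" for t c
    using assms that unfolding packing_def by blast
  then have "(\<exists>c\<in>t. snd c < x \<or> snd c = x \<and> fst c < int W) \<longleftrightarrow>
      (\<exists>c\<in>t. snd c < x + 1 \<or> snd c = x + 1 \<and> fst c < 0)" if "t \<in> S" for t
    using that by (intro bex_cong refl) fastforce
  then have "{t \<in> S. \<exists>c\<in>t. snd c < x \<or> snd c = x \<and> fst c < int W} =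
      {t \<in> S. \<exists>c\<in>t. snd c < x + 1 \<or> snd c = x + 1 \<and> fst c < 0}"
    by (intro Collect_cong conj_cong refl)
  then show ?thesis unfolding begun_def by simp
qed

text \<open>Only a horizontal bar spans three columns. If it reaches \<open>(i, x + 2)\<close> from
  an earlier cell, it starts at \<open>(i, x)\<close>, which forces \<open>i < r\<close>.\<close>

lemma begun_far:
  assumes "packing W S" "i \<ge> r"
  shows "(i, x + 2) \<notin> begun S x r"
proof
  assume "(i, x + 2) \<in> begun S x r"
  then obtain t c where t: "t \<in> S" "(i, x + 2) \<in> t" "c \<in> t" "snd c < x \<or> snd c = x \<and> fst c < r"
    unfolding begun_def by blast
  moreover obtain k r' x' where "k < 4" "t = set (tcells k r' x')"
    using packing_tile[OF assms(1) t(1)] by blast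
  ultimately have "(i, x + 2) \<in> set (tcells k r' x')" "c \<in> set (tcells k r' x')" by simp_all
  then show False using t(4) assms(2) by (cases c) (auto simp: tcells_def split: if_splits)
qed

text \<open>A begun tile reaching column \<open>x + 2\<close> is a bar from column \<open>x\<close>.
  Hence no row gets the status \<open>U\<close> relative to column \<open>x + 1\<close>.\<close>

lemma begun_bar:
  assumes "packing W S" "(i, x + 2) \<in> begun S x r"
  shows "(i, x + 1) \<in> begun S x r"
proof -
  from assms(2) obtain t d where t: "t \<in> S" "d \<in> t" "snd d < x \<or> snd d = x \<and> fst d < r" "(i, x + 2) \<in> t"
    by (rule begunE)
  obtain k r' x' where k: "k < 4" "t = set (tcells k r' x')"
    using packing_tile[OF assms(1) t(1)] by blast
  obtain d1 d2 where d: "d = (d1, d2)" by (cases d)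
  have "(d1, d2) \<in> set (tcells k r' x')" "d2 \<le> x" "(i, x + 2) \<in> set (tcells k r' x')"
    using t k d by auto
  then have "k \<le> 1 \<and> i = r' \<and> x = x'" by (auto simp: tcells_def split: if_splits)
  then have "(i, x + 1) \<in> t" unfolding k(2) by (auto simp: tcells_def)
  then show ?thesis by (rule begunI[OF t(1-3)])
qed

text \<open>At the start of a column, status \<open>U\<close> is impossible and every
  \<open>D\<close> has a vertical neighbour \<open>B\<close>, namely the fourth cell of its bar. If
  that neighbour were \<open>D\<close> as well, a second bar would run through the fourth
  cell.\<close>

lemma begun_row:
  assumes "packing W S" "(i, x + 1) \<in> begun S x 0"
  shows "(i, x) \<in> begun S x 0"
    and "\<exists>q\<in>{i - 1, i + 1}. (q, x) \<in> begun S x 0 \<and> (q, x + 1) \<notin> begun S x 0"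
proof -
  \<comment> \<open>No cell of the strip has a negative row, so the earlier cell lies left of column
    \<open>x\<close>. A tile that also meets column \<open>x + 1\<close> is then a bar starting in
    column \<open>x - 1\<close>.\<close>
  have bar: "\<exists>t\<in>S. \<exists>k\<le>1. t = set (tcells k q (x - 1)) \<and> t \<subseteq> begun S x 0" if "(q, x + 1) \<in> begun S x 0" for q
  proof -
    from that obtain t c where t: "t \<in> S" "c \<in> t" "snd c < x \<or> snd c = x \<and> fst c < 0" "(q, x + 1) \<in> t"
      by (rule begunE)
    have "c \<in> {0..<int W} \<times> UNIV" using t assms(1) unfolding packing_def by blast
    then have c: "fst c \<ge> 0" by auto
    obtain k r' x' where k: "k < 4" "t = set (tcells k r' x')"
      using packing_tile[OF assms(1) t(1)] by blast
    obtain c1 c2 where c12: "c = (c1, c2)" by (cases c)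
    have "(c1, c2) \<in> set (tcells k r' x')" "c2 < x" "(q, x + 1) \<in> set (tcells k r' x')"
      using t c k c12 by auto
    then have *: "k \<le> 1 \<and> r' = q \<and> x' = x - 1" by (auto simp: tcells_def split: if_splits)
    moreover have "t \<subseteq> begun S x 0" using begunI[OF t(1-3)] by blast
    ultimately show ?thesis using t(1) k(2) by blast
  qed
  from bar[OF assms(2)] obtain t k where t: "t \<in> S" "k \<le> 1" "t = set (tcells k i (x - 1))" "t \<subseteq> begun S x 0"
    by blast
  show "(i, x) \<in> begun S x 0" using t by (auto simp: tcells_def split: if_splits)
  define q where "q = (if k = 0 then i + 1 else i - 1)"
  have qt: "(q, x) \<in> t" using t(2,3) by (auto simp: q_def tcells_def)
  moreover have "(q, x + 1) \<notin> begun S x 0"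
  proof
    assume "(q, x + 1) \<in> begun S x 0"
    from bar[OF this] obtain u l where u: "u \<in> S" "l \<le> 1" "u = set (tcells l q (x - 1))" by blast
    have "(q, x) \<in> u" using u(2,3) by (auto simp: tcells_def)
    then have "u = t" using packing_unique[OF assms(1) u(1) t(1) _ qt] by blast
    moreover have "(q, x + 1) \<in> u" using u(2,3) by (auto simp: tcells_def)
    ultimately show False using t(2,3) by (auto simp: q_def tcells_def split: if_splits)
  qed
  ultimately show "\<exists>q\<in>{i - 1, i + 1}. (q, x) \<in> begun S x 0 \<and> (q, x + 1) \<notin> begun S x 0"
    using t(4) by (intro bexI[of _ q]) (auto simp: q_def)
qed

lemma begun_step_in:
  assumes "packing W S" "(r, x) \<in> begun S x r \<or> (r, x) \<notin> \<Union>S"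
  shows "begun S x (r + 1) = begun S x r"
proof (intro equalityI begun_mono subsetI)
  fix c assume "c \<in> begun S x (r + 1)"
  then show "c \<in> begun S x r"
  proof (cases rule: begun_Suc_cases)
    case (2 t)
    then have "(r, x) \<in> begun S x r" using assms(2) by blast
    then obtain u d where u: "u \<in> S" "d \<in> u" "snd d < x \<or> snd d = x \<and> fst d < r" "(r, x) \<in> u"
      by (rule begunE)
    have "t = u" by (rule packing_unique[OF assms(1) 2(1) u(1) 2(2) u(4)])
    then show ?thesis using begunI[OF u(1-3)] 2(3) by simp
  qed
qed

text \<open>An earlier cell of the tile over \<open>(r, x)\<close> would make the whole tile begun.
  So \<open>(r, x)\<close> is its least cell and only the orientation is open.\<close>

lemma begun_step_tile:
  assumes "packing W S" "(r, x) \<notin> begun S x r" "(r, x) \<in> \<Union>S"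
  obtains k where "k < 4" "set (tcells k r x) \<in> S" "begun S x (r + 1) = begun S x r \<union> set (tcells k r x)"
    "begun S x r \<inter> set (tcells k r x) = {}" "set (tcells k r x) \<subseteq> {0..<int W} \<times> UNIV"
proof -
  obtain t where t: "t \<in> S" "(r, x) \<in> t" using assms(3) by blast
  have late: "\<not> (snd c < x \<or> snd c = x \<and> fst c < r)" if "c \<in> t" for c
    using begunI[OF t(1) that _ t(2)] assms(2) by blast
  obtain k r' x' where k: "k < 4" "t = set (tcells k r' x')"
    using packing_tile[OF assms(1) t(1)] by blast
  have "(r', x') \<in> t" using k by (simp add: tcells_def)
  then have "r' = r \<and> x' = x"
    using t(2) late[of "(r', x')"] unfolding k(2) by (auto simp: tcells_def split: if_splits)
  then have tk: "t = set (tcells k r x)" using k by simp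
  have "begun S x (r + 1) = begun S x r \<union> t"
  proof (intro equalityI subsetI)
    fix c assume "c \<in> begun S x (r + 1)"
    then show "c \<in> begun S x r \<union> t"
    proof (cases rule: begun_Suc_cases)
      case (2 u)
      then have "u = t" using packing_unique[OF assms(1) 2(1) t(1) 2(2) t(2)] by simp
      then show ?thesis using 2 by blast
    qed blast
  next
    fix c assume "c \<in> begun S x r \<union> t"
    then show "c \<in> begun S x (r + 1)"
      using begun_mono begunI[OF t, of x "r + 1"] by (cases c) auto
  qed
  moreover have "begun S x r \<inter> t = {}"
  proof (rule ccontr)
    assume "begun S x r \<inter> t \<noteq> {}"
    then obtain c where c: "c \<in> begun S x r" "c \<in> t" by blast
    from c(1) obtain u d where u: "u \<in> S" "d \<in> u" "snd d < x \<or> snd d = x \<and> fst d < r" "c \<in> u"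
      by (rule begunE)
    have "u = t" by (rule packing_unique[OF assms(1) u(1) t(1) u(4) c(2)])
    then show False using late u by blast
  qed
  moreover have "t \<subseteq> {0..<int W} \<times> UNIV" using assms(1) t unfolding packing_def by blast
  ultimately show ?thesis using that[of k] k(1) t(1) unfolding tk by simp
qed

subsection \<open>Completing a column\<close>

datatype status = E | B | D | U | X

text \<open>\<open>E\<close>, \<open>B\<close>, \<open>D\<close>, \<open>U\<close> tell which of the two cells of a row in columns \<open>x\<close>, \<open>x + 1\<close> belong to \<open>A\<close>
  (none, first, both, second); \<open>X\<close> marks the border of the strip.\<close>

definition rcode :: "cell set \<Rightarrow> int \<Rightarrow> int \<Rightarrow> status" where
  "rcode A x i = (if (i, x) \<in> A then if (i, x + 1) \<in> A then D else B
                  else if (i, x + 1) \<in> A then U else E)"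

fun cover2 :: "status \<Rightarrow> status" where
  "cover2 E = U" | "cover2 B = D" | "cover2 c = c"

fun cover1 :: "status \<Rightarrow> status" where
  "cover1 E = B" | "cover1 U = D" | "cover1 c = c"

text \<open>The rows \<open>rs\<close> of a column are completed from top to bottom with the four orientations; the codes
  of the finished rows relative to the next column are stacked on \<open>acc\<close>, so that \<open>Q\<close> receives
  the next state upside down.\<close>

fun chk :: "(status list \<Rightarrow> bool) \<Rightarrow> status list \<Rightarrow> status list \<Rightarrow> bool" where
  "chk Q acc [] = True"
| "chk Q acc (X # rs) = Q acc"
| "chk Q acc (B # rs) = chk Q (E # acc) rs"
| "chk Q acc (D # rs) = chk Q (B # acc) rs"
| "chk Q acc (U # rs) =
    (case rs of y # z # zs \<Rightarrow> y = E \<and> (z = E \<or> z = U) \<longrightarrow> chk Q (B # acc) (D # cover1 z # zs)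
     | _ \<Rightarrow> True)"
| "chk Q acc (E # rs) =
    ((case rs of y # ys \<Rightarrow> y = E \<or> y = B \<longrightarrow> chk Q (D # acc) (cover2 y # ys) | [] \<Rightarrow> True) \<and>
     (case acc of p # ps \<Rightarrow> p = E \<longrightarrow> chk Q (D # B # ps) rs | [] \<Rightarrow> True) \<and>
     (case rs of y # z # zs \<Rightarrow> y = E \<and> (z = E \<or> z = U) \<longrightarrow> chk Q (E # acc) (D # cover1 z # zs)
      | _ \<Rightarrow> True) \<and>
     (case acc of p # ps \<Rightarrow>
        (case rs of y # ys \<Rightarrow> p = E \<and> (y = E \<or> y = B) \<longrightarrow> chk Q (B # B # ps) (cover2 y # ys) | [] \<Rightarrow> True)
      | [] \<Rightarrow> True))"

text \<open>The branches of \<open>chk\<close> as separate rules: orientation 0, orientation 1,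
  orientation 2 starting on \<open>E\<close> and on \<open>U\<close>, orientation 3.\<close>

lemma chk_tile:
  "chk Q acc (E # y # ys) \<Longrightarrow> y = E \<or> y = B \<Longrightarrow> chk Q (D # acc) (cover2 y # ys)"
  "chk Q (E # ps) (E # rs) \<Longrightarrow> chk Q (D # B # ps) rs"
  "chk Q acc (E # E # z # zs) \<Longrightarrow> z = E \<or> z = U \<Longrightarrow> chk Q (E # acc) (D # cover1 z # zs)"
  "chk Q acc (U # E # z # zs) \<Longrightarrow> z = E \<or> z = U \<Longrightarrow> chk Q (B # acc) (D # cover1 z # zs)"
  "chk Q (E # ps) (E # y # ys) \<Longrightarrow> y = E \<or> y = B \<Longrightarrow> chk Q (B # B # ps) (cover2 y # ys)"
  by (simp_all only: chk.simps list.case simp_thms)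

lemma chk_sound:
  fixes W :: nat and x :: int
  assumes pack: "packing W S"
  defines "Z \<equiv> {0..<int W} \<times> {x} - \<Union>S"
  defines "A \<equiv> \<lambda>r::nat. begun S x (int r) \<union> Z"
  assumes "r \<le> W"
    and "chk Q (map (\<lambda>i. rcode (A r) (x + 1) (int i)) (rev [0..<r]) @ [X])
           (map (\<lambda>i. rcode (A r) x (int i)) [r..<W] @ [X])"
  shows "Q (map (\<lambda>i. rcode (begun S (x + 1) 0) (x + 1) (int i)) (rev [0..<W]) @ [X])"
  using assms(4,5)
proof (induction "W - r" arbitrary: r)
  case 0
  then have "r = W" by simp
  \<comment> \<open>\<open>Z\<close> lies in column \<open>x\<close>, whereas these codes read
    columns \<open>x + 1\<close> and \<open>x + 2\<close>.\<close>
  moreover have "rcode (A W) (x + 1) i = rcode (begun S (x + 1) 0) (x + 1) i" for i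
    unfolding A_def begun_next_column[OF pack] by (auto simp: rcode_def Z_def)
  ultimately show ?case using 0 by simp
next
  case (Suc n)
  then have "r < W" by simp
  let ?R = "\<lambda>r i. rcode (A r) x (int i)" and ?O = "\<lambda>r i. rcode (A r) (x + 1) (int i)"
  let ?acc = "\<lambda>r. map (?O r) (rev [0..<r]) @ [X]"
  have status: "?R q i = (if (int i, x) \<in> A q then if (int i, x + 1) \<in> A q then D else B
                      else if (int i, x + 1) \<in> A q then U else E)"
    "?O q i = (if (int i, x + 1) \<in> A q then if (int i, x + 2) \<in> A q then D else B
                      else if (int i, x + 2) \<in> A q then U else E)" for q i
    unfolding rcode_def by (simp_all only: add.assoc one_add_one)
  note IH = Suc.hyps(1)[of "Suc r"]
  have n: "n = W - Suc r" "Suc r \<le> W" using Suc.hyps(2) by simp_all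
  have upt1: "[r..<W] = r # [Suc r..<W]" using \<open>r < W\<close> by (simp add: upt_conv_Cons)
  have upt2: "[Suc r..<W] = Suc r # [Suc (Suc r)..<W]" if "Suc r < W" using that by (simp add: upt_conv_Cons)
  have upt3: "[Suc (Suc r)..<W] = Suc (Suc r) # [Suc (Suc (Suc r))..<W]" if "Suc (Suc r) < W"
    using that by (simp add: upt_conv_Cons)
  note chk = Suc.prems(2)[unfolded upt1 list.map append_Cons]
  \<comment> \<open>Thus a row whose first cell is covered leaves \<open>E\<close> or
    \<open>B\<close> to the next column, as in the clauses of \<open>chk\<close> for
    \<open>B\<close> and \<open>D\<close>.\<close>
  have far: "(int r, x + 2) \<notin> A r"
    unfolding A_def using begun_far[OF pack, of "int r" "int r" x] by (auto simp: Z_def)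
  show ?case
  proof (cases "(int r, x) \<in> A r")
    case True
    have "(int r, x) \<in> begun S x (int r) \<or> (int r, x) \<notin> \<Union>S"
      using True by (auto simp: A_def Z_def)
    from begun_step_in[OF pack this] have eq: "A (Suc r) = A r"
      unfolding A_def by (simp add: add.commute)
    have "?R r r = B \<and> ?O r r = E \<or> ?R r r = D \<and> ?O r r = B"
      unfolding status using True far by simp
    then have "chk Q (?acc (Suc r)) (map (?R (Suc r)) [Suc r..<W] @ [X])"
      using chk unfolding eq by auto
    then show ?thesis by (rule IH[OF n])
  next
    case False
    then have "(int r, x) \<notin> begun S x (int r)" "(int r, x) \<in> \<Union>S"
      using \<open>r < W\<close> by (auto simp: A_def Z_def)
    then obtain k where k: "k < 4" "set (tcells k (int r) x) \<in> S"
      "begun S x (int r + 1) = begun S x (int r) \<union> set (tcells k (int r) x)"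
      "begun S x (int r) \<inter> set (tcells k (int r) x) = {}"
      "set (tcells k (int r) x) \<subseteq> {0..<int W} \<times> UNIV"
      by (rule begun_step_tile[OF pack])
    define t where "t = set (tcells k (int r) x)"
    have A': "A (Suc r) = A r \<union> t" using k(3) by (auto simp: A_def t_def add.commute)
    have "Z \<inter> t = {}" using k(2) by (auto simp: Z_def t_def)
    then have disj: "c \<notin> A r" if "c \<in> t" for c using k(4) that by (auto simp: A_def t_def)
    have inW: "0 \<le> fst c \<and> fst c < int W" if "c \<in> t" for c using k(5) that by (auto simp: t_def)
    \<comment> \<open>Orientations 1 and 3 reach back into row \<open>r - 1\<close>.
      \<open>chk\<close> tries them only if that row has code \<open>E\<close>, so code
      \<open>U\<close> has to be excluded.\<close>
    have up: "(int r - 1, x + 2) \<notin> A r" if "(int r - 1, x + 1) \<notin> A r"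
      using begun_bar[OF pack, of "int r - 1" x "int r"] that by (auto simp: A_def Z_def)
    consider "k = 0" | "k = 1" | "k = 2" | "k = 3" using k(1) by linarith
    then have "chk Q (?acc (Suc r)) (map (?R (Suc r)) [Suc r..<W] @ [X])"
    proof cases
      case 1
      have t: "t = {(int r, x), (int r, x + 1), (int r, x + 2), (int r + 1, x + 1)}"
        by (simp add: t_def 1 tcells_def)
      have W: "Suc r < W" using inW[of "(int r + 1, x + 1)"] by (simp add: t)
      have c: "?R r r = E" "?R r (Suc r) = E \<or> ?R r (Suc r) = B"
        "?R (Suc r) (Suc r) = cover2 (?R r (Suc r))" "?O (Suc r) r = D"
        using disj[of "(int r, x)"] disj[of "(int r, x + 1)"] disj[of "(int r + 1, x + 1)"]
        unfolding status unfolding A' by (simp_all add: t add.commute)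
      have m: "map (?R (Suc r)) [Suc (Suc r)..<W] = map (?R r) [Suc (Suc r)..<W]"
        "map (?O (Suc r)) (rev [0..<r]) = map (?O r) (rev [0..<r])"
        unfolding status unfolding A' by (simp_all add: t)
      show ?thesis using chk_tile(1)[of Q "?acc r"] chk c by (simp add: upt2[OF W] m del: chk.simps)
    next
      case 2
      have t: "t = {(int r, x), (int r, x + 1), (int r, x + 2), (int r - 1, x + 1)}"
        by (simp add: t_def 2 tcells_def)
      obtain q where q: "r = Suc q" using inW[of "(int r - 1, x + 1)"] by (cases r) (simp_all add: t)
      have c: "?R r r = E" "?O r q = E" "?O (Suc r) q = B" "?O (Suc r) r = D"
        using disj[of "(int r, x)"] disj[of "(int r, x + 1)"] disj[of "(int r - 1, x + 1)"] up
        unfolding status unfolding A' by (simp_all add: t q)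
      have m: "map (?R (Suc r)) [Suc r..<W] = map (?R r) [Suc r..<W]"
        "map (?O (Suc r)) (rev [0..<q]) = map (?O r) (rev [0..<q])"
        unfolding status unfolding A' by (simp_all add: t q)
      show ?thesis using chk_tile(2)[of Q] chk c by (simp add: q m[unfolded q] del: chk.simps)
    next
      case 3
      have t: "t = {(int r, x), (int r + 1, x), (int r + 2, x), (int r + 1, x + 1)}"
        by (simp add: t_def 3 tcells_def)
      have W: "Suc (Suc r) < W" using inW[of "(int r + 2, x)"] by (simp add: t)
      then have W': "Suc r < W" by simp
      have c: "?R r r = E \<and> ?O (Suc r) r = E \<or> ?R r r = U \<and> ?O (Suc r) r = B"
        "?R r (Suc r) = E" "?R (Suc r) (Suc r) = D"
        "?R r (Suc (Suc r)) = E \<or> ?R r (Suc (Suc r)) = U"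
        "?R (Suc r) (Suc (Suc r)) = cover1 (?R r (Suc (Suc r)))"
        using disj[of "(int r, x)"] disj[of "(int r + 1, x)"] disj[of "(int r + 2, x)"]
          disj[of "(int r + 1, x + 1)"] far
        unfolding status unfolding A' by (simp_all add: t add.commute)
      have m: "map (?R (Suc r)) [Suc (Suc (Suc r))..<W] = map (?R r) [Suc (Suc (Suc r))..<W]"
        "map (?O (Suc r)) (rev [0..<r]) = map (?O r) (rev [0..<r])"
        unfolding status unfolding A' by (simp_all add: t)
      show ?thesis using chk_tile(3,4)[of Q "?acc r" "?R r (Suc (Suc r))"
            "map (?R r) [Suc (Suc (Suc r))..<W] @ [X]"] chk c
        by (auto simp add: upt2[OF W'] upt3[OF W] m simp del: chk.simps)
    next
      case 4
      have t: "t = {(int r, x), (int r - 1, x + 1), (int r, x + 1), (int r + 1, x + 1)}"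
        by (simp add: t_def 4 tcells_def)
      obtain q where q: "r = Suc q" using inW[of "(int r - 1, x + 1)"] by (cases r) (simp_all add: t)
      have W: "Suc r < W" using inW[of "(int r + 1, x + 1)"] by (simp add: t)
      have c: "?R r r = E" "?O r q = E" "?O (Suc r) q = B" "?O (Suc r) r = B"
        "?R r (Suc r) = E \<or> ?R r (Suc r) = B" "?R (Suc r) (Suc r) = cover2 (?R r (Suc r))"
        using disj[of "(int r, x)"] disj[of "(int r, x + 1)"] disj[of "(int r - 1, x + 1)"]
          disj[of "(int r + 1, x + 1)"] up far
        unfolding status unfolding A' by (simp_all add: t q add.commute)
      have m: "map (?R (Suc r)) [Suc (Suc r)..<W] = map (?R r) [Suc (Suc r)..<W]"
        "map (?O (Suc r)) (rev [0..<q]) = map (?O r) (rev [0..<q])"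
        unfolding status unfolding A' by (simp_all add: t q)
      show ?thesis using chk_tile(5)[of Q] chk c
        by (simp add: upt2[OF W, unfolded q] q m[unfolded q] del: chk.simps)
    qed
    then show ?thesis by (rule IH[OF n])
  qed
qed

section \<open>The transfer automaton\<close>

definition state :: "nat \<Rightarrow> cell set set \<Rightarrow> int \<Rightarrow> status list" where
  "state W S x = map (\<lambda>i. rcode (begun S x 0) x (int i)) [0..<W] @ [X]"

definition flip :: "status list \<Rightarrow> status list" where
  "flip s = rev (butlast s) @ [X]"

lemma flip_flip [simp]: "flip (flip (s @ [X])) = s @ [X]"
  by (simp add: flip_def)

lemma column_gapless:
  assumes "packing W S" "gaps W S x 1 = 0" "chk Q [X] (state W S x)"
  shows "Q (flip (state W S (x + 1)))"
proof -
  have "{0..<int W} \<times> {x..<x + 1} - \<Union>S = {}" using assms(2) by (simp add: gaps_def)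
  then have "{0..<int W} \<times> {x} - \<Union>S = {}" by auto
  note chk_sound[OF assms(1), where r = 0 and x = x and Q = Q, unfolded this]
  then show ?thesis
    using assms(3) by (simp add: state_def flip_def rev_map)
qed

primrec one_gap :: "status list \<Rightarrow> status list list" where
  "one_gap [] = []"
| "one_gap (c # cs) = (if c = E then [B # cs] else []) @ map ((#) c) (one_gap cs)"

lemma one_gap_update: "i < length s \<Longrightarrow> s ! i = E \<Longrightarrow> s[i := B] \<in> set (one_gap s)"
proof (induction s arbitrary: i)
  case (Cons c s)
  then show ?case by (cases i) auto
qed simp

text \<open>A gap behaves like a cell that is already covered, which is why \<^const>\<open>chk\<close> need not know about gaps.\<close>

lemma column_one_gap:
  assumes "packing W S" "gaps W S x 1 = 1" "list_all (chk Q [X]) (one_gap (state W S x))"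
  shows "Q (flip (state W S (x + 1)))"
proof -
  have "{0..<int W} \<times> {x..<x + int 1} = {0..<int W} \<times> {x}" by auto
  then obtain c where c: "{0..<int W} \<times> {x} - \<Union>S = {c}"
    using assms(2) by (auto simp: gaps_def card_1_singleton_iff)
  then have "c \<in> {0..<int W} \<times> {x}" "c \<notin> \<Union>S" by auto
  then obtain i where i: "c = (int i, x)" "i < W" "(int i, x) \<notin> \<Union>S"
    by (cases c) (auto elim!: nonneg_int_cases)
  then have *: "(int i, x) \<notin> begun S x 0" by (auto simp: begun_def)
  \<comment> \<open>This excludes \<open>U\<close>, so the row of the gap has code \<open>E\<close>
    and \<open>one_gap\<close> lists its change to \<open>B\<close>.\<close>
  then have "(int i, x + 1) \<notin> begun S x 0" using begun_row(1)[OF assms(1)] by blast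
  then have "state W S x ! i = E" using * i by (simp add: state_def nth_append rcode_def)
  moreover have "(state W S x)[i := B] = map (\<lambda>j. rcode (begun S x 0 \<union> {c}) x (int j)) [0..<W] @ [X]"
    using \<open>(int i, x + 1) \<notin> begun S x 0\<close> i
    by (intro nth_equalityI) (auto simp: state_def nth_list_update nth_append rcode_def)
  ultimately have "chk Q [X] (map (\<lambda>j. rcode (begun S x 0 \<union> {c}) x (int j)) [0..<W] @ [X])"
    using one_gap_update[of i "state W S x"] assms(3) i by (simp add: list_all_iff state_def)
  then show ?thesis
    using chk_sound[OF assms(1), where r = 0 and x = x and Q = Q, unfolded c] by (simp add: state_def flip_def rev_map)
qed

subsection \<open>Reflection\<close>

text \<open>\<open>chk\<close> delivers the next state reversed, which is the state of the reflected
  packing. Since reflection preserves gaps, nothing has to be turned back, and one state of each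
  mirror pair needs to be listed.\<close>

definition mirror :: "nat \<Rightarrow> cell \<Rightarrow> cell" where
  "mirror W c = (int W - 1 - fst c, snd c)"

lemma mirror_mirror [simp]: "mirror W (mirror W c) = c"
  by (simp add: mirror_def)

lemma inj_mirror: "inj (mirror W)"
  by (metis injI mirror_mirror)

lemma in_mirror_image: "c \<in> mirror W ` A \<longleftrightarrow> mirror W c \<in> A"
  by (metis image_eqI mirror_mirror imageE)

text \<open>Reflection exchanges the two horizontal orientations. For the vertical bar of
  orientation 2 the least cell becomes the image of row \<open>r + 2\<close>, hence
  \<open>int W - 3 - r\<close>.\<close>

lemma mirror_tcells:
  "mirror W ` set (tcells k r x) =
    set (if k = 0 then tcells 1 (int W - 1 - r) x else if k = 1 then tcells 0 (int W - 1 - r) x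
         else if k = 2 then tcells 2 (int W - 3 - r) x else tcells 3 (int W - 1 - r) x)"
  by (auto simp: tcells_def mirror_def)

lemma is_T_tetromino_mirror: "is_T_tetromino t \<Longrightarrow> is_T_tetromino (mirror W ` t)"
proof -
  assume "is_T_tetromino t"
  then obtain k r x where k: "k < 4" "t = set (tcells k r x)" unfolding is_T_tetromino_iff by blast
  define l where "l = (if k = 0 then 1 else if k = 1 then 0 else k)"
  define q where "q = (if k = 2 then int W - 3 - r else int W - 1 - r)"
  have "mirror W ` t = set (tcells l q x)"
    unfolding k(2) mirror_tcells using k(1) by (simp add: l_def q_def tcells_def)
  moreover have "l < 4" using k(1) by (simp add: l_def)
  ultimately show ?thesis unfolding is_T_tetromino_iff by blast
qed

lemma packing_mirror: "packing W S \<Longrightarrow> packing W ((`) (mirror W) ` S)"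
  unfolding packing_def
proof (intro conjI ballI)
  assume S: "disjoint S \<and> (\<forall>t\<in>S. is_T_tetromino t \<and> t \<subseteq> {0..<int W} \<times> UNIV)"
  then show "disjoint ((`) (mirror W) ` S)"
    by (intro disjoint_image) (auto intro: inj_on_subset[OF inj_mirror])
  fix t assume "t \<in> (`) (mirror W) ` S"
  then obtain u where u: "u \<in> S" "t = mirror W ` u" by blast
  then show "is_T_tetromino t" using S is_T_tetromino_mirror by blast
  have "u \<subseteq> {0..<int W} \<times> UNIV" using S u by blast
  then show "t \<subseteq> {0..<int W} \<times> UNIV" unfolding u(2) by (auto simp: mirror_def)
qed

lemma Union_mirror: "\<Union>((`) (mirror W) ` S) = mirror W ` \<Union>S"
  by (simp add: image_Union)

lemma gaps_mirror: "gaps W ((`) (mirror W) ` S) x m = gaps W S x m"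
proof -
  have "{0..<int W} \<times> {x..<x + int m} - mirror W ` \<Union>S =
      mirror W ` ({0..<int W} \<times> {x..<x + int m} - \<Union>S)"
  proof (rule set_eqI)
    fix c
    show "c \<in> {0..<int W} \<times> {x..<x + int m} - mirror W ` \<Union>S \<longleftrightarrow>
        c \<in> mirror W ` ({0..<int W} \<times> {x..<x + int m} - \<Union>S)"
      unfolding in_mirror_image Diff_iff by (cases c) (auto simp: mirror_def)
  qed
  then show ?thesis
    unfolding gaps_def Union_mirror using card_image[OF inj_on_subset[OF inj_mirror subset_UNIV]] by simp
qed

text \<open>No cell of a column precedes row 0, so the order of rows drops out and the description
  is invariant under reflection.\<close>

lemma begun_0: "packing W S \<Longrightarrow> begun S x 0 = \<Union>{t \<in> S. \<exists>c\<in>t. snd c < x}"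
proof -
  assume S: "packing W S"
  have "c \<in> {0..<int W} \<times> UNIV" if "t \<in> S" "c \<in> t" for t c
    using S that unfolding packing_def by blast
  then have "(\<exists>c\<in>t. snd c < x \<or> snd c = x \<and> fst c < 0) \<longleftrightarrow> (\<exists>c\<in>t. snd c < x)" if "t \<in> S" for t
    using that by (intro bex_cong refl) fastforce
  then have "{t \<in> S. \<exists>c\<in>t. snd c < x \<or> snd c = x \<and> fst c < 0} = {t \<in> S. \<exists>c\<in>t. snd c < x}"
    by (intro Collect_cong conj_cong refl)
  then show ?thesis unfolding begun_def by simp
qed

lemma state_mirror:
  assumes "packing W S"
  shows "state W ((`) (mirror W) ` S) x = flip (state W S x)"
proof -
  have "{t \<in> (`) (mirror W) ` S. \<exists>c\<in>t. snd c < x} = (`) (mirror W) ` {t \<in> S. \<exists>c\<in>t. snd c < x}"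
  proof -
    have "(\<exists>c\<in>mirror W ` t. snd c < x) \<longleftrightarrow> (\<exists>c\<in>t. snd c < x)" for t
      by (simp add: mirror_def)
    then show ?thesis by blast
  qed
  then have b: "begun ((`) (mirror W) ` S) x 0 = mirror W ` begun S x 0"
    unfolding begun_0[OF assms] begun_0[OF packing_mirror[OF assms]] by (simp add: Union_mirror)
  have "rcode (mirror W ` begun S x 0) x (int i) = rcode (begun S x 0) x (int (W - Suc i))" if "i < W" for i
    unfolding rcode_def in_mirror_image using that by (simp add: mirror_def of_nat_diff algebra_simps)
  then show ?thesis
    unfolding state_def flip_def b by (intro nth_equalityI) (auto simp: nth_append rev_nth)
qed

subsection \<open>Potential bounds\<close>

text \<open>Two bits per row, the first row being least significant, below a leading one.\<close>

fun dec :: "num \<Rightarrow> status list" where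
  "dec (num.Bit0 (num.Bit0 n)) = E # dec n"
| "dec (num.Bit1 (num.Bit0 n)) = B # dec n"
| "dec (num.Bit1 (num.Bit1 n)) = D # dec n"
| "dec _ = [X]"

text \<open>The accumulator yields the reflected state directly, so that rewriting never has to
  reverse a list.\<close>

fun dec_rev :: "num \<Rightarrow> status list \<Rightarrow> status list" where
  "dec_rev (num.Bit0 (num.Bit0 n)) s = dec_rev n (E # s)"
| "dec_rev (num.Bit1 (num.Bit0 n)) s = dec_rev n (B # s)"
| "dec_rev (num.Bit1 (num.Bit1 n)) s = dec_rev n (D # s)"
| "dec_rev _ s = s"

lemma dec_rev: "\<exists>s. dec n = s @ [X] \<and> (\<forall>t. dec_rev n t = rev s @ t)"
  by (induction n rule: dec.induct) auto

lemma dec_flip: "\<exists>s. dec n = s @ [X] \<and> dec_rev n [X] = flip (s @ [X])"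
  using dec_rev[of n] by (auto simp: flip_def)

text \<open>The lists can hold ordinary numerals, while decoding matches on the constructors of
  \<open>num\<close> contained in them.\<close>

definition bits :: "nat \<Rightarrow> num" where
  "bits = num_of_nat"

lemma bits_numeral: "bits (numeral n) = n"
  by (simp add: bits_def num_of_nat_numeral_eq)

text \<open>Here \<open>i\<close> is the potential of \<open>s\<close>. Taking zero gaps shows that
  it must be at least the length of every gapless run from \<open>s\<close>.\<close>

definition claim :: "nat \<Rightarrow> nat \<Rightarrow> status list \<Rightarrow> nat \<Rightarrow> nat \<Rightarrow> bool" where
  "claim W P s i m \<longleftrightarrow> (\<forall>S x. packing W S \<longrightarrow> state W S x = s \<longrightarrow> m \<le> P * gaps W S x m + i)"

lemma claim_flip: "claim W P (flip s) i m \<Longrightarrow> claim W P s i m"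
  unfolding claim_def by (metis packing_mirror state_mirror gaps_mirror)

lemma claim_mono:
  assumes "claim W P s i m" "i \<le> j"
  shows "claim W P s j m"
  unfolding claim_def
proof (intro allI impI)
  fix S x assume "packing W S" "state W S x = s"
  then have "m \<le> P * gaps W S x m + i" using assms(1) unfolding claim_def by blast
  then show "m \<le> P * gaps W S x m + j" using assms(2) by linarith
qed

locale gap_bound =
  fixes W P Om :: nat and K :: "(nat \<times> nat) list"
begin

text \<open>\<open>Om\<close> is the constant for an arbitrary state. \<open>K\<close> lists better bounds for some states that have to be
  carried along in the induction on the number of columns, because the automaton has cycles with
  exactly one gap per \<open>P\<close> columns.\<close>

definition hyp :: "nat \<Rightarrow> bool" where
  "hyp N \<longleftrightarrow> (\<forall>m<N. (\<forall>S x. packing W S \<longrightarrow> m \<le> P * gaps W S x m + Om) \<and>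
                  (\<forall>(n, i)\<in>set K. claim W P (dec (bits n)) i m))"

text \<open>This includes \<open>m = N\<close>, the case that the induction has to prove.\<close>

definition good :: "status list \<Rightarrow> nat \<Rightarrow> bool" where
  "good s i \<longleftrightarrow> (\<forall>N. hyp N \<longrightarrow> (\<forall>m\<le>N. claim W P s i m))"

text \<open>Strictly fewer columns than \<open>N\<close>: this is all that is available for the
  entries of \<open>K\<close> before they are proved, and it suffices behind a column.\<close>

definition weak :: "status list \<Rightarrow> nat \<Rightarrow> bool" where
  "weak s i \<longleftrightarrow> (\<forall>N. hyp N \<longrightarrow> (\<forall>m<N. claim W P s i m))"

lemma good_mono: "good s i \<Longrightarrow> i \<le> j \<Longrightarrow> good s j"
  unfolding good_def using claim_mono by blast

lemma weak_mono: "weak s i \<Longrightarrow> i \<le> j \<Longrightarrow> weak s j"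
  unfolding weak_def using claim_mono by blast

lemma good_flip: "good (s @ [X]) i \<Longrightarrow> good (flip (s @ [X])) i"
  unfolding good_def using claim_flip[of W P "flip (s @ [X])"] by simp

lemma weak_flip: "weak (s @ [X]) i \<Longrightarrow> weak (flip (s @ [X])) i"
  unfolding weak_def using claim_flip[of W P "flip (s @ [X])"] by simp

lemma good_weak: "good s i \<Longrightarrow> weak s i"
  unfolding good_def weak_def by simp

lemma weak_K: "(n, i) \<in> set K \<Longrightarrow> weak (dec (bits n)) i"
  unfolding weak_def hyp_def by blast

text \<open>A column uses up one unit of the constant and each of its gaps refunds \<open>P\<close>.
  So \<open>j\<close> remains after a gapless column and \<open>P + j\<close> after one gap; once
  the remainder is at least \<open>Om\<close>, the bound for arbitrary states applies. What follows
  has \<open>k < N\<close> columns, which admits the induction hypothesis.\<close>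

lemma good_SucI:
  assumes step: "\<And>S x. packing W S \<Longrightarrow> state W S x = s \<Longrightarrow>
      gaps W S x 1 = 0 \<and> good (flip (state W S (x + 1))) j \<or>
      gaps W S x 1 = 1 \<and> weak (flip (state W S (x + 1))) (P + j) \<or>
      Om \<le> P * gaps W S x 1 + j"
  shows "good s (Suc j)"
  unfolding good_def claim_def
proof (intro allI impI)
  fix N m S x
  assume hyp: "hyp N" and "m \<le> N" and pack: "packing W S" and st: "state W S x = s"
  show "m \<le> P * gaps W S x m + Suc j"
  proof (cases m)
    case (Suc k)
    then have k: "k < N" using \<open>m \<le> N\<close> by simp
    have "k \<le> P * gaps W S x 1 + P * gaps W S (x + 1) k + j"
      using step[OF pack st]
    proof (elim disjE conjE)
      assume "good (flip (state W S (x + 1))) j"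
      from this[unfolded good_def, rule_format, OF hyp less_imp_le[OF k], THEN claim_flip,
        unfolded claim_def, rule_format, OF pack refl]
      show ?thesis by linarith
    next
      assume 1: "gaps W S x 1 = 1" and "weak (flip (state W S (x + 1))) (P + j)"
      from this(2)[unfolded weak_def, rule_format, OF hyp k, THEN claim_flip,
        unfolded claim_def, rule_format, OF pack refl]
      show ?thesis using 1 by simp
    next
      assume "Om \<le> P * gaps W S x 1 + j"
      moreover have "k \<le> P * gaps W S (x + 1) k + Om"
        using hyp[unfolded hyp_def, rule_format, OF k] pack by simp
      ultimately show ?thesis by linarith
    qed
    then show ?thesis unfolding Suc gaps_Suc[of W S x k] by (simp add: distrib_left)
  qed simp
qed

text \<open>Above this threshold for \<open>j\<close> one gap already refunds up to
  \<open>Om\<close>, so only gapless completions are enumerated.\<close>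

lemma good_gapless:
  assumes "Om \<le> P + j" "chk (\<lambda>t. good t j) [X] s"
  shows "good s (Suc j)"
proof (rule good_SucI)
  fix S x assume S: "packing W S" "state W S x = s"
  show "gaps W S x 1 = 0 \<and> good (flip (state W S (x + 1))) j \<or>
      gaps W S x 1 = 1 \<and> weak (flip (state W S (x + 1))) (P + j) \<or>
      Om \<le> P * gaps W S x 1 + j"
  proof (cases "gaps W S x 1")
    case 0
    then show ?thesis using column_gapless[OF S(1), of x "\<lambda>t. good t j"] assms(2) S(2) by simp
  next
    case (Suc g)
    then show ?thesis using assms(1) by simp
  qed
qed

text \<open>Below the threshold of \<open>good_gapless\<close> the states behind a single gap
  matter; two gaps refund up to \<open>Om\<close>.\<close>

lemma good_one_gap:
  assumes "Om \<le> 2 * P + j" "chk (\<lambda>t. good t j) [X] s"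
    "list_all (chk (\<lambda>t. weak t (P + j)) [X]) (one_gap s)"
  shows "good s (Suc j)"
proof (rule good_SucI)
  fix S x assume S: "packing W S" "state W S x = s"
  consider "gaps W S x 1 = 0" | "gaps W S x 1 = 1" | g where "gaps W S x 1 = Suc (Suc g)"
    by (metis One_nat_def not0_implies_Suc)
  then show "gaps W S x 1 = 0 \<and> good (flip (state W S (x + 1))) j \<or>
      gaps W S x 1 = 1 \<and> weak (flip (state W S (x + 1))) (P + j) \<or>
      Om \<le> P * gaps W S x 1 + j"
  proof cases
    case 1
    then show ?thesis using column_gapless[OF S(1), of x "\<lambda>t. good t j"] assms(2) S(2) by simp
  next
    case 2
    then show ?thesis using column_one_gap[OF S(1), of x "\<lambda>t. weak t (P + j)"] assms(3) S(2) by simp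
  next
    case 3
    then show ?thesis using assms(1) by simp
  qed
qed

end

section \<open>The states that some column can leave behind\<close>

text \<open>A tile reaching one column beyond the current one also covers a vertical neighbour in the current column.\<close>

definition lonely :: "status list \<Rightarrow> bool" where
  "lonely s \<longleftrightarrow> (\<exists>c t. s = D # c # t \<and> c \<noteq> B)"

text \<open>The list grows from the last row upwards. If its top is a \<open>D\<close> without a
  \<open>B\<close> below, only a \<open>B\<close> may be put above it, and the list must not end
  there.\<close>

primrec all_columns :: "(status list \<Rightarrow> bool) \<Rightarrow> nat \<Rightarrow> status list \<Rightarrow> bool" where
  "all_columns Q 0 s = (lonely s \<or> Q s)"
| "all_columns Q (Suc k) s =
    (all_columns Q k (B # s) \<and> (lonely s \<or> all_columns Q k (E # s) \<and> all_columns Q k (D # s)))"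

text \<open>With its gaps counted as covered, column \<open>x\<close> reads as a list over
  \<open>E\<close>, \<open>B\<close>, \<open>D\<close> without isolated \<open>D\<close>. Every
  state results from completing such a list, so no set of reachable states has to be
  computed.\<close>

lemma all_columns_state:
  assumes "packing W S" "all_columns (chk Q [X]) W [X]"
  shows "Q (flip (state W S (x + 1)))"
proof -
  let ?b = "begun S x 0" and ?Z = "{0..<int W} \<times> {x} - \<Union>S"
  let ?s = "map (\<lambda>i. rcode (?b \<union> ?Z) x (int i)) [0..<W] @ [X]"
  have len: "length ?s = Suc W" by simp
  \<comment> \<open>\<open>begun_row\<close> rules out \<open>U\<close>; a gap lies in column
    \<open>x\<close> and turns \<open>E\<close> into \<open>B\<close>.\<close>
  have nth: "?s ! i = (if (int i, x + 1) \<in> ?b then D else if (int i, x) \<in> ?b \<union> ?Z then B else E)" if "i < W" for i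
    using that begun_row(1)[OF assms(1), of "int i" x] by (auto simp: nth_append rcode_def)
  have nthW: "?s ! W = X" by (simp add: nth_append)
  have "\<Union>S \<subseteq> {0..<int W} \<times> UNIV" using assms(1) unfolding packing_def by blast
  moreover have "?b \<subseteq> \<Union>S" unfolding begun_def by blast
  ultimately have "?b \<subseteq> {0..<int W} \<times> UNIV" by (rule order_trans[rotated])
  then have out: "(int W, x) \<notin> ?b" "(- 1, x) \<notin> ?b" by auto
  \<comment> \<open>The premise denies a \<open>B\<close> above row \<open>k\<close>, and
    \<open>lonely\<close> denies one below; a \<open>D\<close> in row \<open>k\<close> needs one of
    them.\<close>
  have lonely: "\<not> lonely (drop k ?s)" if "k \<le> W" "k = 0 \<or> ?s ! (k - 1) \<noteq> B" for k
  proof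
    assume "lonely (drop k ?s)"
    then obtain c t where c: "drop k ?s = D # c # t" "c \<noteq> B" unfolding lonely_def by blast
    have "drop k ?s = ?s ! k # drop (Suc k) ?s" using len that(1) by (intro Cons_nth_drop_Suc[symmetric]) simp
    then have "?s ! k = D" and d: "drop (Suc k) ?s = c # t" using c(1) by (metis list.inject)+
    then have "k < W" using nthW that(1) by (cases "k = W") (simp_all del: nth_append)
    have "drop (Suc k) ?s = ?s ! Suc k # drop (Suc (Suc k)) ?s"
      using len \<open>k < W\<close> by (intro Cons_nth_drop_Suc[symmetric]) simp
    then have k1: "?s ! Suc k = c" using d by (metis list.inject)
    have "(int k, x + 1) \<in> ?b"
      using \<open>?s ! k = D\<close> nth[OF \<open>k < W\<close>] by (metis status.distinct)
    from begun_row(2)[OF assms(1) this] consider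
        "(int k - 1, x) \<in> ?b" "(int k - 1, x + 1) \<notin> ?b" | "(int k + 1, x) \<in> ?b" "(int k + 1, x + 1) \<notin> ?b"
      by blast
    then show False
    proof cases
      case 1
      then obtain j where "k = Suc j" using out(2) by (cases k) auto
      then show False using 1 that(2) \<open>k < W\<close> nth[of j] by simp
    next
      case 2
      then have "Suc k \<noteq> W" using out(1) by (auto simp: add.commute)
      then show False using 2 \<open>k < W\<close> c(2) k1 nth[of "Suc k"] by (simp add: add.commute)
    qed
  qed
  have "all_columns (chk Q [X]) k (drop k ?s)" if "k \<le> W" for k
    using that
  proof (induction "W - k" arbitrary: k)
    case 0
    then show ?case using assms(2) by simp
  next
    case (Suc n)
    have "n = W - Suc k" "Suc k \<le> W" using Suc by simp_all
    from Suc.hyps(1)[OF this] have "all_columns (chk Q [X]) (Suc k) (drop (Suc k) ?s)" .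
    moreover have "drop k ?s = ?s ! k # drop (Suc k) ?s"
      using \<open>Suc k \<le> W\<close> len by (intro Cons_nth_drop_Suc[symmetric]) simp
    moreover have "?s ! k = E \<or> ?s ! k = B \<or> ?s ! k = D"
      unfolding nth[OF Suc_le_lessD[OF \<open>Suc k \<le> W\<close>]] by simp
    moreover have "?s ! k \<noteq> B \<Longrightarrow> \<not> lonely (drop (Suc k) ?s)"
      using lonely[of "Suc k"] \<open>Suc k \<le> W\<close> by simp
    ultimately show ?case by auto
  qed
  from this[of 0] have "chk Q [X] ?s" using lonely[of 0] by simp
  then show ?thesis
    using chk_sound[OF assms(1), where r = 0 and x = x and Q = Q] by (simp add: state_def flip_def rev_map)
qed

text \<open>Induction on the number of columns: from \<open>hyp N\<close> the good bounds hold for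
  \<open>N\<close> columns, which gives \<open>hyp (Suc N)\<close>. The state at \<open>x\<close> is
  obtained from column \<open>x - 1\<close>, which exists because the strip is infinite.\<close>

theorem (in gap_bound) gaps_lower_bound:
  assumes "all_columns (chk (\<lambda>s. good s Om) [X]) W [X]" "\<forall>(n, i)\<in>set K. good (dec (bits n)) i" "packing W S"
  shows "m \<le> P * gaps W S x m + Om"
proof -
  have "hyp N" for N
  proof (induction N)
    case (Suc N)
    have "N \<le> P * gaps W S x N + Om" if "packing W S" for S x
    proof -
      have "good (flip (state W S x)) Om" using all_columns_state[OF that assms(1), of "x - 1"] by simp
      from this[unfolded good_def, rule_format, OF Suc.IH le_refl, THEN claim_flip]
      show ?thesis using that unfolding claim_def by blast
    qed
    moreover have "claim W P (dec (bits n)) i N" if "(n, i) \<in> set K" for n i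
      using assms(2) that Suc.IH unfolding good_def by blast
    ultimately show ?case
      using Suc.IH unfolding hyp_def by (auto simp: less_Suc_eq)
  qed (simp add: hyp_def)
  from this[of "Suc m"] assms(3) show ?thesis unfolding hyp_def by simp
qed

subsection \<open>Evaluation\<close>

text \<open>\<open>chk\<close> unrolled far enough that patterns decide all conditions, for
  evaluation without case distinctions. \<open>c \<noteq> E\<close> stands for a row above that is
  blocked or the border. The right-hand side \<open>True\<close> marks columns that no tiles
  complete.\<close>

lemma chk_eqs:
  "chk Q acc [X] = Q acc"
  "chk Q acc (B # rs) = chk Q (E # acc) rs"
  "chk Q acc (D # rs) = chk Q (B # acc) rs"
  "chk Q acc (U # E # E # rs) = chk Q (E # B # B # acc) rs"
  "chk Q (E # acc) (E # E # E # rs) = (chk Q (D # E # acc) (U # E # rs) \<and> chk Q (D # B # acc) (E # E # rs) \<and> chk Q (E # B # E # E # acc) rs \<and> chk Q (B # B # acc) (U # E # rs))"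
  "c \<noteq> E \<Longrightarrow> chk Q (c # acc) (E # E # E # rs) = (chk Q (D # c # acc) (U # E # rs) \<and> chk Q (E # B # E # c # acc) rs)"
  "chk Q acc (U # E # B # rs) = True"
  "chk Q (E # acc) (E # E # B # rs) = (chk Q (D # E # acc) (U # B # rs) \<and> chk Q (D # B # acc) (E # B # rs) \<and> chk Q (B # B # acc) (U # B # rs))"
  "c \<noteq> E \<Longrightarrow> chk Q (c # acc) (E # E # B # rs) = chk Q (D # c # acc) (U # B # rs)"
  "chk Q acc (U # E # D # rs) = True"
  "chk Q (E # acc) (E # E # D # rs) = (chk Q (D # E # acc) (U # D # rs) \<and> chk Q (D # B # acc) (E # D # rs) \<and> chk Q (B # B # acc) (U # D # rs))"
  "c \<noteq> E \<Longrightarrow> chk Q (c # acc) (E # E # D # rs) = chk Q (D # c # acc) (U # D # rs)"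
  "chk Q acc (U # E # U # rs) = chk Q (B # B # B # acc) rs"
  "chk Q (E # acc) (E # E # U # rs) = (chk Q (D # E # acc) (U # U # rs) \<and> chk Q (D # B # acc) (E # U # rs) \<and> chk Q (B # B # E # E # acc) rs \<and> chk Q (B # B # acc) (U # U # rs))"
  "c \<noteq> E \<Longrightarrow> chk Q (c # acc) (E # E # U # rs) = (chk Q (D # c # acc) (U # U # rs) \<and> chk Q (B # B # E # c # acc) rs)"
  "chk Q acc [U, E, X] = True"
  "chk Q (E # acc) [E, E, X] = (chk Q (D # E # acc) [U, X] \<and> chk Q (D # B # acc) [E, X] \<and> chk Q (B # B # acc) [U, X])"
  "c \<noteq> E \<Longrightarrow> chk Q (c # acc) [E, E, X] = chk Q (D # c # acc) [U, X]"
  "chk Q acc (U # B # rs) = True"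
  "chk Q (E # acc) (E # B # rs) = (chk Q (D # E # acc) (D # rs) \<and> chk Q (D # B # acc) (B # rs) \<and> chk Q (B # B # acc) (D # rs))"
  "c \<noteq> E \<Longrightarrow> chk Q (c # acc) (E # B # rs) = chk Q (D # c # acc) (D # rs)"
  "chk Q acc (U # D # rs) = True"
  "chk Q (E # acc) (E # D # rs) = chk Q (D # B # acc) (D # rs)"
  "c \<noteq> E \<Longrightarrow> chk Q (c # acc) (E # D # rs) = True"
  "chk Q acc (U # U # rs) = True"
  "chk Q (E # acc) (E # U # rs) = chk Q (D # B # acc) (U # rs)"
  "c \<noteq> E \<Longrightarrow> chk Q (c # acc) (E # U # rs) = True"
  "chk Q acc [U, X] = True"
  "chk Q (E # acc) [E, X] = chk Q (D # B # acc) [X]"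
  "c \<noteq> E \<Longrightarrow> chk Q (c # acc) [E, X] = True"
  by (simp_all split: list.split)

text \<open>\<open>chk\<close> quantifies over all gapless completions, so it accepts the false
  predicate only if there are none.\<close>

definition dead :: "status list \<Rightarrow> status list \<Rightarrow> bool" where
  "dead = chk (\<lambda>_. False)"

text \<open>At most one more gapless column is possible.\<close>

definition dead2 :: "status list \<Rightarrow> status list \<Rightarrow> bool" where
  "dead2 = chk (dead [X])"

lemma chk_mono: "chk Q acc rs \<Longrightarrow> (\<And>s. Q s \<Longrightarrow> R s) \<Longrightarrow> chk R acc rs"
  by (induction Q acc rs rule: chk.induct) (auto split: list.splits)

lemmas dead_eqs = chk_eqs[where Q = "\<lambda>_. False", folded dead_def]
  chk_eqs[where Q = "dead [X]", folded dead2_def]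

context gap_bound
begin

definition ck :: "nat \<Rightarrow> status list \<Rightarrow> status list \<Rightarrow> bool" where
  "ck j = chk (\<lambda>t. good t j)"

definition cw :: "nat \<Rightarrow> status list \<Rightarrow> status list \<Rightarrow> bool" where
  "cw j = chk (\<lambda>t. weak t j)"

lemmas ck_eqs = chk_eqs[where Q = "\<lambda>t. good t j" for j, folded ck_def]
lemmas cw_eqs = chk_eqs[where Q = "\<lambda>t. weak t j" for j, folded cw_def]

lemma good_dead: "Om < P + i \<Longrightarrow> 0 < i \<Longrightarrow> dead [X] s \<Longrightarrow> good s i"
  using good_gapless[of "i - 1" s] chk_mono[of "\<lambda>_. False" "[X]" s] by (simp add: dead_def)

text \<open>Together with \<open>good_dead\<close> this settles gapless runs of length 0 and 1 by
  computation; therefore the lists of runs begin with length 2.\<close>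

lemma good_dead2:
  assumes "Suc Om < P + i" "1 < i" "dead2 [X] s"
  shows "good s i"
proof -
  have "good t (i - 1)" if "dead [X] t" for t
    using good_dead[of "i - 1" t] that assms(1,2) by simp
  then show ?thesis
    using good_gapless[of "i - 1" s] chk_mono[of "dead [X]" "[X]" s] assms by (simp add: dead2_def)
qed

definition level :: "nat \<Rightarrow> nat list \<Rightarrow> bool" where
  "level j ns \<longleftrightarrow> list_all (\<lambda>n. good (dec (bits n)) (Suc j)) ns"

lemma level_gapless:
  "Om \<le> P + j \<Longrightarrow> list_all (\<lambda>n. ck j [X] (dec (bits n))) ns \<Longrightarrow> level j ns"
  unfolding level_def ck_def list_all_iff using good_gapless by blast

lemma level_one_gap:
  "Om \<le> 2 * P + j \<Longrightarrow>
    list_all (\<lambda>n. ck j [X] (dec (bits n)) \<and> list_all (cw (P + j) [X]) (one_gap (dec (bits n)))) ns \<Longrightarrow>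
    level j ns"
  unfolding level_def ck_def cw_def list_all_iff[of _ ns] using good_one_gap by blast

lemma good_dec: "good (dec n) i \<Longrightarrow> i \<le> j \<Longrightarrow> good (dec n) j \<and> good (dec_rev n [X]) j"
  using dec_flip[of n] good_mono good_flip by metis

lemma weak_dec: "weak (dec n) i \<Longrightarrow> i \<le> j \<Longrightarrow> weak (dec n) j \<and> weak (dec_rev n [X]) j"
  using dec_flip[of n] weak_mono weak_flip by metis

text \<open>Quantifying over all larger constants turns each listed state and its reflection into
  rewrite rules that also prove weaker bounds.\<close>

lemma level_good:
  "level j ns \<Longrightarrow> list_all (\<lambda>n. (\<forall>i>j. good (dec (bits n)) i) \<and> (\<forall>i>j. good (dec_rev (bits n) [X]) i)) ns"
  unfolding level_def list_all_iff using good_dec Suc_leI by blast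

lemma K_weak:
  "list_all (\<lambda>(n, i). (\<forall>j\<ge>i. weak (dec (bits n)) j) \<and> (\<forall>j\<ge>i. weak (dec_rev (bits n) [X]) j)) K"
  unfolding list_all_iff using weak_dec weak_K by blast

end

lemmas decode = list.pred_inject bits_numeral dec.simps dec_rev.simps

lemma all_columns_eqs:
  "\<not> lonely s \<Longrightarrow> all_columns Q (numeral k) s = (all_columns Q (pred_numeral k) (E # s) \<and>
    all_columns Q (pred_numeral k) (B # s) \<and> all_columns Q (pred_numeral k) (D # s))"
  "lonely s \<Longrightarrow> all_columns Q (numeral k) s = all_columns Q (pred_numeral k) (B # s)"
  "lonely s \<Longrightarrow> all_columns Q 0 s = True"
  "\<not> lonely s \<Longrightarrow> all_columns Q 0 s = Q s"
  by (auto simp: numeral_eq_Suc)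

lemma lonely_eqs:
  "lonely (E # s) = False" "lonely (B # s) = False" "lonely (X # s) = False"
  "lonely (D # B # s) = False" "c \<noteq> B \<Longrightarrow> lonely (D # c # s) = True"
  by (simp_all add: lonely_def)

lemmas eval_all = all_columns_eqs lonely_eqs pred_numeral_simps BitM.simps

section \<open>Lower bounds\<close>

subsection \<open>Width 5\<close>

text \<open>The lists contain each state up to reflection. In the names \<open>run5_2\<close> and \<open>excess5_2\<close> the second number
  is, for \<open>run\<close>, the largest number of columns that can be tiled without a gap from the listed states,
  where the next gap leads to an arbitrary state, and for \<open>excess\<close> the constant of the potential
  bound, which has to be better for the states on gapless runs of more than \<open>P\<close> columns. Every
  proved bound becomes a rewrite rule for the evaluation of the later ones.\<close>

definition K5 :: "(nat \<times> nat) list" where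
  "K5 = [
    (1863, 6), (1143, 6), (1149, 6), (1367, 6), (1373, 6)]"

global_interpretation g5: gap_bound 5 5 7 K5
  defines good5 = g5.good and weak5 = g5.weak
    and ck5 = g5.ck and cw5 = g5.cw and level5 = g5.level .

lemmas eval5 = decode simp_thms status.distinct g5.ck_eqs
lemmas eval5_gap = eval5 g5.cw_eqs one_gap.simps list.map append_Nil append_Cons if_True if_False arith_simps
lemmas dead5 = g5.good_dead g5.good_dead2 dead_eqs

declare g5.good_weak [simp]
lemmas K5_weak [simp] = g5.K_weak[unfolded K5_def, simplified decode prod.case simp_thms]

text \<open>\<open>L\<close> gapless columns and the column with the gap use \<open>L + 1\<close>;
  the gap refunds 5 and an arbitrary state needs 7. This gives the constant \<open>L + 3\<close>,
  here 5, and exactly 7 for \<open>L = 4\<close>. Successors not covered by earlier rules are tried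
  with the rules for dead states.\<close>

lemma run5_2 [THEN g5.level_good, simplified decode simp_thms, simp]: "level5 4 [
    1109, 1301, 1095, 1287, 1137, 1479, 1879]"
  by (rule g5.level_gapless, simp, simp only: eval5, (simp)?, (simp add: dead5)?)

lemma run5_3 [THEN g5.level_good, simplified decode simp_thms, simp]: "level5 5 [
    1024, 1025, 1028, 1111, 1303, 1309, 1140]"
  by (rule g5.level_gapless, simp, simp only: eval5, (simp)?, (simp add: dead5)?)

lemma run5_4 [THEN g5.level_good, simplified decode simp_thms, simp]: "level5 6 [
    1365, 1367, 1373, 1143, 1149]"
  by (rule g5.level_gapless, simp, simp only: eval5, (simp)?, (simp add: dead5)?)

text \<open>Constant 1 leaves 0 after a gapless column, and no rule supplies a state with 0. So the
  first column has a gap, behind which constant 5 is available.\<close>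

lemma excess5_1 [THEN g5.level_good, simplified decode simp_thms, simp]: "level5 0 [
    1040]"
  by (rule g5.level_one_gap, simp, simp only: eval5_gap, (simp)?, (simp add: dead5)?)

lemma excess5_2 [THEN g5.level_good, simplified decode simp_thms, simp]: "level5 1 [
    1041, 1044, 1089, 1092, 1281]"
  by (rule g5.level_one_gap, simp, simp only: eval5_gap, (simp)?, (simp add: dead5)?)

text \<open>From here on \<open>7 \<le> 5 + j\<close>, so the state behind a gap is
  irrelevant.\<close>

lemma excess5_3 [THEN g5.level_good, simplified decode simp_thms, simp]: "level5 2 [
    1037, 1405, 1031, 1399, 1879]"
  by (rule g5.level_gapless, simp, simp only: eval5, (simp)?, (simp add: dead5)?)

lemma excess5_4 [THEN g5.level_good, simplified decode simp_thms, simp]: "level5 3 [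
    1024, 1109, 1301, 1095, 1287]"
  by (rule g5.level_gapless, simp, simp only: eval5, (simp)?, (simp add: dead5)?)

lemma excess5_5 [THEN g5.level_good, simplified decode simp_thms, simp]: "level5 4 [
    1025, 1028, 1365, 1111, 1303]"
  by (rule g5.level_gapless, simp, simp only: eval5, (simp)?, (simp add: dead5)?)

text \<open>These are the states of \<open>K5\<close>: the bounds assumed for fewer columns are now
  proved, which closes the induction.\<close>

lemma excess5_6 [THEN g5.level_good, simplified decode simp_thms, simp]: "level5 5 [
    1149, 1373, 1143, 1863, 1367]"
  by (rule g5.level_gapless, simp, simp only: eval5, (simp)?, (simp add: dead5)?)

lemma excess5_7 [THEN g5.level_good, simplified decode simp_thms, simp]: "level5 6 [
    1105, 1108, 1297]"
  by (rule g5.level_gapless, simp, simp only: eval5, (simp)?, (simp add: dead5)?)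

lemma columns5: "all_columns (ck5 7 [X]) 5 [X]"
  by (simp only: eval_all eval5, (simp)?, (simp add: dead5)?)

lemma gaps5: "packing 5 S \<Longrightarrow> m \<le> 5 * gaps 5 S x m + 7"
  by (rule g5.gaps_lower_bound[folded g5.ck_def, OF columns5]) (simp_all add: K5_def bits_numeral)

subsection \<open>Width 7\<close>

definition K7 :: "(nat \<times> nat) list" where
  "K7 = [
    (29815, 8), (23671, 8), (24391, 8), (21981, 8), (23895, 8), (21975, 8), (18301, 8),
    (21885, 8), (21879, 8), (18391, 8), (18397, 8), (18295, 8), (30039, 8)]"

global_interpretation g7: gap_bound 7 7 9 K7
  defines good7 = g7.good and weak7 = g7.weak
    and ck7 = g7.ck and cw7 = g7.cw and level7 = g7.level .

lemmas eval7 = decode simp_thms status.distinct g7.ck_eqs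
lemmas eval7_gap = eval7 g7.cw_eqs one_gap.simps list.map append_Nil append_Cons if_True if_False arith_simps
lemmas dead7 = g7.good_dead g7.good_dead2 dead_eqs

declare g7.good_weak [simp]
lemmas K7_weak [simp] = g7.K_weak[unfolded K7_def, simplified decode prod.case simp_thms]

text \<open>\<open>Om - P\<close> is 2 as in width 5, so a run of \<open>L\<close> columns again has
  constant \<open>L + 3\<close>, which is \<open>Om = 9\<close> for \<open>L = 6\<close>.\<close>

lemma run7_2 [THEN g7.level_good, simplified decode simp_thms, simp]: "level7 4 [
    17493, 17685, 17745, 17748, 20565, 20757, 20817, 17479, 17671, 20551, 20743, 21837, 17521,
    17716, 20593, 20788, 17863, 20935, 18263, 21335, 21325, 23623, 23815, 24007, 24407, 29719,
    29767, 30071, 29911]"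
  by (rule g7.level_gapless, simp, simp only: eval7, (simp)?, (simp add: dead7)?)

lemma run7_3 [THEN g7.level_good, simplified decode simp_thms, simp]: "level7 5 [
    16384, 16385, 16388, 17412, 16407, 16455, 17415, 20487, 16397, 16413, 17421, 20493, 17524,
    17777, 17780, 20596, 17783, 20855, 17789, 20861, 16593, 16596, 17879, 20951, 20957, 18253,
    23831, 23837, 29783, 29975]"
  by (rule g7.level_gapless, simp, simp only: eval7, (simp)?, (simp add: dead7)?)

lemma run7_4 [THEN g7.level_good, simplified decode simp_thms, simp]: "level7 6 [
    16405, 16448, 16465, 16468, 16469, 21845, 17751, 20823, 21783, 21847, 16461, 17757, 20829,
    21789, 21853, 16436, 21873, 21876, 17527, 20599, 17533, 20605, 17877, 17908, 18199, 18205,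
    18289, 18292, 23639, 23901, 23677]"
  by (rule g7.level_gapless, simp, simp only: eval7, (simp)?, (simp add: dead7)?)

lemma run7_5 [THEN g7.level_good, simplified decode simp_thms, simp]: "level7 7 [
    16401, 16404, 16449, 16452, 20481, 20821, 16391, 17495, 17687, 20567, 20807, 21831, 17693,
    20765, 20813, 20849, 20852, 20945, 20949, 20980, 18247, 21319]"
  by (rule g7.level_gapless, simp, simp only: eval7, (simp)?, (simp add: dead7)?)

lemma run7_6 [THEN g7.level_good, simplified decode simp_thms, simp]: "level7 8 [
    17409, 17749, 17735, 20759, 17741, 21879, 21885, 17873, 21975, 21981, 18301, 18391, 18397,
    23671, 30039, 29815]"
  by (rule g7.level_gapless, simp, simp only: eval7, (simp)?, (simp add: dead7)?)

text \<open>For the constants 1 and 2 the inequality \<open>9 \<le> 7 + j\<close> fails, so the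
  states behind a gap are examined.\<close>

lemma excess7_1 [THEN g7.level_good, simplified decode simp_thms, simp]: "level7 0 [
    16653, 16668, 16661, 16647]"
  by (rule g7.level_one_gap, simp, simp only: eval7_gap, (simp)?, (simp add: dead7)?)

lemma excess7_2 [THEN g7.level_good, simplified decode simp_thms, simp]: "level7 1 [
    16657, 16660, 16705, 16708, 16885, 17425, 17428, 17473, 17476, 17665, 20497, 20545]"
  by (rule g7.level_one_gap, simp, simp only: eval7_gap, (simp)?, (simp add: dead7)?)

lemma excess7_3 [THEN g7.level_good, simplified decode simp_thms, simp]: "level7 2 [
    16509, 16605, 22493, 22397, 16503, 16599, 29703, 23559, 21767, 23927, 24407, 30071, 22391,
    22487]"
  by (rule g7.level_gapless, simp, simp only: eval7, (simp)?, (simp add: dead7)?)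

lemma excess7_4 [THEN g7.level_good, simplified decode simp_thms, simp]: "level7 3 [
    16385, 16388, 17521, 17524, 17493, 17685, 17745, 17748, 20565, 20757, 17479, 17671, 20551,
    20743]"
  by (rule g7.level_gapless, simp, simp only: eval7, (simp)?, (simp add: dead7)?)

lemma excess7_5 [THEN g7.level_good, simplified decode simp_thms, simp]: "level7 4 [
    16384, 16461, 16593, 16596, 16469, 17421, 17789, 20493, 20861, 16407, 16455, 17415, 17783,
    20487, 20855, 21847]"
  by (rule g7.level_gapless, simp, simp only: eval7, (simp)?, (simp add: dead7)?)

lemma excess7_6 [THEN g7.level_good, simplified decode simp_thms, simp]: "level7 5 [
    16405, 17533, 17877, 17757, 20605, 20949, 20829, 21789, 21845, 16391, 17527, 17751, 20599,
    20823, 21783, 21831]"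
  by (rule g7.level_gapless, simp, simp only: eval7, (simp)?, (simp add: dead7)?)

lemma excess7_7 [THEN g7.level_good, simplified decode simp_thms, simp]: "level7 6 [
    16401, 16404, 16449, 16452, 17409, 17749, 20481, 20849, 20852, 20821, 17495, 17687, 20567,
    20759]"
  by (rule g7.level_gapless, simp, simp only: eval7, (simp)?, (simp add: dead7)?)

text \<open>The states of \<open>K7\<close>, with the constant assumed for them.\<close>

lemma excess7_8 [THEN g7.level_good, simplified decode simp_thms, simp]: "level7 7 [
    18301, 18397, 21885, 21981, 18295, 18391, 23671, 29815, 24391, 21975, 23895, 21879, 30039]"
  by (rule g7.level_gapless, simp, simp only: eval7, (simp)?, (simp add: dead7)?)

lemma excess7_9 [THEN g7.level_good, simplified decode simp_thms, simp]: "level7 8 [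
    17489, 17492, 17681, 17684, 17729, 20561, 20753, 16471]"
  by (rule g7.level_gapless, simp, simp only: eval7, (simp)?, (simp add: dead7)?)

lemma columns7: "all_columns (ck7 9 [X]) 7 [X]"
  by (simp only: eval_all eval7, (simp)?, (simp add: dead7)?)

lemma gaps7: "packing 7 S \<Longrightarrow> m \<le> 7 * gaps 7 S x m + 9"
  by (rule g7.gaps_lower_bound[folded g7.ck_def, OF columns7]) (simp_all add: K7_def bits_numeral)

subsection \<open>Width 11\<close>

text \<open>Some entries are weaker than what is proved for these states in the end; monotonicity
  bridges the difference.\<close>

definition K11 :: "(nat \<times> nat) list" where
  "K11 = [
    (4472849, 42), (6118679, 41), (6151511, 39), (6145911, 39), (6149495, 39), (6059895, 39),
    (4207735, 41), (6117239, 39), (4215927, 41), (4683101, 41), (4653405, 41), (5332295, 39),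
    (5627351, 39), (4685079, 41), (4208500, 41), (5332433, 39), (4457297, 40), (4457809, 40),
    (4207965, 41), (5601143, 39), (4683549, 41), (6108279, 41), (4216692, 41), (6116471, 41)]"

global_interpretation g11: gap_bound 11 35 43 K11
  defines good11 = g11.good and weak11 = g11.weak
    and ck11 = g11.ck and cw11 = g11.cw and level11 = g11.level .

lemmas eval11 = decode simp_thms status.distinct g11.ck_eqs
lemmas eval11_gap = eval11 g11.cw_eqs one_gap.simps list.map append_Nil append_Cons if_True if_False arith_simps
lemmas dead11 = g11.good_dead g11.good_dead2 dead_eqs

declare g11.good_weak [simp]
lemmas K11_weak [simp] = g11.K_weak[unfolded K11_def, simplified decode prod.case simp_thms]

section \<open>Gapless runs in width 11\<close>

text \<open>Here \<open>Om - P = 8\<close>, so \<open>L\<close> gapless columns give the constant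
  \<open>L + 9\<close>. Long levels are cut into pieces, which do not depend on each other.\<close>

lemma run11_2_a [THEN g11.level_good, simplified decode simp_thms, simp]: "level11 10 [
    4198485, 4473941, 4474133, 4474193, 4474196, 4476945, 4477013, 4477205, 4478273, 4478276,
    4522325, 4523093, 4523285, 4523345, 4523348, 4526165, 4526357, 4542549, 4543505, 4543553,
    5260373, 5260565, 5260625, 5263377, 5263445, 5263637, 5264705, 5308757, 5309525, 5309717,
    5309777, 5312597, 5312789, 5328981, 5587285, 5588053, 4194647, 4195591, 4198423, 4198471,
    4198663, 4199687, 4211031, 4211975, 4214807, 4215127, 4216071, 4456711, 4457735, 4473927,
    4474119, 4476951, 4476999, 4477191, 4478215, 4522247, 4522311, 4523079, 4523271, 4526103,
    4526151, 4526343, 4527367, 4538711, 4539655, 4542487, 4542535, 4542727, 4543511, 4543559,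
    4543751, 5243143, 5244167, 5260359, 5260551, 5263383, 5263431, 5263623, 5264647, 5308679,
    5308743, 5309511, 5309703, 5312535, 5312583, 5312775, 5313799, 5325143, 5326087, 5328919,
    5328967, 5329159, 5329943, 5329991, 5330183, 5570567, 5570823, 5574679, 5574999, 5575703,
    5575751, 5575943, 5587223, 5587271, 5587287, 5587991, 5588039, 5588231, 5591063, 5591111,
    5591303, 5592327, 4478285, 4543517, 4543565, 5264717, 5308749, 5329949, 5329997, 5574989,
    5575709, 5575757, 5587229, 5587277, 5587997, 5588045, 4198513, 4473969, 4474164, 4477041,
    4477236, 4522353, 4523121, 4523316, 4526193, 4526388, 4542577, 5260401, 5260596, 5263473,
    5263668, 5308785, 5309553, 5309748, 5312625, 5312820, 5329009, 5570929, 5576049, 5576052,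
    5587313, 5587316, 5588081, 5591153, 5576055, 5587319, 5576061, 5587325, 4543697, 4543700,
    5308881, 5308884, 5308885, 5330129, 5330132, 5575889, 5575892, 5587392, 5587409, 5587412,
    5587413, 5588177, 5588180, 4194759, 4195783, 4198855, 4199879, 4211143, 4212167, 4215239,
    4216263, 4456903, 4457927, 4474311, 4477383, 4478407, 4523463, 4526535, 4527559, 4538823,
    4539847, 4542919, 4543703, 4543943, 5243335, 5244359, 5260743, 5263815, 5264839, 5308871,
    5309895, 5312967, 5313991, 5325255, 5326279, 5329351, 5330135, 5330375, 5571015, 5575111,
    5575895, 5576135, 5587399, 5587415, 5588183, 5588423, 5591495, 5592519, 4543709, 5330141]"
  by (rule g11.level_gapless, simp, simp only: eval11, (simp)?, (simp add: dead11)?)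

lemma run11_2_b [THEN g11.level_good, simplified decode simp_thms, simp]: "level11 10 [
    5575901, 5587421, 5588189, 5308916, 5587444, 4458321, 4474641, 4474644, 4477761, 4477764,
    4478801, 4522833, 4523793, 4523796, 4526913, 4526916, 5244753, 5261073, 5261076, 5264193,
    5264196, 5265233, 5309265, 5309268, 5310225, 5310228, 5313345, 5313348, 5592913, 5592916,
    4196183, 4199255, 4212567, 4216663, 4457303, 4458327, 4474711, 4477783, 4478807, 4522839,
    4523863, 4526935, 4540247, 4543319, 4544343, 5243735, 5244759, 5261143, 5264215, 5265239,
    5309271, 5310295, 5313367, 5326679, 5329751, 5330775, 5571415, 5588823, 5591895, 5592919,
    4477773, 4526925, 5264205, 5313357, 4197653, 4197713, 4197716, 4201557, 4214037, 4214097,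
    4214100, 4217941, 4480085, 4529237, 4541717, 4541777, 4541780, 4545617, 4545621, 5266517,
    5315669, 5328149, 5328209, 5332053, 5577813, 5590357, 4197639, 4201543, 4201735, 4214023,
    4217927, 4218119, 4459783, 4480071, 4480263, 4529223, 4529415, 4541703, 4545607, 4545623,
    4545799, 5246215, 5266503, 5266695, 5315655, 5315847, 5328135, 5332039, 5332055, 5332231,
    5577799, 5577815, 5577991, 5590279, 5590295, 5590343, 5590359, 5594183, 5594375, 5590301,
    5590349, 4197684, 4201585, 4214068, 4217969, 4480113, 4529265, 4541748, 4545649, 4545652,
    5266545, 5315697, 5328180, 5332081, 5332084, 5577841, 5577844, 5590324, 5590385, 5590388,
    5594225, 4545655, 5332087, 5577847, 5590391, 4217981, 4545661, 5332093, 5577853, 5590397,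
    5590481, 5590484, 4201927, 4218311, 4480455, 4529607, 4545991, 5266887, 5316039, 5332423,
    5578183, 5590487, 5594567, 5590493, 4546385, 4546388, 5332817, 5332820, 5578577, 5578580,
    4202327, 4218711, 4480855, 4530007, 4546391, 5267287, 5316439, 5332823, 5578583, 5594967,
    4207879, 4485143, 4485463, 4486407, 4535319, 4535367, 4535559, 4550679, 4550999, 4551943,
    4552007, 5271575, 5271895, 5272839, 5321751, 5321799, 5321991, 5337111, 5337431, 5338439,
    5599255, 5599575, 5600519, 4485453, 4535325, 4535373, 5271885, 5321757, 5321805, 5338445,
    4207985, 4486513, 4535665, 4535668, 4552049, 5272945, 5322097, 5322100, 5600625, 4535671]"
  by (rule g11.level_gapless, simp, simp only: eval11, (simp)?, (simp add: dead11)?)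

lemma run11_2_c [THEN g11.level_good, simplified decode simp_thms, simp]: "level11 10 [
    5322103, 4535677, 5322109, 4535505, 4535508, 5321937, 5321940, 5338577, 5338581, 4208071,
    4485575, 4486599, 4535511, 4535751, 4551111, 5272007, 5273031, 5321943, 5322183, 5337543,
    5338567, 5599687, 5600711, 4535517, 5321949, 5338612, 4552529, 4208471, 4486999, 4536151,
    4552535, 5273431, 5322583, 5601111, 4488455, 4553991, 5274887, 5340423, 5602567, 4554036,
    5340468, 4247623, 4247815, 4572231, 4572423, 4575255, 4575303, 4575495, 4576519, 5358663,
    5358855, 5361687, 5361735, 5361927, 5362951, 5623831, 5623879, 5624071, 5625095, 4247665,
    4572273, 4572468, 4575345, 5358705, 5358900, 5361777, 5623921, 4248007, 4249031, 4572615,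
    4575687, 5359047, 5362119, 5363143, 5624263, 5625287, 4248407, 4573015, 4576087, 5359447,
    5362519, 5363543, 5624663, 5625687, 4250887, 4578375, 4578567, 5364807, 5364999, 5627143,
    4578417, 5364849, 4578759, 5365191, 4579159, 5365591, 4584711, 5371143, 4584817, 5371249,
    4584903, 5371335, 4585303, 5371735, 4653063, 4653319, 4657175, 4657495, 4658199, 4658247,
    4658439, 4669783, 4670727, 4673559, 4673607, 4673799, 4674823, 5456151, 5456199, 5456215,
    5456919, 5456967, 5457159, 5459991, 5460039, 5460231, 5461255, 4657485, 4658205, 4658253,
    5456157, 5456205, 5456925, 5456973, 4653425, 4658545, 4658548, 4673649, 5456241, 5457009,
    4658551, 5456247, 4658557, 5456253, 4653511, 4657607, 4658391, 4658631, 4669895, 4670919,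
    4673991, 4675015, 5456327, 5456343, 5457111, 5457351, 5460423, 5461447, 4658397, 5456349,
    5457117, 5456372, 4653911, 4671319, 4674391, 4675415, 5457751, 5460823, 5461783, 5461831,
    5461789, 5461837, 5461873, 5461876, 5461879, 5461885, 5461975, 5461981, 4660295, 4660311,
    4660487, 4672775, 4676679, 4676871, 5459207, 5459223, 5459271, 5459287, 5463111, 5463303,
    5459229, 5459277, 4660337, 4660340, 4676721, 5459313, 4660343, 5459319, 4660349, 5459325,
    4660679, 4677063, 5459415, 5463495, 5459421, 4661079, 4677463, 5463895, 4681751, 4682071,
    4683015, 5469447, 4682183, 4683207, 5469639, 4683607, 5470039, 4685063, 4706327, 4706375]"
  by (rule g11.level_gapless, simp, simp only: eval11, (simp)?, (simp add: dead11)?)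

lemma run11_2_d [THEN g11.level_good, simplified decode simp_thms, simp]: "level11 10 [
    4706567, 4707591, 4706759, 4707783, 4707159, 4708183, 4709639, 6029575, 6046791, 6046983,
    6049815, 6049863, 6050055, 6051079, 6095943, 6096135, 6098967, 6099015, 6099207, 6100231,
    6115351, 6115671, 6116615, 6051149, 6029767, 6030791, 6047175, 6050247, 6051271, 6096327,
    6099399, 6100423, 6115783, 6116807, 6030167, 6047575, 6050647, 6051671, 6096727, 6099799,
    6117207, 6050637, 6032647, 6052935, 6053127, 6102087, 6102279, 6118663, 6053319, 6102471,
    6053719, 6102871, 6058007, 6058327, 6059271, 6108423, 6108541, 6058439, 6059463, 6108615,
    6059863, 6109015, 6061319, 6145095, 6145287, 6148167, 6148359, 6145479, 6148551, 6145879,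
    6148951, 6151239, 6151431, 6151623, 6152023, 6157575, 6157693, 6157767, 6158167, 6242647,
    6243591, 6246423, 6246471, 6246663, 6247687, 6242759, 6243783, 6246855, 6247879, 6244183,
    6247255, 6248215, 6248407, 6245639, 6245719, 6249543, 6249735, 6249927, 6250327, 6255879,
    6256071, 6256471, 7602439, 7606295, 7606551, 7606599, 7606615, 7607319, 7607367, 7607383,
    7607559, 7607575, 7607623, 7607639, 7618839, 7618887, 7618903, 7619607, 7619655, 7622679,
    7667991, 7668055, 7684439, 7688535, 7606647, 7607415, 7607671, 7618935, 7668087, 7688311,
    7602631, 7603655, 7606727, 7606743, 7607511, 7607751, 7619015, 7619031, 7619799, 7620039,
    7623111, 7624135, 7668167, 7669191, 7672263, 7673287, 7684551, 7685575, 7688647, 7689671,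
    7603031, 7608087, 7608135, 7620439, 7623511, 7624535, 7668551, 7668567, 7669591, 7672663,
    7685975, 7689031, 7689047, 7690071, 7608183, 7608279, 7605511, 7609415, 7609431, 7609607,
    7609623, 7609671, 7609687, 7621911, 7621959, 7621975, 7609463, 7609719, 7622007, 7609799,
    7609815, 7622103, 7626183, 7675335, 7691719, 7610183, 7610199, 7626583, 7675735, 7692119,
    7696759, 7697527, 7631303, 7632327, 7681479, 7696839, 7696855, 7697623, 7697863, 7632727,
    7681879, 7698295, 7698391, 7699831, 7699927, 7655543, 7655799, 7656567, 7656823, 7655879,
    7655895, 7656663, 7656903, 7656919, 7657335, 7657431, 7658871, 7658967]"
  by (rule g11.level_gapless, simp, simp only: eval11, (simp)?, (simp add: dead11)?)

lemma run11_3_a [THEN g11.level_good, simplified decode simp_thms, simp]: "level11 11 [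
    4194560, 4194577, 4194580, 4194625, 4194628, 4194641, 4194644, 4194645, 4195328, 4195345,
    4195348, 4195393, 4195396, 4195413, 4198420, 4211028, 4214804, 4215124, 4456469, 4457749,
    4477265, 4477268, 4478228, 4521985, 4522257, 4522260, 4522261, 4522321, 4522324, 4526097,
    4526420, 4527380, 4527425, 4538708, 4542545, 4542737, 4542741, 4542785, 4542804, 5242897,
    5242901, 5244181, 5263697, 4194583, 4194631, 4195351, 4195399, 4522263, 4522327, 4542551,
    4542807, 5570887, 5576007, 4194589, 4194637, 4195357, 4195405, 4522269, 4522333, 4527437,
    4542797, 4542813, 5329229, 4194417, 4194420, 4194673, 4194676, 4195441, 4195444, 4198516,
    4456500, 4457780, 4473972, 4477044, 4522292, 4522356, 4523124, 4526196, 4542580, 4542772,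
    5242932, 5244212, 5260404, 5263476, 5308788, 5309556, 5312628, 5329012, 5570932, 5588084,
    5591156, 4194423, 4194679, 4457591, 4522359, 4542583, 5329015, 4194429, 4194685, 4457597,
    4522365, 4542589, 5329021, 4194516, 4194752, 4194769, 4194772, 4194773, 4195537, 4195540,
    5571025, 5571028, 5576145, 5576148, 4194519, 4194775, 4195543, 4194525, 4194781, 4195549,
    4194804, 4196180, 4199252, 4200276, 4212564, 4216660, 4457300, 4458240, 4458257, 4458260,
    4458305, 4458308, 4458325, 4474708, 4477780, 4522817, 4522820, 4522837, 4523841, 4523860,
    4526932, 4527956, 4540244, 4543297, 4543300, 4543313, 4543316, 4543317, 4544340, 5243732,
    5244672, 5244689, 5244692, 5244737, 5244740, 5244757, 5261140, 5264212, 5310273, 5310292,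
    5313364, 5314388, 5326676, 5329748, 5330772, 5571412, 5576532, 5588820, 5591892, 4458263,
    4458311, 4522823, 4543303, 5244695, 5244743, 4458269, 4458317, 4522829, 4543309, 5244701,
    5244749, 4458353, 4458356, 4522868, 4543348, 5244785, 5244788, 4458359, 5244791, 4458365,
    5244797, 4458449, 4458452, 5244881, 5244884, 4212695, 4458455, 5244887]"
  by (rule g11.level_gapless, simp, simp only: eval11, (simp)?, (simp add: dead11)?)

lemma run11_3_b [THEN g11.level_good, simplified decode simp_thms, simp]: "level11 11 [
    4212701, 4458461, 5244893, 4197632, 4197649, 4197652, 4197696, 4197697, 4197700, 4197717,
    4201476, 4197655, 4197703, 4197719, 4201479, 4459799, 4459847, 5246279, 4197661, 4197709,
    4201485, 4459805, 4197745, 4197748, 4201588, 4201841, 4201844, 4217972, 4459889, 4459892,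
    4480116, 4529268, 5246321, 5246324, 5266548, 5315700, 5594228, 4197751, 4201847, 4217975,
    4459895, 5246327, 4197757, 4201853, 4459901, 5246333, 4197841, 4197844, 4201920, 4201940,
    4459985, 4459988, 5246417, 5246420, 4197847, 4201943, 4459991, 5246423, 4197853, 4201949,
    4459997, 5246429, 4202324, 4218708, 4480852, 4530004, 5267284, 5316436, 5594964, 4207943,
    4486471, 4535623, 4550663, 4550935, 4550983, 4551703, 4551751, 4551767, 4551959, 4552023,
    5272903, 5322055, 5600583, 4550669, 4550941, 4550989, 4551709, 4551757, 4551965, 4552029,
    4207988, 4486516, 4550708, 4551025, 4551028, 4551793, 4551796, 4551988, 4552052, 5272948,
    5338484, 5600628, 4551031, 4551799, 4552055, 4551037, 4551805, 4552061, 4208081, 4208084,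
    4486609, 4486612, 4535761, 4535764, 4551104, 4551121, 4551124, 4551125, 4551889, 4551892,
    5273041, 5273044, 5322193, 5322196, 5600721, 5600724, 4551127, 4551895, 4551133, 4551901,
    4551156, 4208468, 4486996, 4536148, 4552465, 4552513, 4552533, 4552471, 4552519, 4552477,
    4552525, 4552561, 4552564, 4552567, 5338999, 4552573, 5339005, 4552657, 4552660, 4552663,
    5339095, 4552669, 5339101, 4554007, 4554055, 4554071, 4554013, 4554061, 4554097, 4554100,
    5340529, 5340532, 4554103, 5340535, 4554109, 5340541, 4554193, 4554196, 5340628, 4554199,
    5340631, 4554205, 5340637, 4247559, 4571159, 4571207, 5357639, 4247565, 4571165, 4247668,
    4571249, 4571252, 4572276, 4575284, 4575348, 4576564, 5357681, 5357684, 5358708, 5361716,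
    5361780, 5362996, 5623924, 4248695, 4571255, 5357687, 4248701, 4571261]"
  by (rule g11.level_gapless, simp, simp only: eval11, (simp)?, (simp add: dead11)?)

lemma run11_3_c [THEN g11.level_good, simplified decode simp_thms, simp]: "level11 11 [
    5357693, 4248000, 4571345, 4571348, 5357777, 4248023, 4571351, 5357783, 4248029, 4571357,
    5357789, 4577047, 4577095, 5363479, 5363527, 4577053, 4577101, 5363485, 5363533, 4577137,
    4577140, 5363569, 5363572, 4577143, 5363575, 4577149, 5363581, 4577233, 4577236, 5363665,
    5363668, 4577239, 5363671, 4577245, 5363677, 4250903, 4250951, 4578311, 4578583, 5364743,
    5365063, 4250909, 4578317, 4578589, 5364749, 4578420, 4578673, 4578676, 5364852, 5365105,
    5365108, 4578679, 5365111, 4578685, 5365117, 4251089, 4251092, 4578769, 5365201, 4578775,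
    5365207, 5365213, 4584775, 5371207, 4584820, 5371252, 4584823, 5371255, 4584829, 5371261,
    4653383, 4658503, 4669463, 4669511, 4669719, 4669767, 4670487, 4670535, 5455895, 5455943,
    4669469, 4669725, 4669773, 4670493, 4670541, 5455901, 4653428, 4669809, 4669812, 4670577,
    4670580, 4669815, 4674679, 5461111, 4669821, 4674685, 5461117, 4669911, 4670679, 4669917,
    4670685, 4669940, 4675351, 4675399, 4675357, 4675405, 4675441, 4675444, 4675447, 4675453,
    4675543, 4675549, 4672791, 4672839, 4672855, 4676887, 4676935, 5463319, 5463367, 4672797,
    4672845, 4676893, 5463325, 4672881, 4672884, 4672887, 4672893, 4672983, 4672989, 4683079,
    5469511, 6029319, 6029325, 6030455, 6094967, 6030461, 6094973, 6029783, 6095063, 6029789,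
    6095069, 6032663, 6032711, 6102023, 6032669, 6102391, 6102397, 6102487, 6102493, 6059335,
    6108487, 6108535, 6144023, 6144071, 6148103, 6148567, 6148573, 6151447, 6157399, 6157639,
    6157687, 6242327, 6242375, 6243335, 6243703, 6247543, 6243709, 6243799, 6248263, 6249751,
    6249799, 6255943, 7602183, 7618631, 7603319, 7618679, 7667831, 7602647, 7618775, 7667927,
    7624471, 7624519, 7624567, 7624663, 7686103, 7605527, 7605575, 7626103, 7675255, 7691383,
    7626199, 7675351, 7632247, 7681399, 7722103, 7721431, 7730551, 7816567]"
  by (rule g11.level_gapless, simp, simp only: eval11, (simp)?, (simp add: dead11)?)

lemma run11_4_a [THEN g11.level_good, simplified decode simp_thms, simp]: "level11 12 [
    4198417, 4198677, 4198720, 4198740, 4199700, 4199745, 4199748, 4210753, 4210756, 4215057,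
    4215060, 4215105, 4215108, 4215125, 4215825, 4215828, 4215873, 4215876, 4456465, 4456468,
    4457476, 4457745, 4457748, 4457793, 4457796, 4472913, 4472916, 4478293, 4527445, 4538433,
    4539476, 4542805, 4543765, 4543825, 4543828, 5259345, 5264725, 5313877, 5330197, 5570901,
    5574997, 5575957, 5576021, 5587029, 4215063, 4215831, 4215879, 4456471, 4457751, 4474199,
    4477271, 4478231, 4523351, 4526423, 4542743, 5242903, 5260631, 5263703, 5264663, 5309783,
    5312855, 5574935, 5587015, 4198749, 4199709, 4199757, 4215069, 4215117, 4215837, 4215885,
    4456477, 4457757, 4457805, 4472845, 4474205, 4477277, 4478237, 4521997, 4523357, 4526429,
    4527389, 4542749, 5242909, 5259277, 5260637, 5263709, 5264669, 5308429, 5308701, 5309789,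
    5312861, 5313869, 5570893, 5574941, 5576013, 5587021, 5591389, 5592349, 5592397, 4198708,
    4215153, 4215156, 4478321, 4478324, 4527473, 4527476, 4542833, 4542836, 4543796, 5264753,
    5264756, 5313905, 5313908, 5330228, 5575025, 5575028, 5575988, 5587057, 5587060, 5591092,
    5591348, 5592372, 4473975, 4477047, 4523127, 4526199, 5260407, 5263479, 5309559, 5312631,
    5587063, 4195453, 4198525, 4473981, 4477053, 4523133, 4526205, 5260413, 5263485, 5308797,
    5309565, 5312637, 5570941, 5587069, 5588093, 5591165, 4215252, 4216017, 4216020, 4456660,
    4478420, 4523477, 4527572, 4542932, 5243092, 5264852, 5309909, 5314004, 5329364, 5575124,
    5587153, 5587156, 4216023, 5587159, 4216029, 5587165, 4523508, 5309940, 4199233, 4199236,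
    4477781, 4523844, 4526933, 4540241, 4544273, 4544276, 5264213, 5310276, 5313365, 5330705,
    5330708, 5576465, 5576468, 5591873, 5591876, 5592832, 5592849, 5592852, 5592897, 5592900,
    5592917, 4474647, 4523799, 5261079, 5310231, 5592855, 5592903, 4199245, 4474653, 4474701,
    4523805, 4523853, 5261085, 5261133, 5310237, 5310285, 5591885, 5592861, 5592909, 4477812,
    4526964, 5264244, 5313396, 5592945, 5592948, 4200311, 5592951, 4200317, 4212605, 5592957,
    4474836, 4523988, 5261268, 5310420, 5593041, 5593044, 4200407, 5593047, 4200413, 5593053,
    4214080, 4217937, 4217940, 4459861, 4480277, 4480337, 4480340, 4545857, 5246293, 5266709,
    5266769, 5594453, 4214103, 4217943, 4541783, 5328215, 5594119, 5594439, 4459853, 4480349]"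
  by (rule g11.level_gapless, simp, simp only: eval11, (simp)?, (simp add: dead11)?)

lemma run11_4_b [THEN g11.level_good, simplified decode simp_thms, simp]: "level11 12 [
    5246285, 5266781, 5594125, 5594445, 4480308, 5266740, 5594481, 5594484, 5594487, 4201597,
    4480125, 4529277, 5266557, 5315709, 5594237, 5594493, 5594560, 5594577, 5594580, 5594583,
    5594589, 4218705, 4480833, 4480836, 5267265, 5267268, 4480845, 5267277, 4485399, 4486167,
    5271831, 5272599, 4207949, 4485405, 4486173, 4486477, 4535629, 5271837, 5272605, 5272909,
    5322061, 5599517, 5599565, 5600589, 4485489, 4485492, 4535604, 5271921, 5271924, 5322036,
    4207997, 4486525, 5272957, 5600637, 4485588, 4486356, 5272020, 5272788, 5340503, 4572503,
    4575575, 4576535, 5358935, 4571149, 4571213, 4572509, 4575581, 4576541, 4576589, 5357581,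
    5357645, 5358941, 4575540, 4247677, 4247933, 4572285, 4575357, 5358717, 5361789, 5623933,
    4576724, 4572951, 5359383, 4572957, 4573005, 4576077, 5359389, 5359437, 4573140, 5359572,
    4250957, 5365069, 4578429, 5364861, 4584471, 4584519, 4584477, 4584525, 4584781, 5371213,
    4584663, 4584669, 4657431, 4653389, 4657437, 4658509, 4669517, 4673885, 4674845, 4674893,
    5455949, 5460317, 5461277, 5461325, 4657521, 4657524, 4658484, 4653437, 4670589, 4673661,
    5457021, 5460093, 4674381, 5460813, 4676941, 5463373, 4676733, 5463165, 4682013, 4682061,
    4683085, 5469517, 4683133, 5469565, 4706429, 6029335, 6029383, 6045767, 6047063, 6050135,
    6051095, 6096215, 6099287, 6115607, 6116375, 6116423, 6029341, 6029389, 6045773, 6047069,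
    6050141, 6051101, 6096221, 6099293, 6100253, 6045815, 6049911, 6099063, 6029693, 6045821,
    6046845, 6049917, 6095997, 6099069, 6029527, 6045911, 6116567, 6029533, 6045917, 6116573,
    6047511, 6051607, 6051655, 6096663, 6047517, 6047565, 6051613, 6051661, 6096669, 6096717,
    6099789, 6051703, 6100855, 6051709, 6100861, 6051799, 6100951, 6051805, 6100957, 6052871,
    6032717, 6053239, 6052989, 6053245, 6102141, 6053335, 6058263, 6059031, 6059079, 6108183,
    6108231, 6059383, 6059389, 6059223, 6108375, 6059229, 6108381, 6145367, 6145149, 6148221,
    6148477, 6145815, 6151293, 6157591, 6242583, 6242631, 6243351, 6243399, 6246407, 6247767,
    6242679, 6242685, 6243453, 6246781, 6242775, 6243543, 6246871, 6247639, 6248311, 6248317,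
    6245655, 6245703, 6249559, 6245751, 6245757, 6245847, 6255703, 6255991, 7619927, 7669079,
    7672151, 7689591, 7689431, 7620375, 7669527, 7673815, 7687511, 7687543, 7681239, 7718263]"
  by (rule g11.level_gapless, simp, simp only: eval11, (simp)?, (simp add: dead11)?)

lemma run11_5_a [THEN g11.level_good, simplified decode simp_thms, simp]: "level11 13 [
    4194304, 4194305, 4194308, 4195332, 4198421, 4210752, 4456513, 4457473, 4472833, 4472853,
    4477953, 4527105, 4539473, 4542465, 5242945, 5243157, 5243217, 5243905, 5244177, 5244225,
    5259285, 5259329, 5259349, 5263381, 5264657, 5264661, 5325905, 4194327, 4195335, 4198407,
    4210695, 4215111, 4457799, 4472839, 4478279, 4521991, 4527431, 4542791, 5242887, 5242951,
    5244183, 5244231, 5259271, 5259335, 5264711, 5308423, 5313863, 5329223, 5574983, 5591047,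
    4194333, 4195341, 4198413, 4210701, 4457501, 5242893, 5242957, 5244189, 5244237, 5259341,
    5570845, 5591053, 4195697, 4195700, 4198452, 4216177, 4216180, 4456564, 4457585, 4457588,
    4522097, 4522100, 4526132, 5242996, 5243188, 5243249, 5259377, 5259380, 5263412, 5264692,
    5591409, 4195703, 4199543, 4216183, 4472951, 4522103, 5243255, 5259383, 5308535, 5570935,
    4195709, 4199549, 4216189, 4472957, 4522109, 5243261, 5259389, 5308541, 5591421, 4195776,
    4198848, 4211136, 4215249, 4457937, 4478417, 4522196, 4527569, 4542929, 5243089, 5243328,
    5244369, 5259473, 5259476, 5260757, 5264849, 5314001, 5329361, 5575121, 5591488, 4195799,
    4198871, 4211159, 4473047, 4522199, 5243095, 5243351, 5259479, 5591511, 4198877, 4211165,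
    4473053, 4522205, 5243101, 5243357, 5259485, 5591517, 4477428, 5260788, 5263860, 4196161,
    4196164, 4200192, 4200277, 4212480, 4212565, 4474689, 4474709, 4523776, 4523861, 4527872,
    4544321, 5243713, 5261121, 5261124, 5261141, 5265152, 5265169, 5265172, 5265217, 5265220,
    5265237, 5309269, 5310208, 5310293, 5326673, 5330753, 5571409, 5576513, 4200263, 4212551,
    4474695, 4477767, 4523847, 4526919, 5261127, 5264199, 5265175, 5265223, 5309255, 5310279,
    5313351, 4200221, 4200269, 4212509, 4212557, 4527901, 5265181, 5265229, 5309261, 4200305,
    4200308, 4212593, 4212596, 4474737, 4478833, 4523889, 4523892, 4527985, 4527988, 5261169,
    5265265, 5265268, 5309300, 5310321, 5310324, 5326705, 4478839, 4527991, 5265271, 5326711,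
    4478845, 4527997, 5265277, 5326717, 4200401, 4212689, 4474833, 4523985, 5261265, 5265361,
    5265364, 5310417, 4478935, 4528087, 5265367, 5326807, 4478941, 4528093, 5265373, 5326813,
    4201728, 4459796, 4459841, 5246273, 5266773, 4201751, 4480007]"
  by (rule g11.level_gapless, simp, simp only: eval11, (simp)?, (simp add: dead11)?)

lemma run11_5_b [THEN g11.level_good, simplified decode simp_thms, simp]: "level11 13 [
    4529159, 5266439, 4201757, 4218205, 4480013, 4529165, 5266445, 4214129, 4214132, 4529521,
    4529524, 5266801, 5266804, 4214135, 4480375, 4529527, 5266807, 5315959, 4214141, 4480381,
    4529533, 5266813, 5315965, 4480448, 4529600, 4529620, 5266880, 5266897, 4480471, 4529623,
    5266903, 4529629, 4202321, 4529985, 4529988, 4218740, 4207703, 4485447, 5271879, 5272647,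
    5337095, 5600343, 4207901, 5272653, 5337101, 5600541, 4486260, 5272692, 5272884, 5337140,
    5272951, 5338231, 5600631, 5338237, 4485585, 5272017, 5272785, 5337536, 5272791, 5337559,
    5272797, 5337565, 4208465, 4536129, 5273361, 5273409, 5338965, 5338951, 5338909, 5338957,
    5338993, 5338996, 5339089, 5340439, 5340445, 4247639, 4247879, 4571143, 4576583, 5357575,
    5361671, 5362007, 5362967, 5363015, 5624839, 4247837, 4247885, 4248605, 5361677, 5362013,
    5362973, 5363021, 5624845, 4247921, 4247924, 4248689, 4248692, 5361972, 5362033, 5362039,
    5623927, 5362045, 4248017, 4249045, 4576721, 5363153, 5362135, 5625303, 5362141, 4572999,
    4576071, 5359431, 5362503, 5362509, 4573137, 5359569, 5370903, 5370951, 5370967, 5370909,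
    5370957, 5371165, 5371095, 5371101, 4657479, 4670471, 4673543, 4674903, 5456903, 5459975,
    5460295, 5461335, 4653341, 4670477, 4673549, 4674589, 4674909, 5456909, 5459981, 5460301,
    5461021, 5461341, 4670833, 4670836, 4674673, 5457265, 5460337, 4670839, 5457271, 4670845,
    5457277, 5460349, 4670935, 4674007, 4674775, 5457367, 5460439, 5461207, 4674013, 4674781,
    5460445, 5461213, 4676695, 5463127, 4682839, 5469271, 4683037, 5469469, 5469559, 4706423,
    6029399, 6029639, 6045703, 6049799, 6051143, 6094855, 6094871, 6095879, 6098951, 6100295,
    6115655, 6029597, 6029645, 6030365, 6094877, 6050167, 6096247, 6100087, 6116727, 6050173,
    6096253, 6100093, 6116733, 6050263, 6096343, 6099415, 6050269, 6099421, 6047559, 6050631,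
    6096711, 6099783, 6100807, 6100765, 6100813, 6102295, 6102301, 6058311, 6059095, 6108247,
    6108439, 6144007, 6148183, 6148423, 6145399, 6145405, 6145863, 6243607, 6246727, 7602199,
    7602247, 7602263, 7602503, 7622999, 7623959, 7624007, 7623031, 7602391, 7623127, 7684567,
    7620423, 7623495, 7669575, 7672647, 7685959, 7632087]"
  by (rule g11.level_gapless, simp, simp only: eval11, (simp)?, (simp add: dead11)?)

lemma run11_6_a [THEN g11.level_good, simplified decode simp_thms, simp]: "level11 14 [
    4199765, 4210773, 4216149, 4456452, 4457812, 4478225, 4538453, 4542485, 5242965, 5324885,
    5328917, 5570837, 5592405, 4199767, 4210775, 4215815, 4456455, 4456519, 4456791, 4457479,
    4457495, 4457815, 4477959, 4527111, 4539479, 4542471, 4543495, 4543831, 5243223, 5243911,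
    5264391, 5308759, 5313543, 5325911, 5328903, 5329927, 5330263, 5574663, 5576023, 5592407,
    4194317, 4210765, 4216141, 4456461, 4477965, 4527117, 4538445, 4542477, 4543501, 5264397,
    5313549, 5324877, 5329933, 5570637, 5574669, 5586957, 5592413, 4199793, 4210801, 4456561,
    4456817, 4456820, 4538481, 4543857, 4543860, 5242993, 5324913, 5570868, 5592433, 5592436,
    4198519, 4478327, 4543863, 5264759, 5588343, 5591159, 4211069, 4215165, 4456829, 4478333,
    4527485, 4542845, 4543869, 5264765, 5313917, 5575037, 5588349, 4456657, 4456896, 4456916,
    4457684, 4477397, 4478400, 4527552, 4542912, 4543936, 4543956, 4543957, 5263829, 5264832,
    5313984, 5330368, 5575104, 5576149, 4199639, 4215255, 4216279, 4456663, 4456919, 4457687,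
    4457943, 4478423, 4527575, 4542935, 4543959, 5244375, 5264855, 5308631, 5314007, 5329367,
    5330391, 5575127, 5592279, 4456925, 4478429, 4527581, 4542941, 4543965, 5264861, 5314013,
    5330397, 5575133, 5592285, 4543988, 5576180, 4199253, 4540160, 4544341, 5330773, 5576533,
    5588801, 5591893, 4200215, 4212503, 4527895, 4540183, 4544279, 4544327, 5243719, 5330711,
    5330759, 5576471, 5576519, 4196173, 4540189, 4544333, 5330765, 5576525, 5588813, 4540273,
    4540276, 4544369, 5330801, 5576561, 5591924, 4540279, 4474749, 4523901, 4540285, 5261181,
    5310333, 4200404, 4212692, 4528084, 4540372, 4544465, 4544468, 5330897, 5330900, 5576657,
    5576660, 4474839, 4523991, 4540375, 5261271, 5310423, 4474845, 4523997, 4540381, 5261277,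
    5310429, 4214101, 4218197, 4545877, 5332309, 5578069, 4201559, 4218199, 5315591, 5594199,
    4214093, 4545869, 5332301, 5578061, 5594461, 4218225, 4541809, 4541812, 4545905, 5332337,
    5578097, 5594420, 4480119, 4541815, 5266551, 5328247, 4541821, 5328253, 4541908, 4214231,
    4541911, 5316055, 5328343, 4541917, 5328349, 4480853, 5267285, 5594945, 5594948, 4529997]"
  by (rule g11.level_gapless, simp, simp only: eval11, (simp)?, (simp add: dead11)?)

lemma run11_6_b [THEN g11.level_good, simplified decode simp_thms, simp]: "level11 14 [
    5594957, 5267316, 4486215, 4486487, 4535639, 5271559, 5272919, 5322071, 5338199, 5338455,
    5600279, 5600327, 5600333, 4486257, 5272689, 5599601, 5599604, 5600564, 4485495, 5271927,
    4485501, 5271933, 4485568, 4486353, 4535765, 5272000, 5322197, 5600465, 5600468, 4485591,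
    4486359, 5272023, 5338327, 4485597, 5272029, 4535796, 5322228, 4536149, 5322581, 4486935,
    4536135, 5273367, 5273415, 5322567, 5338903, 4536141, 5322573, 4487124, 5273553, 5273556,
    5339092, 4488525, 5274957, 4488561, 5274993, 4247831, 4248599, 4248647, 4248919, 4572167,
    4575239, 4576599, 5358599, 5362695, 5624855, 5624903, 4572173, 4575245, 5358605, 5624141,
    5624909, 4247860, 4572529, 4572532, 4575601, 4575604, 5625140, 4572279, 4572535, 4575607,
    5358711, 5358967, 4572541, 4575613, 5358973, 4248020, 4248785, 4248788, 4572629, 4575700,
    5359061, 5625301, 4248791, 4572631, 4575703, 4576727, 5359063, 5363159, 4575709, 4572660,
    5359092, 4573041, 5359473, 4573143, 5359575, 4578391, 4584535, 4584727, 4584733, 4584756,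
    5371188, 4657159, 4658519, 4674583, 5461015, 4657165, 4669453, 5455885, 4674929, 5461361,
    4673655, 5460087, 4657533, 4657623, 4657629, 4658676, 4658967, 4659015, 4659021, 4671309,
    5457741, 4659057, 5460852, 4660557, 5463389, 4660593, 5463885, 5469207, 5469255, 5469261,
    4685143, 4707351, 4707399, 4706637, 4707405, 6030359, 6030407, 6030679, 6050823, 6051159,
    6099975, 6100311, 6116359, 6051165, 6046839, 6047095, 6047101, 6051197, 6100349, 6115709,
    6030551, 6051031, 6051287, 6100183, 6100439, 6115799, 6116823, 6051037, 6100759, 6047613,
    6047703, 6096855, 6052951, 6102103, 6118743, 6053213, 6053709, 6058365, 6058455, 6145031,
    6148375, 6149463, 6145495, 6146007, 6151255, 6243415, 6246487, 6247447, 6247495, 7603207,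
    7603223, 7603271, 7603479, 7603527, 7603543, 7673175, 7684183, 7685207, 7685463, 7602551,
    7619703, 7619959, 7668855, 7669111, 7685239, 7603415, 7603671, 7620055, 7624151, 7669207,
    7672279, 7673047, 7673303, 7685335, 7688663, 7689687, 7673623, 7685911, 7686007, 7620567,
    7669719, 7674967, 7691607, 7687639, 7631319, 7721335, 7718359, 7722455, 7718871]"
  by (rule g11.level_gapless, simp, simp only: eval11, (simp)?, (simp add: dead11)?)

lemma run11_7_a [THEN g11.level_good, simplified decode simp_thms, simp]: "level11 15 [
    4194324, 4194325, 4194368, 4194385, 4194388, 4195392, 4195584, 4195605, 4195648, 4195665,
    4195668, 4199701, 4199764, 4210689, 4210708, 4210772, 4211989, 4214785, 4215812, 4216084,
    4216085, 4216128, 4216145, 4216148, 4456788, 4457492, 4476949, 4522005, 4522065, 4522068,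
    4527185, 4538385, 4538452, 4542481, 4543573, 5242881, 5243221, 5308693, 5308753, 4194311,
    4195415, 4195607, 4199447, 4199495, 4211015, 4457543, 4476935, 4522007, 4523015, 4527447,
    4538391, 4538455, 4539735, 4543575, 4543767, 5242967, 5243207, 5244247, 5260295, 5263367,
    5309447, 5324807, 5324823, 5570583, 5575767, 5586951, 5591367, 4195613, 4195677, 4199453,
    4210717, 4211741, 4216157, 4457821, 4476941, 4522013, 4523021, 4527453, 4538397, 4543773,
    4543837, 5243213, 5243229, 5260301, 5263373, 5309453, 5324813, 5324829, 5330269, 5570589,
    5575965, 5576029, 4194356, 4195636, 4199540, 4199732, 4210740, 4210804, 4211828, 4212020,
    4215924, 4216116, 4456756, 4472948, 4522036, 4523377, 4523380, 4527412, 4538420, 4538484,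
    4539700, 4543601, 4543604, 5263729, 5308468, 5308532, 5308724, 5324916, 5330036, 5570676,
    5574708, 5575796, 5588276, 4195447, 4523383, 4527223, 4527479, 4539511, 4542839, 4543607,
    5260663, 5263735, 5309815, 5325943, 5330039, 5575799, 4215933, 4456573, 4523389, 4527229,
    4539517, 4543613, 5243005, 5260669, 5263741, 5309821, 5325949, 5330045, 5575805, 4199633,
    4199636, 4211153, 4216276, 4457681, 4473044, 4477376, 4523456, 4526549, 4538580, 5243345,
    5243349, 5244373, 5260736, 5263808, 5308628, 5309888, 5325012, 5325248, 5570772, 5591505,
    4477399, 4523479, 4527319, 4539607, 5244119, 5260759, 5263831, 5309911, 5325271, 4457693,
    4477405, 4527325, 5263837, 5325277, 4195828, 4474356, 4526580, 5243380, 5591540, 4196096,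
    4196113, 4196116, 4196177, 4196181, 4200209, 4200212, 4200257, 4212497, 4212500, 4212545,
    4212548, 4216593, 4216596, 4216641, 4478805, 4527892, 4540180, 4544324, 4544337, 5243729,
    5309249, 5326677, 5330769, 5576448, 5588756, 4196167, 4478791, 5326663, 5329735, 5588807,
    4196125, 4216605, 4216653, 4478797, 4544285, 5326669, 5330717, 5576477, 4196209, 4196212,
    5576564]"
  by (rule g11.level_gapless, simp, simp only: eval11, (simp)?, (simp add: dead11)?)

lemma run11_7_b [THEN g11.level_good, simplified decode simp_thms, simp]: "level11 15 [
    4212599, 4196305, 4478929, 5326801, 5588945, 5314519, 5314525, 4201553, 4201556, 4201748,
    4201749, 4201792, 4201809, 4201812, 4214036, 4218132, 4218196, 4459793, 4459797, 4459844,
    4459857, 4459860, 4529429, 4529489, 4529492, 4545809, 4545876, 4529239, 4529431, 4541719,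
    4545815, 4545879, 5328151, 5332247, 5578007, 4201821, 4218141, 4529437, 4529501, 4541725,
    4545821, 4545885, 5328157, 5332253, 5578013, 4201780, 4218164, 4218228, 4459828, 4480372,
    4529460, 4545844, 4545908, 5315892, 5315956, 5328244, 5332340, 5578100, 4529271, 4214228,
    4546004, 5316052, 5328340, 5332436, 5578196, 4480500, 4529652, 5266932, 4202305, 4202308,
    4530001, 4530005, 4529991, 4202317, 4530036, 4546420, 4486231, 4535383, 4535575, 5272663,
    5321815, 5337415, 5338135, 5338183, 4207645, 4535581, 4535645, 5272861, 5272925, 5322013,
    5322077, 5338141, 5600285, 4207732, 4207924, 4486452, 4535409, 4535412, 5321844, 5338228,
    5600372, 4535415, 5321847, 4486269, 4535421, 5272701, 5321853, 5273045, 5337553, 5338321,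
    5338324, 5273076, 4486932, 4536145, 5273425, 5322577, 4486941, 5273373, 4536180, 5322612,
    4488519, 5274951, 4488477, 5274909, 4488564, 5274996, 4488657, 4488660, 5275089, 5275092,
    4572247, 4572439, 5358871, 5361751, 5361991, 5363031, 5624135, 5625159, 4572445, 4576605,
    5358877, 5361997, 5624861, 5358964, 4247927, 5362129, 5362133, 5363157, 5362903, 5362164,
    5625332, 5624647, 5364823, 4578612, 5370993, 5370996, 4653143, 4658263, 4658455, 4669447,
    4670551, 4670743, 4674631, 5455879, 4653085, 4658461, 4658525, 4670749, 4670813, 4653108,
    4653172, 4653364, 4658289, 4658292, 4657527, 4658295, 4670583, 4658301, 4670964, 4674036,
    5460468, 4671303, 5457735, 4658973, 4671261, 4659060, 4671345, 4671348, 4660503, 4660567,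
    4660509, 4660573, 4676957, 4660532, 4660596, 4677453, 4661108, 4682781, 5469213, 4706631,
    4707357, 4707828, 6050119, 6095959, 6096151, 6099991, 6100039, 6096157, 6116701, 6029687,
    6095991, 6029437, 6116477, 6117149, 6117197, 6096765, 6102365, 6102861, 6059133, 6108285,
    6059805, 6148471, 7619863, 7622743, 7622983, 7624023, 7668823, 7669015, 7623895, 7625815]"
  by (rule g11.level_gapless, simp, simp only: eval11, (simp)?, (simp add: dead11)?)

lemma run11_8_a [THEN g11.level_good, simplified decode simp_thms, simp]: "level11 16 [
    4194321, 4194369, 4194372, 4194389, 4199744, 4199761, 4210692, 4211029, 4211793, 4211796,
    4215121, 4215893, 4216129, 4456725, 4456785, 4472917, 4527188, 4543489, 4543829, 5329237,
    5330261, 5588309, 4194375, 4195671, 4210967, 4456535, 4472855, 4522071, 4543815, 5243927,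
    5259287, 5264727, 5313879, 5586967, 5591127, 5592087, 5592135, 4194381, 4198685, 4199773,
    4210973, 4211021, 4214797, 4216093, 4472861, 4472909, 4543821, 5259293, 5264733, 5308445,
    5329245, 5330205, 5330253, 5586973, 5588301, 5588317, 5592141, 4199537, 4211057, 4215921,
    4472945, 5260657, 5264497, 5308529, 5329265, 5330289, 5330292, 5588337, 5592177, 4215159,
    4478071, 4538487, 5264503, 5308791, 5324919, 5592183, 4199805, 4210813, 4211837, 4477309,
    4478077, 4538493, 4538749, 5244029, 5264509, 5313661, 5324925, 5325181, 5330301, 5570685,
    5592189, 5592445, 4194513, 4210900, 4211156, 4215232, 4474325, 4543953, 5244116, 5592273,
    5592276, 5592533, 4538583, 5264599, 5313751, 5325015, 5570775, 4199645, 4215261, 5264605,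
    4198900, 4199249, 4200260, 5329749, 5330756, 5576516, 5588817, 5591889, 4196119, 5314327,
    5329741, 5588765, 5329780, 4523895, 5310327, 4196221, 5314429, 5588861, 4196308, 5314516,
    4544471, 5330903, 5576663, 4544477, 5330909, 5576669, 4201473, 4201536, 4201745, 4201793,
    4201796, 4201813, 4214081, 4217860, 4480341, 4541781, 5328213, 4201799, 4480279, 4529495,
    4541767, 4545543, 5266519, 5266711, 5315671, 5331975, 5577735, 5594391, 4201805, 4214045,
    4480285, 4541773, 5246237, 5266717, 5315869, 5328205, 5594397, 4480369, 5315953, 5328241,
    4201591, 4545911, 5332343, 5578103, 5594231, 4218237, 4545917, 5332349, 5578109, 4201937]"
  by (rule g11.level_gapless, simp, simp only: eval11, (simp)?, (simp add: dead11)?)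

lemma run11_8_b [THEN g11.level_good, simplified decode simp_thms, simp]: "level11 16 [
    4541905, 5594581, 4546007, 5332439, 5578199, 4201972, 5594612, 4202325, 4480849, 5267281,
    5316433, 5594961, 5594965, 4202356, 5594996, 4486429, 5337373, 5337421, 5338189, 5337457,
    5337460, 5338225, 4207741, 5337469, 5599613, 5600381, 5599701, 5600471, 4486929, 4487127,
    5273559, 5340493, 5602589, 5602637, 5602673, 5602676, 4488567, 5274999, 4488573, 5275005,
    5602772, 4488663, 5275095, 4572487, 4575319, 5362711, 5625175, 4247901, 4248861, 4248909,
    4572493, 5357597, 5358925, 5624093, 5625165, 5358961, 5625201, 5362813, 5624189, 5625213,
    4572625, 5624277, 5625047, 5625053, 4575732, 5625623, 4248397, 5624653, 5625812, 4573149,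
    5359581, 4578653, 5365021, 5627213, 5627249, 4578423, 4579149, 4579188, 4584791, 5371223,
    4584564, 4584948, 4585287, 4670807, 4673815, 5456983, 5457175, 5460055, 5460247, 5461063,
    4673821, 5457181, 5457229, 5457245, 5460253, 5461069, 4653181, 4674941, 5461373, 4671255,
    5457693, 4671357, 5457789, 4659159, 4659165, 4660231, 4660599, 4676727, 5463159, 4660605,
    4660695, 4677108, 5463540, 4677492, 5463924, 4682109, 4682877, 5469309, 5469399, 4685085,
    4685133, 4707671, 4706589, 4706685, 4707453, 4707543, 4707549, 4708119, 4709661, 4709709,
    6045719, 6049879, 6050839, 6050887, 6094919, 6099031, 6029661, 6030621, 6030669, 6045725,
    6047053, 6099229, 6100317, 6050935, 6051191, 6099319, 6100343, 6115703, 6050941, 6099325,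
    6051293, 6100189, 6100445, 6115805, 6053143, 6102343, 6053149, 6052983, 6102135, 6118781,
    6058359, 6058461, 6061437, 6157335, 6157383, 6243655, 6246679, 6243447, 6246519, 7602519,
    7623703, 7671895, 7689559, 7690007, 7690055, 7674999, 7632663, 7718007, 7816311]"
  by (rule g11.level_gapless, simp, simp only: eval11, (simp)?, (simp add: dead11)?)

lemma run11_9_a [THEN g11.level_good, simplified decode simp_thms, simp]: "level11 17 [
    4195412, 4195604, 4195669, 4199425, 4199441, 4199444, 4199505, 4199508, 4210964, 4211009,
    4211012, 4211732, 4212033, 4212036, 4214801, 4457489, 4457553, 4457813, 4472897, 4472900,
    4478033, 4522004, 4522069, 4527444, 4539713, 4542801, 5242961, 5243201, 5243969, 5243985,
    5244245, 5260629, 5263701, 5264465, 5264469, 5264721, 5313617, 5325141, 5570645, 4194391,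
    4199431, 4199751, 4216087, 4477015, 4478039, 4523095, 4523287, 4526167, 4527127, 4527191,
    5259351, 5260615, 5263447, 5263687, 5264455, 5264471, 5309719, 5325127, 5326103, 5326151,
    5591383, 5592071, 5592343, 5592391, 4195661, 4199437, 4522061, 4523293, 4527133, 4539421,
    4539677, 5243917, 5260621, 5263693, 5264461, 5308765, 5309725, 5325085, 5325133, 5326109,
    5592077, 5592093, 4457841, 4477297, 4527220, 4539508, 4539764, 5244017, 5244273, 5244276,
    5309812, 5325169, 5326196, 5329204, 5570673, 5592180, 4211831, 4456823, 4474231, 5242999,
    5570679, 5592439, 4474237, 4526461, 4199872, 4199889, 4215253, 4216277, 4527316, 5244352,
    5260753, 5263825, 5264593, 5264853, 5325265, 5326289, 5591509, 5592512, 5592529, 5592532,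
    4199895, 5592535, 4199901, 5308637, 5592541, 4216308, 4216657, 4477777, 4478785, 4523857,
    4526929, 5264209, 5310289, 5314369, 5326657, 5329729, 5329732, 5588821, 4199239, 5591879,
    5243764, 5314417, 5588849, 4196215, 5261175, 4196311, 5588951, 4529236, 4529428, 4529493]"
  by (rule g11.level_gapless, simp, simp only: eval11, (simp)?, (simp add: dead11)?)

lemma run11_9_b [THEN g11.level_good, simplified decode simp_thms, simp]: "level11 17 [
    5266513, 4201815, 4214039, 5266775, 4529485, 5315597, 5266901, 5316032, 5316061, 5316417,
    4202311, 4480839, 5267271, 5316423, 5599511, 5599559, 5338461, 5271604, 5600369, 4486519,
    5272695, 5599607, 5600375, 4208085, 5272021, 5599680, 5599697, 5599700, 5599703, 5338333,
    5599709, 5600477, 4208116, 4208449, 4208461, 4487025, 5273457, 5273460, 5601137, 5273565,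
    5274903, 5602583, 4248903, 5623815, 5362701, 5624157, 5625117, 5625181, 4248945, 4248948,
    4576625, 5362801, 5363057, 5363060, 5623860, 5624177, 4247671, 5361783, 4249041, 5624279,
    5363165, 4248391, 5625671, 5625629, 4248436, 5362548, 5625713, 5625716, 5625809, 5364855,
    4579143, 5365575, 5371159, 5370999, 4584573, 5371005, 5371380, 4669527, 4674567, 4674887,
    5457223, 5460311, 5460999, 5461271, 5461319, 4670797, 4674573, 5461005, 5461367, 4675031,
    5461463, 4675037, 5461469, 4653556, 4674375, 5460807, 4653901, 5457777, 4671351, 4671447,
    5457879, 4676951, 4677447, 4682055, 4681741, 5469303, 4682199, 4682205, 5469405, 4683252,
    5469684, 4683597, 5470029, 4706311, 4707677, 4706679, 4707709, 4706775, 4706804, 4708167,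
    4708125, 6030663, 6094935, 6116631, 6050845, 6029431, 6096759, 6102359, 6102855, 6059127,
    6061335, 6145303, 6149447, 6148215, 6148935, 6242311, 6243671, 6244119, 6244167, 7602455,
    7602295, 7622775, 7673671, 7625847, 7626567, 7675719, 7631991, 7721079, 7815543]"
  by (rule g11.level_gapless, simp, simp only: eval11, (simp)?, (simp add: dead11)?)

lemma run11_10_a [THEN g11.level_good, simplified decode simp_thms, simp]: "level11 18 [
    4195649, 4198401, 4198481, 4198484, 4214788, 4456449, 4456789, 4474197, 4476929, 4478229,
    4478289, 4478292, 4522049, 4523009, 4523349, 4526421, 4538709, 4539669, 4543809, 5243153,
    5244241, 5308433, 5313809, 5326101, 5326165, 4198487, 4198727, 4211799, 4456775, 4457559,
    4473863, 4477255, 4477975, 4478023, 4478295, 4523335, 4526087, 4538375, 4538647, 4539399,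
    5243975, 5243991, 5264407, 5309527, 5312519, 5312839, 5313623, 5324887, 5325831, 5330247,
    5570647, 5588055, 5591319, 4456781, 4456797, 4474189, 4523341, 4526413, 4538381, 4538653,
    4538701, 5243165, 5264413, 5326157, 4474225, 4478260, 4526449, 4538737, 4538740, 4542516,
    5243252, 5264500, 5313649, 5313844, 5325172, 5326132, 5326193, 4210807, 4538743, 5313911,
    5575031, 5588087, 5244285, 4198865, 4198869, 4212181, 4456913, 4477393, 4478161, 4478164,
    4523473, 4538816, 4538836, 5243348, 5244113, 5264596, 5312977, 5330385, 5591508, 4474327,
    4478167, 4526551, 4538839, 4539863, 5312983, 5326295, 4456669, 4538845, 4212212, 5592564,
    4216644, 4478737, 4478740, 4478788, 4540177, 4540245, 4544256, 5314324, 5326592, 5326609,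
    5326612, 5326660, 4478743, 4527943, 4540231, 5314375]"
  by (rule g11.level_gapless, simp, simp only: eval11, (simp)?, (simp add: dead11)?)

lemma run11_10_b [THEN g11.level_good, simplified decode simp_thms, simp]: "level11 18 [
    5326615, 4540237, 5326621, 4544372, 5326708, 4478932, 4528081, 4540369, 5314513, 5326804,
    4480081, 4480084, 4529473, 4541761, 5315857, 4480087, 5328199, 5332311, 5578071, 4218231,
    5315703, 4480469, 5328337, 4546389, 5332821, 5578581, 4218695, 4546375, 5332807, 5578567,
    5594951, 4546381, 5332813, 5578573, 4207639, 4486493, 4207729, 4207828, 4486365, 5599732,
    5273469, 5602647, 5602612, 5602679, 5602685, 4488669, 5275101, 4248583, 4575559, 5358919,
    5361943, 5362759, 5362775, 5624919, 4248589, 4575565, 5361949, 4571188, 5362036, 5624180,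
    5363069, 4249024, 4575697, 5359057, 4249047, 4573044, 5625725, 5625815, 5625821, 5627261,
    4653079, 4673623, 4673863, 4653169, 5457015, 5461492, 5457780, 4661063, 5463879, 4661069,
    4682775, 4685175, 4685181, 4707335, 4707415, 4707661, 4707799, 4707149, 4708221, 4708311,
    4708317, 4709757, 6030343, 6046807, 6050071, 6099271, 6100247, 6030349, 6030807, 6118775,
    6053703, 6061399, 6061431, 6149591, 6149597, 6157527, 6247751, 6247805, 6247239, 6244221,
    6249591, 7619911, 7622935, 7623767, 7672919, 7684471, 7684311, 7690199, 7605591, 7691735,
    7692103, 7632855, 7634391, 7718775, 7730295, 7818615]"
  by (rule g11.level_gapless, simp, simp only: eval11, (simp)?, (simp add: dead11)?)

lemma run11_11 [THEN g11.level_good, simplified decode simp_thms, simp]: "level11 19 [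
    4199488, 4199509, 4210961, 4211716, 4211776, 4211988, 4456769, 4457556, 4477009, 4477972,
    4523092, 4523284, 4526164, 4526356, 4526417, 4538369, 4538389, 4538449, 4538705, 5260609,
    5263441, 5263681, 5312533, 5324821, 5324881, 5325137, 5570581, 4199511, 4211991, 4214791,
    4216151, 4472903, 4538695, 4539671, 5260375, 5263639, 5312599, 5570903, 5592151, 4199501,
    4211997, 5312525, 5325837, 5328909, 5588253, 4198769, 4211825, 4212084, 5324852, 5570612,
    5588340, 4477303, 4539773, 5326205, 4473041, 4478421, 4538833, 4538837, 5263828, 5312960,
    5326272, 5329344, 4538589, 5312989, 5329373, 4456948, 4527604, 4538868, 4539892, 4542964,
    5325300, 5330420, 5571060, 4212561, 4540225, 5309252, 5314389, 4216599, 4216647, 5314381,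
    4544375, 4544381, 4216785, 4216788, 4196317, 4480001, 4545813, 4545873, 5332245, 5332305,
    5578005, 4459863, 4545549, 5332276, 5578036, 4480465, 4545984, 4546013, 4218356, 5600599,
    4485589, 4486644, 5337588, 5600756, 4486993, 4208455, 5601047, 5601236, 5274967, 4571223,
    4248052, 4573047, 4573053, 4578647, 4250932, 5365236, 4584797, 5371229, 4584567, 4585293,
    4585332, 5371764, 4674647, 5461079, 4674637, 4673905, 4657652, 4653895, 4659063, 4659069,
    4671453, 4660237, 4660701, 4681735, 5469527, 4683543, 4683591, 4706583, 4706317, 4706781,
    4708173, 4709703, 4709719, 4709751, 6050903, 6100055, 6115335, 6116695, 6047005, 6117143,
    6117191, 6096861, 6059351, 6108503, 6059799, 6108999, 6146013, 6152007, 6157655, 6157431,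
    6157437, 6242391, 6247431, 6247895, 6244311, 6249815, 6250311, 6255639, 6256455, 7667799,
    7689335, 7669623, 7690103, 7675223, 7681143, 7819639, 7820663]"
  by (rule g11.level_gapless, simp, simp only: eval11, (simp)?, (simp add: dead11)?)

lemma run11_12 [THEN g11.level_good, simplified decode simp_thms, simp]: "level11 20 [
    4195409, 4195601, 4195652, 4198676, 4199489, 4199492, 4472852, 4474132, 4477252, 4477969,
    4522001, 4523329, 4526401, 4527121, 4538641, 4538689, 4539457, 4539477, 4543761, 5264401,
    5309781, 5330257, 4527175, 5313559, 5329175, 5575959, 4457485, 4474141, 4477981, 4526365,
    4539469, 5260573, 5309773, 5313565, 5325853, 5329181, 4474228, 4478068, 4526452, 4527217,
    4539505, 5260660, 5309809, 5313652, 5325940, 4212093, 4457920, 4527313, 5313748, 4199924,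
    4215284, 5264884, 5326324, 4457284, 5329745, 5330807, 5576567, 4216791, 4480276, 4529233,
    4529425, 4541713, 4218325, 4546369, 5322007, 5272052, 4486980, 4487133, 5602631, 5274932,
    5602769, 4247895, 4248855, 4576733, 5624308, 5359479, 5625719, 5365581, 4675060, 4682228,
    4683735, 4706391, 4706653, 4707613, 4708215, 4709847, 6029655, 6030615, 6117335, 6061383,
    6148439, 6149399, 6145143, 6255895, 7603287, 7685591, 7620471]"
  by (rule g11.level_gapless, simp, simp only: eval11, (simp)?, (simp add: dead11)?)

lemma run11_13 [THEN g11.level_good, simplified decode simp_thms, simp]: "level11 21 [
    4198737, 4210709, 4210769, 4211729, 4212032, 4212053, 4456529, 4457540, 4523281, 4527381,
    4527441, 4474135, 5325079, 4212045, 4212061, 4212081, 5259316, 5329268, 4212087, 5326199,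
    5325268, 4211933, 4474705, 4527889, 5261056, 5261172, 4218133, 4218193, 5332317, 5578077,
    4546036, 5332852, 5578612, 4207895, 5601149, 5602775, 5602781, 4248957, 4653335, 4660724,
    4683031, 5469463, 6030717, 6059901, 6061527, 6061533, 6149501, 6247511, 6247799, 6244215,
    7667735, 7672951, 7685495, 7675159, 7634295]"
  by (rule g11.level_gapless, simp, simp only: eval11, (simp)?, (simp add: dead11)?)

lemma run11_14 [THEN g11.level_good, simplified decode simp_thms, simp]: "level11 22 [
    4199680, 4474177, 4477012, 4477249, 4526161, 5260369, 5263633, 5312593, 5570839, 5587975,
    4199796, 5586996, 5329277, 5326293, 5330389, 5588437, 5588439, 4210909, 5588736, 4199284,
    5588852, 4217869, 4218304, 5316053, 5332801, 5578561, 4480884, 5600535, 4207693, 5337557,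
    5624945, 5627255, 4653133, 4674932, 4674420, 4682829, 4685277, 6029591, 6046727, 6047191,
    6118877, 6059287, 6151287, 6255735]"
  by (rule g11.level_gapless, simp, simp only: eval11, (simp)?, (simp add: dead11)?)

lemma run11_15 [THEN g11.level_good, simplified decode simp_thms, simp]: "level11 23 [
    4478017, 5243989, 5591381, 4538439, 5243159, 5308439, 5308487, 5328983, 5588295, 5243981,
    5591373, 5328948, 5313655, 4538577, 5308625, 5329365, 5575125, 5588433, 5330688, 5330804,
    4545537, 5246225, 4545863, 5315863, 5315911, 5246260, 4546001, 5316049, 4207687, 5272855,
    4207825, 4248663, 5362765, 5357620, 5359476, 5365044, 4653127, 4660551, 4682823, 6030423,
    6047047, 6050125]"
  by (rule g11.level_gapless, simp, simp only: eval11, (simp)?, (simp add: dead11)?)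

lemma run11_16 [THEN g11.level_good, simplified decode simp_thms, simp]: "level11 24 [
    4198404, 4457557, 4539393, 5308689, 4198679, 4211719, 4539719, 5313815, 5588247, 4456733,
    4457549, 4199799, 4457847, 4198868, 4539857, 4212183, 5246295, 5332468, 5578228, 4207959,
    4207831, 5357655, 4575517, 4576631, 5365079, 5371719, 4653399, 4674935, 4653271, 4683095,
    4682103, 4682967, 6046999, 6099223, 7618647, 7673207, 7688567, 7603015, 7626071, 7632711]"
  by (rule g11.level_gapless, simp, simp only: eval11, (simp)?, (simp add: dead11)?)

lemma run11_17 [THEN g11.level_good, simplified decode simp_thms, simp]: "level11 25 [
    4198724, 4214805, 4456724, 4477269, 4527189, 4539732, 4210759, 4526359, 4539415, 4477213,
    4477261, 4527181, 5570909, 4477300, 4198775, 4210897, 4526548, 4539604, 4457972, 4216661,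
    4527940, 4216689, 5571444, 4217857, 4218321, 4546005, 4218692, 5600605, 5599284, 4208469,
    5601053, 5601140, 5365085, 5627188, 5365620, 4673911, 5469533, 4683633, 4685127, 4706647,
    4707607, 6118727, 7821175]"
  by (rule g11.level_gapless, simp, simp only: eval11, (simp)?, (simp add: dead11)?)

lemma run11_18 [THEN g11.level_good, simplified decode simp_thms, simp]: "level11 26 [
    4456516, 5325909, 5325901, 5325937, 4211157, 4457941, 4457301, 4474692, 5571396, 4457293,
    4216701, 4485133, 4486997, 4486989, 5601245, 5624151, 4683645, 6117245, 6059997, 6145917,
    6158151]"
  by (rule g11.level_gapless, simp, simp only: eval11, (simp)?, (simp add: dead11)?)

lemma run11_19 [THEN g11.level_good, simplified decode simp_thms, simp]: "level11 27 [
    4210705, 4212049, 4215889, 4527377, 4539409, 5260561, 5309521, 4211783, 4215821, 5326173,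
    4211921, 4216256, 5314005, 4216285, 5326045, 4218129, 5315933, 4214237, 4248925, 4248797,
    6030685, 6030557, 6116829]"
  by (rule g11.level_gapless, simp, simp only: eval11, (simp)?, (simp add: dead11)?)

lemma run11_20 [THEN g11.level_good, simplified decode simp_thms, simp]: "level11 28 [
    5308437, 5308497, 5330005, 5575765, 5330033, 5575793, 5312887, 5312981, 5588753, 5315861,
    5315921, 5321841, 5624951, 5625207, 5627159, 4578773, 6246775]"
  by (rule g11.level_gapless, simp, simp only: eval11, (simp)?, (simp add: dead11)?)

lemma run11_21 [THEN g11.level_good, simplified decode simp_thms, simp]: "level11 29 [
    5312797, 5244023, 5330295, 4457281, 5243716, 5314423, 5246231, 5316420, 5337463, 4486977,
    4487031, 5340487, 5340625, 5357591, 5362807, 5365015, 7618583, 7623799, 7672183, 7626007]"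
  by (rule g11.level_gapless, simp, simp only: eval11, (simp)?, (simp add: dead11)?)

lemma run11_22 [THEN g11.level_good, simplified decode simp_thms, simp]: "level11 30 [
    4199428, 4211780, 4478036, 4198743, 4199703, 4212055, 4215895, 4472919, 4457844, 4211063,
    4456567, 4199892, 4211927, 4457332, 4474743, 4480343, 4485172, 4486263, 4208452, 4487028,
    4488471, 4576628, 4575351, 4576116, 4673879, 4674839, 4682007, 6116439, 6145111, 7671927]"
  by (rule g11.level_gapless, simp, simp only: eval11, (simp)?, (simp add: dead11)?)

lemma run11_23 [THEN g11.level_good, simplified decode simp_thms, simp]: "level11 31 [
    4198464, 4198741, 4211797, 4216132, 4526101, 4198733, 4211789, 4473869, 4478301, 4526093,
    5591325, 4211060, 4476980, 5591412, 4195797, 4474304, 4526528, 4478173, 4526557, 5588468,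
    4478720, 4527957, 4478749, 4527949, 4478836, 4214084, 4529621, 5316084, 4218709, 4218701,
    4486613, 5624948, 4249076, 5627357, 4673869, 5457396, 4707341, 6050077]"
  by (rule g11.level_gapless, simp, simp only: eval11, (simp)?, (simp add: dead11)?)

lemma run11_24 [THEN g11.level_good, simplified decode simp_thms, simp]: "level11 32 [
    4211985, 5308501, 5312785, 5308493, 5312893, 5325269, 5571029, 5313757, 5325021, 5570781,
    5571399, 5330813, 5576573, 5588957, 4214033, 5315925, 5315917, 5331981, 5577741, 5332416,
    5578176, 5332445, 5578205, 5599239, 5600725, 5601095, 5601233, 5623821, 4248021, 5624285,
    5625677, 5359485, 5627207, 5365205, 5371725, 5457885, 5470023, 6030151, 6047709, 6057991,
    6059847, 6255687]"
  by (rule g11.level_gapless, simp, simp only: eval11, (simp)?, (simp add: dead11)?)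

lemma run11_25 [THEN g11.level_good, simplified decode simp_thms, simp]: "level11 33 [
    4457537, 4539729, 4543569, 5243921, 5313813, 5313873, 5329173, 5329233, 4539463, 5260567,
    5309767, 5312791, 5313607, 5325847, 5244279, 4539601, 5309905, 5312980, 5313745, 5326036,
    5261137, 5313361, 5314321, 5315665, 5273463, 5363063, 7624055, 7631223]"
  by (rule g11.level_gapless, simp, simp only: eval11, (simp)?, (simp add: dead11)?)

lemma run11_26 [THEN g11.level_good, simplified decode simp_thms, simp]: "level11 34 [
    4456532, 4456772, 4473943, 4477207, 5308695, 4539767, 5329271, 4477396, 4210903, 4540228,
    4217863, 4218327, 4488535, 4683639, 4685271, 6118871, 7673111, 7684215, 7691639, 7724151,
    7817079]"
  by (rule g11.level_gapless, simp, simp only: eval11, (simp)?, (simp add: dead11)?)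

lemma run11_27 [THEN g11.level_good, simplified decode simp_thms, simp]: "level11 35 [
    4198656, 4474180, 4198772, 4527573, 4542933, 4211188, 4478452, 4216797, 4486423, 4207991,
    4485620, 5624116, 4673908, 4653431, 4683127, 4683741, 4709853, 6117341]"
  by (rule g11.level_gapless, simp, simp only: eval11, (simp)?, (simp add: dead11)?)

lemma run11_28 [THEN g11.level_good, simplified decode simp_thms, simp]: "level11 36 [
    4199697, 4456533, 5309713, 4211725, 4456525, 5313821, 4212160, 5571413, 5588804, 5571405,
    4486221, 5599245, 4207837, 5601109, 5601101, 4653277, 4682973, 6030157, 6059853]"
  by (rule g11.level_gapless, simp, simp only: eval11, (simp)?, (simp add: dead11)?)

lemma run11_29 [THEN g11.level_good, simplified decode simp_thms, simp]: "level11 37 [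
    4215809, 5326161, 4216135, 5325895, 5244253, 5591415, 4216273, 5326033, 5244125, 4214087,
    4214225, 5332437, 5578197, 5363037, 5362909, 5460343, 6116679, 6145351]"
  by (rule g11.level_gapless, simp, simp only: eval11, (simp)?, (simp add: dead11)?)

lemma run11_30 [THEN g11.level_good, simplified decode simp_thms, simp]: "level11 38 [
    4539665, 5312849, 5308503, 5588311, 4456917, 4457287, 5588759, 5588948, 5315927, 4485127,
    4486983, 4487121, 5624087, 4575701, 4584561, 5457239, 5457687]"
  by (rule g11.level_gapless, simp, simp only: eval11, (simp)?, (simp add: dead11)?)

lemma run11_31 [THEN g11.level_good, simplified decode simp_thms, simp]: "level11 39 [
    4195329, 4212052, 4215892, 4216081, 4195655, 4211735, 4522055, 4539741, 5243933, 5313885,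
    5244020, 5312564, 4526455, 4195793, 4211924, 4522193, 4539613, 5314304, 5314333, 5314420,
    4529153, 4529479, 4529617, 5362717, 5362804, 4670791, 4707703, 6096199, 7673719]"
  by (rule g11.level_gapless, simp, simp only: eval11, (simp)?, (simp add: dead11)?)

lemma run11_32 [THEN g11.level_good, simplified decode simp_thms, simp]: "level11 40 [
    4539733, 5587031, 4539725, 4472884, 4539761, 4457853, 4474624, 4474740, 5588855, 5594455,
    4201941, 4487037, 5624183, 4576637, 5624957, 5627165, 5627252, 5455959, 5457783, 5463383,
    6045783, 6047607, 6053207, 6246743, 6247703]"
  by (rule g11.level_gapless, simp, simp only: eval11, (simp)?, (simp add: dead11)?)

lemma run11_33 [THEN g11.level_good, simplified decode simp_thms, simp]: "level11 41 [
    4198721, 4211777, 4456721, 4473857, 4526081, 5259281, 5312853, 4474183, 4526407, 5263645,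
    5312845, 5587981, 5263732, 5312881, 4474321, 4526545, 5588416, 5244404, 4527937, 5314372,
    5266705, 4218689, 4248653, 5363188, 4707655, 4707143, 6030413]"
  by (rule g11.level_gapless, simp, simp only: eval11, (simp)?, (simp add: dead11)?)

text \<open>The last length with \<open>L + 9 \<le> 43\<close>. States with longer gapless runs need
  a better bound behind the gap, which the following lists supply.\<close>

lemma run11_34 [THEN g11.level_good, simplified decode simp_thms, simp]: "level11 42 [
    5324871, 5570631, 4539405, 4539840, 5325009, 5570769, 4216695, 5246229, 5246289, 5332295,
    5578055, 5332433, 5578193, 5601239, 5623895, 4250967, 5627351, 6117239, 6032727, 6059991,
    6144087, 6145911, 6151511, 6255959, 6255831, 7603575, 7632759, 7722359]"
  by (rule g11.level_gapless, simp, simp only: eval11, (simp)?, (simp add: dead11)?)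

section \<open>Better constants for the ends of long runs in width 11\<close>

text \<open>Up to constant 8 the inequality \<open>43 \<le> 35 + j\<close> fails, so single gaps are
  examined with the help of \<open>K11\<close>.\<close>

lemma excess11_1 [THEN g11.level_good, simplified decode simp_thms, simp]: "level11 0 [
    4265079]"
  by (rule g11.level_one_gap, simp, simp only: eval11_gap, (simp)?, (simp add: dead11)?)

lemma excess11_2 [THEN g11.level_good, simplified decode simp_thms, simp]: "level11 1 [
    4480885]"
  by (rule g11.level_one_gap, simp, simp only: eval11_gap, (simp)?, (simp add: dead11)?)

lemma excess11_3 [THEN g11.level_good, simplified decode simp_thms, simp]: "level11 2 [
    4247623, 4309063, 4277301, 4277325, 4277361, 4277340, 4277333, 4279569, 4278135, 4280391,
    4283409, 4281617]"
  by (rule g11.level_one_gap, simp, simp only: eval11_gap, (simp)?, (simp add: dead11)?)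

lemma excess11_4 [THEN g11.level_good, simplified decode simp_thms, simp]: "level11 3 [
    4263236, 4267076, 4265284, 5365237, 4457741, 4457756, 4457749, 4474357, 5755255, 5758279]"
  by (rule g11.level_one_gap, simp, simp only: eval11_gap, (simp)?, (simp add: dead11)?)

lemma excess11_5 [THEN g11.level_good, simplified decode simp_thms, simp]: "level11 4 [
    5247184, 5247424, 4250887, 4218705, 4312327, 4280577, 4316167, 4283655, 4314375, 4456711,
    4460551, 4460817, 4461015, 4461687, 7606551, 4464465, 4473873, 4575495]"
  by (rule g11.level_one_gap, simp, simp only: eval11_gap, (simp)?, (simp add: dead11)?)

lemma excess11_6 [THEN g11.level_good, simplified decode simp_thms, simp]: "level11 5 [
    4208468, 4223828, 4224788, 4224887, 4216660, 4264004, 6033431, 4509980, 4509965, 6082679,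
    4480832, 4480861, 5574679, 5574868, 5050391, 5575108, 4536157, 4571420, 4571405, 6144119,
    5623927, 4542733, 4542748, 4542741, 5099639, 4551517, 6115447, 6125431, 4552477, 4544320,
    4552029, 4544349]"
  by (rule g11.level_one_gap, simp, simp only: eval11_gap, (simp)?, (simp add: dead11)?)

lemma excess11_7 [THEN g11.level_good, simplified decode simp_thms, simp]: "level11 6 [
    4198417, 4198468, 4198672, 4200400, 4247605, 4247665, 4249461, 4259857, 4259908, 4260112,
    5308701, 5308788, 4261840, 4264221, 4264308, 4265013, 4265073, 4265045, 4267281, 4267332,
    4309045, 4309105, 5457021, 4310901, 4280373, 4280433, 4280405, 4322589, 4282229, 4473117,
    4473909, 4473969, 4473941, 4476177, 4480017, 4478225, 5702781, 5587152, 5587392, 5588093]"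
  by (rule g11.level_one_gap, simp, simp only: eval11_gap, (simp)?, (simp add: dead11)?)

lemma excess11_8 [THEN g11.level_good, simplified decode simp_thms, simp]: "level11 7 [
    5259335, 4261133, 4261148, 4261141, 4263389, 4267229, 4267469, 4267357, 4267477, 4267484,
    4265437, 4276295, 4277060, 4278020, 4277572, 5469197, 5469212, 5469559, 5470069, 6029687,
    6032711, 6034759, 6036551, 6059383, 5046647, 5570935, 5571445, 5049671, 5572405, 5573959,
    5572465, 5571957, 5572437, 5714957, 5577799, 5051719, 5714972, 5715319, 5715829, 5053511,
    5576007, 5730317, 5730332, 5730679, 5731189, 5600269, 5600284, 5723149, 5076343, 5723164,
    5733703, 5732173, 5732188, 5723511, 5724021, 5600631, 5601141]"
  by (rule g11.level_one_gap, simp, simp only: eval11_gap, (simp)?, (simp add: dead11)?)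

text \<open>\<open>j = 8\<close> is the threshold \<open>Om - P\<close>: from here on only gapless
  completions are enumerated.\<close>

lemma excess11_9 [THEN g11.level_good, simplified decode simp_thms, simp]: "level11 8 [
    5247249, 5250897, 4212213, 5358663, 5329991, 5330756, 5340533, 4456519, 4456657, 4456785,
    4457479, 4457973, 7619655, 4486215, 4486353]"
  by (rule g11.level_gapless, simp, simp only: eval11, (simp)?, (simp add: dead11)?)

lemma excess11_10 [THEN g11.level_good, simplified decode simp_thms, simp]: "level11 9 [
    4214039, 4214228, 4216087, 4216276, 4218196, 4459799, 4459988, 7655543, 7698295, 6118663,
    7688311, 5627143]"
  by (rule g11.level_gapless, simp, simp only: eval11, (simp)?, (simp add: dead11)?)

lemma excess11_11 [THEN g11.level_good, simplified decode simp_thms, simp]: "level11 10 [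
    4195396, 4198869, 4198749, 4473972, 4478228, 6099293, 5624093, 4542737]"
  by (rule g11.level_gapless, simp, simp only: eval11, (simp)?, (simp add: dead11)?)

lemma excess11_12 [THEN g11.level_good, simplified decode simp_thms, simp]: "level11 11 [
    4200311, 4247933, 4250957, 5314417, 5314389, 6100855, 5594560]"
  by (rule g11.level_gapless, simp, simp only: eval11, (simp)?, (simp add: dead11)?)

lemma excess11_13 [THEN g11.level_good, simplified decode simp_thms, simp]: "level11 12 [
    5243157, 4472853, 7620471, 4474737, 4474709, 5574983, 5575121]"
  by (rule g11.level_gapless, simp, simp only: eval11, (simp)?, (simp add: dead11)?)

lemma excess11_14 [THEN g11.level_good, simplified decode simp_thms, simp]: "level11 13 [
    4248785, 4248647, 5338903, 5330368, 5339092, 5338455, 4457540]"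
  by (rule g11.level_gapless, simp, simp only: eval11, (simp)?, (simp add: dead11)?)

lemma excess11_15 [THEN g11.level_good, simplified decode simp_thms, simp]: "level11 14 [
    4195447, 4218304, 5570583, 5570772, 5578007, 5578196, 4670583]"
  by (rule g11.level_gapless, simp, simp only: eval11, (simp)?, (simp add: dead11)?)

lemma excess11_16 [THEN g11.level_good, simplified decode simp_thms, simp]: "level11 15 [
    4199249, 4199761, 5337373, 5330205, 4472909, 4472917, 5575125]"
  by (rule g11.level_gapless, simp, simp only: eval11, (simp)?, (simp add: dead11)?)

lemma excess11_17 [THEN g11.level_good, simplified decode simp_thms, simp]: "level11 16 [
    5244352, 5308689, 5469303, 5600375]"
  by (rule g11.level_gapless, simp, simp only: eval11, (simp)?, (simp add: dead11)?)

lemma excess11_18 [THEN g11.level_good, simplified decode simp_thms, simp]: "level11 17 [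
    4478023, 5578071, 7821175]"
  by (rule g11.level_gapless, simp, simp only: eval11, (simp)?, (simp add: dead11)?)

lemma excess11_19 [THEN g11.level_good, simplified decode simp_thms, simp]: "level11 18 [
    4211716, 4456516, 4474692, 4526417]"
  by (rule g11.level_gapless, simp, simp only: eval11, (simp)?, (simp add: dead11)?)

lemma excess11_20 [THEN g11.level_good, simplified decode simp_thms, simp]: "level11 19 [
    4214237, 4248797, 4216256, 4248925, 4218325, 4216285, 6255895]"
  by (rule g11.level_gapless, simp, simp only: eval11, (simp)?, (simp add: dead11)?)

lemma excess11_21 [THEN g11.level_good, simplified decode simp_thms, simp]: "level11 20 [
    5261056, 5308437, 5312981, 5315861, 5575793, 5575765]"
  by (rule g11.level_gapless, simp, simp only: eval11, (simp)?, (simp add: dead11)?)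

lemma excess11_22 [THEN g11.level_good, simplified decode simp_thms, simp]: "level11 21 [
    5314423, 5337463, 5340487, 5330295, 5587975]"
  by (rule g11.level_gapless, simp, simp only: eval11, (simp)?, (simp add: dead11)?)

lemma excess11_23 [THEN g11.level_good, simplified decode simp_thms, simp]: "level11 22 [
    4456567, 4474743, 4486263, 4488471, 4545863]"
  by (rule g11.level_gapless, simp, simp only: eval11, (simp)?, (simp add: dead11)?)

lemma excess11_24 [THEN g11.level_good, simplified decode simp_thms, simp]: "level11 23 [
    4198404, 4198464, 4211060, 4214084, 4216132, 4474304]"
  by (rule g11.level_gapless, simp, simp only: eval11, (simp)?, (simp add: dead11)?)

lemma excess11_25 [THEN g11.level_good, simplified decode simp_thms, simp]: "level11 24 [
    5570781, 5571029, 5570909, 5578205, 5623821, 5624285]"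
  by (rule g11.level_gapless, simp, simp only: eval11, (simp)?, (simp add: dead11)?)

lemma excess11_26 [THEN g11.level_good, simplified decode simp_thms, simp]: "level11 25 [
    5313361, 5314321, 5313873]"
  by (rule g11.level_gapless, simp, simp only: eval11, (simp)?, (simp add: dead11)?)

lemma excess11_27 [THEN g11.level_good, simplified decode simp_thms, simp]: "level11 26 [
    4215821, 7817079]"
  by (rule g11.level_gapless, simp, simp only: eval11, (simp)?, (simp add: dead11)?)

lemma excess11_28 [THEN g11.level_good, simplified decode simp_thms, simp]: "level11 27 [
    5330005, 4474180]"
  by (rule g11.level_gapless, simp, simp only: eval11, (simp)?, (simp add: dead11)?)

lemma excess11_29 [THEN g11.level_good, simplified decode simp_thms, simp]: "level11 28 [
    5246231, 4212160, 5578176]"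
  by (rule g11.level_gapless, simp, simp only: eval11, (simp)?, (simp add: dead11)?)

lemma excess11_30 [THEN g11.level_good, simplified decode simp_thms, simp]: "level11 29 [
    4198743, 5329173, 5578197]"
  by (rule g11.level_gapless, simp, simp only: eval11, (simp)?, (simp add: dead11)?)

lemma excess11_31 [THEN g11.level_good, simplified decode simp_thms, simp]: "level11 30 [
    5308695, 5312849, 4527957]"
  by (rule g11.level_gapless, simp, simp only: eval11, (simp)?, (simp add: dead11)?)

lemma excess11_32 [THEN g11.level_good, simplified decode simp_thms, simp]: "level11 31 [
    4207991, 7673719, 6255687, 4683127]"
  by (rule g11.level_gapless, simp, simp only: eval11, (simp)?, (simp add: dead11)?)

lemma excess11_33 [THEN g11.level_good, simplified decode simp_thms, simp]: "level11 32 [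
    4456525, 4456533, 4457537, 4474624, 4486221, 5588804]"
  by (rule g11.level_gapless, simp, simp only: eval11, (simp)?, (simp add: dead11)?)

lemma excess11_34 [THEN g11.level_good, simplified decode simp_thms, simp]: "level11 33 [
    5244125, 5244253, 4214087, 4214225, 4217863, 4216135, 4216273, 5588416]"
  by (rule g11.level_gapless, simp, simp only: eval11, (simp)?, (simp add: dead11)?)

lemma excess11_35 [THEN g11.level_good, simplified decode simp_thms, simp]: "level11 34 [
    5315927, 4456917, 4474740, 5570631, 5578055, 5624087, 4575701, 4542933]"
  by (rule g11.level_gapless, simp, simp only: eval11, (simp)?, (simp add: dead11)?)

lemma excess11_36 [THEN g11.level_good, simplified decode simp_thms, simp]: "level11 35 [
    4199697, 4248653, 4216081, 5314304, 5313821, 5314420, 4457297, 4457809, 4526455]"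
  by (rule g11.level_gapless, simp, simp only: eval11, (simp)?, (simp add: dead11)?)

lemma excess11_37 [THEN g11.level_good, simplified decode simp_thms, simp]: "level11 36 [
    5246229, 4215809, 5460343, 6047607, 4487037, 5570769, 5578193, 5588855, 5624183, 5591415,
    6118679, 6116471]"
  by (rule g11.level_gapless, simp, simp only: eval11, (simp)?, (simp add: dead11)?)

lemma excess11_38 [THEN g11.level_good, simplified decode simp_thms, simp]: "level11 37 [
    4198673, 4211777, 5312884, 5314372, 5457239, 5337367, 5337556, 5329239, 5330199, 5330388,
    4456721, 6030413, 4472849, 4473857, 4485127, 4486983, 4487121, 5587981, 5588759, 5588948,
    5588311]"
  by (rule g11.level_gapless, simp, simp only: eval11, (simp)?, (simp add: dead11)?)

lemma excess11_39 [THEN g11.level_good, simplified decode simp_thms, simp]: "level11 38 [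
    4195329, 5244020, 4207735, 4211735, 4211924, 4212052, 4215927, 4248951, 5332295, 5332433,
    6059895, 4522055, 4522193, 4529153, 4527383, 6145911, 4682871, 6151511, 6149495, 6117239,
    5627351, 5601143]"
  by (rule g11.level_gapless, simp, simp only: eval11, (simp)?, (simp add: dead11)?)

lemma excess11_40 [THEN g11.level_good, simplified decode simp_thms, simp]: "level11 39 [
    4198781, 4201941, 4210711, 4456727, 4457853, 4478029, 6053207, 4478037, 7672087, 5578564,
    6108279, 6246743, 4575511, 4673917, 5624957, 6247703, 5627165, 4576637, 5594455]"
  by (rule g11.level_gapless, simp, simp only: eval11, (simp)?, (simp add: dead11)?)

lemma excess11_41 [THEN g11.level_good, simplified decode simp_thms, simp]: "level11 40 [
    4198721, 4208500, 4207965, 4199893, 5259281, 4211025, 4211713, 5271565, 5263732, 4218689,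
    5273421, 5273429, 4216692, 5312881, 5312853, 4478065, 4653405, 5571393, 4526081, 4527937,
    4683101, 5625204, 4685079, 4683549]"
  by (rule g11.level_gapless, simp, simp only: eval11, (simp)?, (simp add: dead11)?)

lemma excess11_42 [THEN g11.level_good, simplified decode simp_thms, simp]: "level11 41 [
    5243725, 5243733, 4212039, 4218135, 4250967, 5316429, 5316437, 5358679, 5330007, 7603575,
    6032727, 6030711, 7619671, 7632759, 6059991, 6144087, 5623895, 7722359, 6255959, 5625111,
    6255831, 5627223, 5601239]"
  by (rule g11.level_gapless, simp, simp only: eval11, (simp)?, (simp add: dead11)?)

text \<open>The last level: 43 is the constant that \<open>columns11\<close> demands of every
  state.\<close>

lemma excess11_43 [THEN g11.level_good, simplified decode simp_thms, simp]: "level11 42 [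
    4212177, 4214836, 4216576, 5313012, 5313613, 5313621, 5314036, 5316468, 5325175, 5326039,
    5326167, 5329396, 5332804, 4473937, 4473940, 4474129, 4477201, 4477204, 4480273, 4488500,
    4653175, 4653940, 4523089, 4526353, 5575156, 4527169, 4539861, 5624692, 4707447, 4683636,
    4709655, 4546372, 4578804]"
  by (rule g11.level_gapless, simp, simp only: eval11, (simp)?, (simp add: dead11)?)

section \<open>All columns of width 11\<close>

text \<open>The enumeration is split by the last three rows, named from the bottom upwards. Of the
  27 triples 19 remain; in the others a row other than \<open>B\<close> stands on a \<open>D\<close>
  that has no \<open>B\<close> below.\<close>

lemma columns11_EEE: "all_columns (ck11 43 [X]) 8 [E, E, E, X]"
  by (simp only: eval_all eval11, (simp)?, (simp add: dead11)?)

lemma columns11_EEB: "all_columns (ck11 43 [X]) 8 [B, E, E, X]"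
  by (simp only: eval_all eval11, (simp)?, (simp add: dead11)?)

lemma columns11_EED: "all_columns (ck11 43 [X]) 8 [D, E, E, X]"
  by (simp only: eval_all eval11, (simp)?, (simp add: dead11)?)

lemma columns11_EBE: "all_columns (ck11 43 [X]) 8 [E, B, E, X]"
  by (simp only: eval_all eval11, (simp)?, (simp add: dead11)?)

lemma columns11_EBB: "all_columns (ck11 43 [X]) 8 [B, B, E, X]"
  by (simp only: eval_all eval11, (simp)?, (simp add: dead11)?)

lemma columns11_EBD: "all_columns (ck11 43 [X]) 8 [D, B, E, X]"
  by (simp only: eval_all eval11, (simp)?, (simp add: dead11)?)

lemma columns11_EDB: "all_columns (ck11 43 [X]) 8 [B, D, E, X]"
  by (simp only: eval_all eval11, (simp)?, (simp add: dead11)?)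

lemma columns11_BEE: "all_columns (ck11 43 [X]) 8 [E, E, B, X]"
  by (simp only: eval_all eval11, (simp)?, (simp add: dead11)?)

lemma columns11_BEB: "all_columns (ck11 43 [X]) 8 [B, E, B, X]"
  by (simp only: eval_all eval11, (simp)?, (simp add: dead11)?)

lemma columns11_BED: "all_columns (ck11 43 [X]) 8 [D, E, B, X]"
  by (simp only: eval_all eval11, (simp)?, (simp add: dead11)?)

lemma columns11_BBE: "all_columns (ck11 43 [X]) 8 [E, B, B, X]"
  by (simp only: eval_all eval11, (simp)?, (simp add: dead11)?)

lemma columns11_BBB: "all_columns (ck11 43 [X]) 8 [B, B, B, X]"
  by (simp only: eval_all eval11, (simp)?, (simp add: dead11)?)

lemma columns11_BBD: "all_columns (ck11 43 [X]) 8 [D, B, B, X]"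
  by (simp only: eval_all eval11, (simp)?, (simp add: dead11)?)

lemma columns11_BDE: "all_columns (ck11 43 [X]) 8 [E, D, B, X]"
  by (simp only: eval_all eval11, (simp)?, (simp add: dead11)?)

lemma columns11_BDB: "all_columns (ck11 43 [X]) 8 [B, D, B, X]"
  by (simp only: eval_all eval11, (simp)?, (simp add: dead11)?)

lemma columns11_BDD: "all_columns (ck11 43 [X]) 8 [D, D, B, X]"
  by (simp only: eval_all eval11, (simp)?, (simp add: dead11)?)

lemma columns11_DBE: "all_columns (ck11 43 [X]) 8 [E, B, D, X]"
  by (simp only: eval_all eval11, (simp)?, (simp add: dead11)?)

lemma columns11_DBB: "all_columns (ck11 43 [X]) 8 [B, B, D, X]"
  by (simp only: eval_all eval11, (simp)?, (simp add: dead11)?)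

lemma columns11_DBD: "all_columns (ck11 43 [X]) 8 [D, B, D, X]"
  by (simp only: eval_all eval11, (simp)?, (simp add: dead11)?)

lemma columns11: "all_columns (ck11 43 [X]) 11 [X]"
  by (simp only: eval_all columns11_EEE columns11_EEB columns11_EED columns11_EBE columns11_EBB columns11_EBD columns11_EDB columns11_BEE columns11_BEB columns11_BED columns11_BBE columns11_BBB columns11_BBD columns11_BDE columns11_BDB columns11_BDD columns11_DBE columns11_DBB columns11_DBD simp_thms status.distinct)

lemma gaps11: "packing 11 S \<Longrightarrow> m \<le> 35 * gaps 11 S x m + 43"
  by (rule g11.gaps_lower_bound[folded g11.ck_def, OF columns11]) (simp_all add: K11_def bits_numeral)

section \<open>Upper bounds\<close>

text \<open>Monominos fill the rest; having four cells, no tetromino is counted among them.\<close>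

lemma gap_number_le:
  assumes "disjoint S" "\<And>t. t \<in> S \<Longrightarrow> is_T_tetromino t \<and> t \<subseteq> rectangle m n"
  shows "gap_number m n \<le> card (rectangle m n - \<Union>S)"
proof -
  define F where "F = rectangle m n - \<Union>S"
  define P where "P = S \<union> (\<lambda>c. {c}) ` F"
  have ne: "t \<noteq> {}" if "t \<in> S" for t using card_T_tetromino[of t] assms(2)[OF that] by auto
  have "\<Union>S \<subseteq> rectangle m n" using assms(2) by blast
  then have "\<Union>P = rectangle m n" unfolding P_def F_def by auto
  moreover have "disjoint P"
    using assms(1) unfolding P_def F_def disjoint_def by auto
  moreover have "{} \<notin> P" using ne unfolding P_def by auto
  ultimately have "partition_on (rectangle m n) P" unfolding partition_on_def by blast
  then have tiling: "is_tiling m n P"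
    using assms(2) unfolding is_tiling_def is_monomino_def P_def by blast
  have "\<not> is_monomino t" if "is_T_tetromino t" for t
    using card_T_tetromino[OF that] unfolding is_monomino_def by auto
  then have "{t \<in> P. is_monomino t} = (\<lambda>c. {c}) ` F"
    using assms(2) unfolding P_def is_monomino_def by blast
  moreover have "card ((\<lambda>c. {c}) ` F) = card F" by (intro card_image) (simp add: inj_on_def)
  ultimately have "\<exists>P. is_tiling m n P \<and> card {t \<in> P. is_monomino t} = card F"
    using tiling by auto
  then show ?thesis unfolding gap_number_def F_def by (rule Least_le)
qed

text \<open>The tetrominoes of an optimal tiling form a packing of the infinite strip. Outside the
  rectangle it covers nothing, but only columns \<open>0\<close> to \<open>n - 1\<close> are
  counted.\<close>

lemma gap_number_packing:
  obtains S where "packing m S" "gaps m S 0 n = gap_number m n"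
proof -
  obtain P where P: "is_tiling m n P" "card {S \<in> P. is_monomino S} = gap_number m n"
    using gap_number_attained by blast
  define S where "S = {t \<in> P. is_T_tetromino t}"
  have part: "partition_on (rectangle m n) P" and tiles: "\<And>t. t \<in> P \<Longrightarrow> is_T_tetromino t \<or> is_monomino t"
    using P(1) unfolding is_tiling_def by auto
  have in_strip: "t \<subseteq> {0..<int m} \<times> UNIV" if "t \<in> S" for t
  proof -
    have "t \<in> P" using that unfolding S_def by simp
    then have "t \<subseteq> rectangle m n" using part unfolding partition_on_def by blast
    then show ?thesis unfolding rectangle_def by auto
  qed
  have disj: "disjoint P" using part unfolding partition_on_def by simp
  then have "disjoint S" unfolding S_def by (rule pairwise_subset) auto
  then have pack: "packing m S" unfolding packing_def using in_strip by (simp add: S_def)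
  have "{t \<in> P. is_monomino t} = (\<lambda>c. {c}) ` (rectangle m n - \<Union>S)"
  proof (intro equalityI subsetI)
    fix t assume t: "t \<in> {t \<in> P. is_monomino t}"
    then obtain c where c: "t = {c}" unfolding is_monomino_def by blast
    have "c \<notin> u" if "u \<in> S" for u
    proof
      assume "c \<in> u"
      then have "u \<inter> t \<noteq> {}" using c by blast
      moreover have "u \<in> P" "t \<in> P" using that t unfolding S_def by simp_all
      ultimately have "u = t" using disjointD[OF disj] by blast
      then show False using that c card_T_tetromino[of u] unfolding S_def by simp
    qed
    moreover have "c \<in> \<Union>P" using t c by blast
    then have "c \<in> rectangle m n" using part unfolding partition_on_def by simp
    ultimately show "t \<in> (\<lambda>c. {c}) ` (rectangle m n - \<Union>S)" using c by blast
  next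
    fix t assume "t \<in> (\<lambda>c. {c}) ` (rectangle m n - \<Union>S)"
    then obtain c where c: "t = {c}" "c \<in> rectangle m n" "c \<notin> \<Union>S" by blast
    have "c \<in> \<Union>P" using c(2) part unfolding partition_on_def by simp
    then obtain u where u: "u \<in> P" "c \<in> u" by blast
    then have "is_monomino u" using tiles[OF u(1)] c(3) unfolding S_def by blast
    then have "u = t" using u(2) c(1) unfolding is_monomino_def by blast
    then show "t \<in> {t \<in> P. is_monomino t}" using u \<open>is_monomino u\<close> by blast
  qed
  then have "gap_number m n = card ((\<lambda>c. {c}) ` (rectangle m n - \<Union>S))" using P(2) by simp
  also have "\<dots> = card (rectangle m n - \<Union>S)" by (intro card_image) (simp add: inj_on_def)
  finally have "gaps m S 0 n = gap_number m n" unfolding gaps_def rectangle_def by simp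
  with pack show thesis by (rule that)
qed

section \<open>Periodic packings\<close>

lemma tcells_shift: "tcells k r (x + d) = map (\<lambda>(a, b). (a, b + d)) (tcells k r x)"
  by (simp add: tcells_def)

definition tile_cells :: "(nat \<times> int \<times> int) list \<Rightarrow> cell list" where
  "tile_cells ts = concat (map (\<lambda>(k, r, x). tcells k r x) ts)"

text \<open>Modulo \<open>p\<close> columns, the tiles \<open>ts\<close> cover all cells of a period
  but one. Cells may lie in the next period, hence the width \<open>2 * p\<close>. The number
  \<open>r * p + x mod p\<close> names the class of a cell, so distinctness says that translates do
  not overlap.\<close>

lemma gap_number_periodic:
  fixes p m :: nat and ts :: "(nat \<times> int \<times> int) list"
  defines "cs \<equiv> tile_cells ts"
  assumes p: "p > 0"
    and dist: "distinct (map (\<lambda>(r, x). r * int p + x mod int p) cs)"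
    and inside: "list_all (\<lambda>(r, x). 0 \<le> r \<and> r < int m \<and> 0 \<le> x \<and> x < 2 * int p) cs"
    and len: "length cs + 1 = m * p"
    and ts: "list_all (\<lambda>(k, r, x). k < 4) ts"
  shows "gap_number m n \<le> n div p + 2 * m * p"
proof (cases "n div p")
  case 0
  have "gap_number m n \<le> card (rectangle m n)"
    using gap_number_le[of "{}" m n] by simp
  also have "\<dots> = m * n" by (simp add: rectangle_def card_cartesian_product)
  also have "\<dots> \<le> m * p" using 0 p by (intro mult_left_mono) (simp_all add: div_eq_0_iff)
  finally show ?thesis by simp
next
  case (Suc q)
  let ?enc = "\<lambda>(r, x). r * int p + x mod int p"
  let ?c = "\<lambda>(k, r, x). tcells k r x" and ?sh = "\<lambda>i (a, b). (a, b + int p * int i)"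
  define T where "T t i = ?sh i ` set (?c t)" for t and i :: nat
  \<comment> \<open>Shifting by multiples of \<open>p\<close> preserves the class, so colliding
    translates come from the same cell, and then the shifts agree.\<close>
  have inj: "a = b \<and> i = j" if "a \<in> set cs" "b \<in> set cs" "?sh i a = ?sh j b" for a b i j
  proof -
    have "?enc (?sh i a) = ?enc a" for i and a :: cell by (cases a) simp
    then have "?enc a = ?enc b" using that(3) by metis
    then have "a = b" using dist that(1,2) unfolding distinct_map inj_on_def by blast
    moreover from this that(3) have "int p * int i = int p * int j" by (cases b) auto
    ultimately show ?thesis using p by simp
  qed
  have same: "?c t = ?c u" if "t \<in> set ts" "u \<in> set ts" "a \<in> set (?c t)" "a \<in> set (?c u)" for t u a
  proof -
    have "distinct cs" using dist by (simp add: distinct_map)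
    moreover have "?c t \<in> set (map ?c ts)" "?c u \<in> set (map ?c ts)" using that(1,2) by simp_all
    ultimately have "?c t = ?c u \<or> set (?c t) \<inter> set (?c u) = {}"
      unfolding cs_def tile_cells_def distinct_concat_iff by blast
    then show ?thesis using that(3,4) by blast
  qed
  define S where "S = {T t i |t i. t \<in> set ts \<and> i < q}"
  have sub: "a \<in> set cs" if "t \<in> set ts" "a \<in> set (?c t)" for t a
    using that unfolding cs_def tile_cells_def by auto
  have "disjoint S"
  proof (rule disjointI)
    fix A C assume "A \<in> S" "C \<in> S" "A \<noteq> C"
    then obtain t i u j where ti: "t \<in> set ts" "A = T t i" and uj: "u \<in> set ts" "C = T u j"
      unfolding S_def by blast
    show "A \<inter> C = {}"
    proof (rule ccontr)
      assume "A \<inter> C \<noteq> {}"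
      then obtain a b where ab: "a \<in> set (?c t)" "b \<in> set (?c u)" "?sh i a = ?sh j b"
        unfolding ti uj T_def by blast
      then have "a = b \<and> i = j" using inj sub ti uj by blast
      then have "?c t = ?c u" "i = j" using same[OF ti(1) uj(1)] ab by auto
      then show False using \<open>A \<noteq> C\<close> unfolding ti uj T_def by simp
    qed
  qed
  moreover have tiles: "is_T_tetromino t \<and> t \<subseteq> rectangle m n" if tS: "t \<in> S" for t
  proof -
    obtain u i where u: "u \<in> set ts" "i < q" "t = T u i" using tS unfolding S_def by blast
    obtain k r x where krx: "u = (k, r, x)" by (cases u)
    then have "k < 4" using ts u(1) by (auto simp: list_all_iff)
    moreover have "t = set (tcells k r (x + int p * int i))"
      unfolding u(3) T_def krx by (simp add: tcells_shift)
    ultimately have "is_T_tetromino t" unfolding is_T_tetromino_iff by blast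
    moreover have "t \<subseteq> rectangle m n"
    proof
      fix z assume "z \<in> t"
      then obtain a where a: "a \<in> set (?c u)" "z = ?sh i a" unfolding u(3) T_def by blast
      obtain r x where rx: "a = (r, x)" by (cases a)
      have b: "0 \<le> r" "r < int m" "0 \<le> x" "x < 2 * int p"
        using inside sub[OF u(1) a(1)] unfolding rx list_all_iff by auto
      \<comment> \<open>A translate occupies at most two periods; this is why only
        \<open>q = n div p - 1\<close> translates are used.\<close>
      have "p * (i + 2) \<le> p * (n div p)" using u(2) Suc by (intro mult_left_mono) simp_all
      also have "\<dots> \<le> n" by (rule times_div_less_eq_dividend)
      finally have "int p * int i + 2 * int p \<le> int n" by (simp add: algebra_simps flip: of_nat_mult of_nat_add)
      then show "z \<in> rectangle m n" using b unfolding a rx rectangle_def by simp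
    qed
    ultimately show ?thesis by blast
  qed
  ultimately have le: "gap_number m n \<le> card (rectangle m n - \<Union>S)" by (rule gap_number_le)
  have sub_rect: "\<Union>S \<subseteq> rectangle m n"
    using tiles by blast
  have US: "\<Union>S = (\<lambda>(a, i). ?sh i a) ` (set cs \<times> {..<q})"
  proof -
    have "set cs = (\<Union>t\<in>set ts. set (?c t))" by (simp add: cs_def tile_cells_def)
    show ?thesis
    proof (intro equalityI subsetI)
      fix z assume "z \<in> \<Union>S"
      then obtain t i a where z: "t \<in> set ts" "i < q" "a \<in> set (?c t)" "z = ?sh i a"
        unfolding S_def T_def by blast
      then show "z \<in> (\<lambda>(a, i). ?sh i a) ` (set cs \<times> {..<q})"
        using sub by (intro image_eqI[of _ _ "(a, i)"]) auto
    next
      fix z assume "z \<in> (\<lambda>(a, i). ?sh i a) ` (set cs \<times> {..<q})"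
      then obtain w where "z = (\<lambda>(a, i). ?sh i a) w" "w \<in> set cs \<times> {..<q}" by (rule imageE)
      moreover obtain a i where "w = (a, i)" by (cases w)
      ultimately have z: "a \<in> set cs" "i < q" "z = ?sh i a" by auto
      then obtain t where "t \<in> set ts" "a \<in> set (?c t)"
        using \<open>set cs = (\<Union>t\<in>set ts. set (?c t))\<close> by blast
      then show "z \<in> \<Union>S" using z unfolding S_def T_def by blast
    qed
  qed
  have "card (\<Union>S) = card (set cs \<times> {..<q})"
    unfolding US by (intro card_image inj_onI) (use inj in auto)
  also have "\<dots> = length cs * q"
    using dist by (simp add: card_cartesian_product distinct_card distinct_map)
  finally have "card (rectangle m n - \<Union>S) = m * n - length cs * q"
    using card_Diff_subset[OF finite_subset[OF sub_rect] sub_rect]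
    by (simp add: rectangle_def card_cartesian_product)
  moreover have "m * n \<le> length cs * q + (n div p + 2 * m * p)"
  proof -
    have "n = p * Suc q + n mod p" using Suc by (metis mult_div_mod_eq)
    then have "m * n = m * p * Suc q + m * (n mod p)" by (metis distrib_left mult.assoc)
    also have "\<dots> = length cs * q + q + m * p + m * (n mod p)" by (simp flip: len add: algebra_simps)
    also have "m * (n mod p) \<le> m * p" using p by (intro mult_left_mono) (simp_all add: less_imp_le)
    finally show ?thesis using Suc by simp
  qed
  ultimately show ?thesis using le by linarith
qed

text \<open>Distinctness is thus evaluated by comparing numerals, without expanding sets.\<close>

definition notin :: "int \<Rightarrow> int list \<Rightarrow> bool" where
  "notin x xs \<longleftrightarrow> x \<notin> set xs"

lemma notin_eqs: "notin x [] = True" "x \<noteq> y \<Longrightarrow> notin x (y # ys) = notin x ys"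
  by (auto simp: notin_def)

lemma distinct_Cons_notin: "distinct (x # xs) = (notin x xs \<and> distinct xs)"
  by (auto simp: notin_def)

text \<open>Tilings of the strips of width 5, 7, 11 that leave one cell uncovered per 5, 7, 35 columns;
  they were found by a search for the cheapest cycles of the transfer automaton.\<close>

definition ts5 :: "(nat \<times> int \<times> int) list" where
  "ts5 = [
    (3, 1, 1), (2, 2, 1), (1, 4, 2), (2, 0, 3), (0, 0, 4), (3, 3, 4)]"

lemma ts5_periodic:
  "distinct (map (\<lambda>(r, x). r * int 5 + x mod int 5) (tile_cells ts5))"
  "list_all (\<lambda>(r, x). 0 \<le> r \<and> r < int 5 \<and> 0 \<le> x \<and> x < 2 * int 5) (tile_cells ts5)"
  "length (tile_cells ts5) + 1 = 5 * 5"
  "list_all (\<lambda>(k, r, x). k < 4) ts5"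
  by (simp_all add: tile_cells_def ts5_def tcells_def del: distinct.simps)
    (simp add: notin_eqs distinct_Cons_notin del: distinct.simps(2))

lemma gap_number_5_upper: "gap_number 5 n \<le> n div 5 + 50"
  using gap_number_periodic[OF _ ts5_periodic] by simp

definition ts7 :: "(nat \<times> int \<times> int) list" where
  "ts7 = [
    (3, 2, 0), (1, 6, 1), (0, 0, 2), (2, 1, 2), (3, 4, 2), (1, 1, 4), (0, 2, 4), (2, 3, 4),
    (1, 6, 4), (0, 0, 6), (1, 4, 6), (0, 5, 6)]"

lemma ts7_periodic:
  "distinct (map (\<lambda>(r, x). r * int 7 + x mod int 7) (tile_cells ts7))"
  "list_all (\<lambda>(r, x). 0 \<le> r \<and> r < int 7 \<and> 0 \<le> x \<and> x < 2 * int 7) (tile_cells ts7)"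
  "length (tile_cells ts7) + 1 = 7 * 7"
  "list_all (\<lambda>(k, r, x). k < 4) ts7"
  by (simp_all add: tile_cells_def ts7_def tcells_def del: distinct.simps)
    (simp add: notin_eqs distinct_Cons_notin del: distinct.simps(2))

lemma gap_number_7_upper: "gap_number 7 n \<le> n div 7 + 98"
  using gap_number_periodic[OF _ ts7_periodic] by simp

definition ts11 :: "(nat \<times> int \<times> int) list" where
  "ts11 = [
    (1, 1, 1), (3, 3, 1), (0, 5, 1), (2, 7, 1), (1, 10, 1), (3, 7, 2), (0, 0, 3), (2, 2, 3),
    (3, 9, 3), (3, 2, 4), (2, 4, 4), (1, 7, 4), (0, 4, 5), (2, 8, 5), (0, 0, 6), (2, 1, 6),
    (1, 6, 6), (1, 8, 6), (1, 10, 6), (3, 3, 7), (3, 1, 8), (1, 5, 8), (1, 7, 8), (3, 9, 8),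
    (0, 3, 9), (2, 0, 10), (3, 6, 10), (2, 8, 10), (0, 0, 11), (0, 2, 11), (0, 4, 11), (1, 8, 11),
    (1, 10, 11), (3, 6, 12), (1, 1, 13), (1, 3, 13), (3, 9, 13), (2, 4, 14), (1, 7, 14),
    (0, 0, 15), (0, 2, 15), (0, 4, 15), (2, 8, 15), (1, 6, 16), (1, 8, 16), (1, 10, 16),
    (3, 1, 17), (0, 3, 17), (3, 5, 18), (0, 7, 18), (0, 9, 18), (2, 0, 19), (0, 0, 20),
    (0, 2, 20), (2, 3, 20), (1, 6, 20), (1, 8, 20), (1, 10, 20), (3, 1, 22), (2, 3, 22),
    (1, 7, 22), (3, 9, 22), (0, 3, 23), (0, 5, 23), (2, 0, 24), (2, 8, 24), (0, 0, 25),
    (0, 2, 25), (0, 4, 25), (2, 6, 25), (1, 10, 25), (1, 6, 26), (3, 8, 26), (3, 1, 27),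
    (0, 3, 27), (3, 5, 28), (2, 7, 28), (1, 10, 28), (2, 0, 29), (3, 7, 29), (0, 0, 30),
    (0, 2, 30), (2, 3, 30), (0, 9, 30), (3, 5, 31), (2, 6, 31), (1, 1, 32), (1, 3, 32),
    (1, 8, 32), (1, 10, 32), (2, 4, 33), (0, 0, 34), (0, 2, 34), (0, 4, 34), (0, 6, 34),
    (3, 9, 34)]"

lemma ts11_periodic:
  "distinct (map (\<lambda>(r, x). r * int 35 + x mod int 35) (tile_cells ts11))"
  "list_all (\<lambda>(r, x). 0 \<le> r \<and> r < int 11 \<and> 0 \<le> x \<and> x < 2 * int 35) (tile_cells ts11)"
  "length (tile_cells ts11) + 1 = 11 * 35"
  "list_all (\<lambda>(k, r, x). k < 4) ts11"
  by (simp_all add: tile_cells_def ts11_def tcells_def del: distinct.simps)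
    (simp add: notin_eqs distinct_Cons_notin del: distinct.simps(2))

lemma gap_number_11_upper: "gap_number 11 n \<le> n div 35 + 770"
  using gap_number_periodic[OF _ ts11_periodic] by simp

section \<open>The theorem\<close>

text \<open>Since \<open>p \<ge> 1\<close>, \<open>p * f n + b\<close> is at most
  \<open>p * (f n + b)\<close>, and division by \<open>p\<close> leaves the error
  \<open>b\<close>.\<close>

lemma floor_error_bound:
  fixes f :: "nat \<Rightarrow> nat"
  assumes "\<And>n. n \<le> p * f n + b" "\<And>n. f n \<le> n div p + c" "p > 0"
  shows "\<bar>int (f n) - \<lfloor>real n / real p\<rfloor>\<bar> \<le> int (b + c)"
proof -
  have "p * (n div p) \<le> p * f n + b" using assms(1)[of n] times_div_less_eq_dividend[of p n] by linarith
  moreover have "p * f n + b \<le> p * (f n + b)" using assms(3) by (simp add: distrib_left)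
  ultimately have "n div p \<le> f n + b" using assms(3) by (meson le_trans mult_le_cancel1)
  then show ?thesis using assms(2)[of n] by (simp add: floor_divide_of_nat_eq)
qed

lemma gap_number_lower:
  assumes "\<And>S. packing m S \<Longrightarrow> n \<le> p * gaps m S 0 n + b"
  shows "n \<le> p * gap_number m n + b"
  using assms by (metis gap_number_packing)

theorem theorem3:
  shows "\<exists>e5 e7 e11 :: nat \<Rightarrow> int.
    (\<exists>B. \<forall>n\<ge>1. \<bar>e5 n\<bar> \<le> B) \<and>
    (\<exists>B. \<forall>n\<ge>1. \<bar>e7 n\<bar> \<le> B) \<and>
    (\<exists>B. \<forall>n\<ge>1. \<bar>e11 n\<bar> \<le> B) \<and>
    (\<forall>n\<ge>1.
       int (gap_number 5 n) = \<lfloor>real n / 5\<rfloor> + e5 n \<and>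
       int (gap_number 7 n) = \<lfloor>real n / 7\<rfloor> + e7 n \<and>
       int (gap_number 11 n) = \<lfloor>real n / 35\<rfloor> + e11 n)"
proof -
  let ?e = "\<lambda>m p n. int (gap_number m n) - \<lfloor>real n / real p\<rfloor>"
  \<comment> \<open>Each bound adds the constant \<open>Om\<close> of the lower bound and the loss
    \<open>2 * m * p\<close> of the periodic packing.\<close>
  have 5: "\<bar>?e 5 5 n\<bar> \<le> int (7 + 50)" for n
    by (rule floor_error_bound) (auto intro: gap_number_lower gaps5 gap_number_5_upper)
  have 7: "\<bar>?e 7 7 n\<bar> \<le> int (9 + 98)" for n
    by (rule floor_error_bound) (auto intro: gap_number_lower gaps7 gap_number_7_upper)
  have 11: "\<bar>?e 11 35 n\<bar> \<le> int (43 + 770)" for n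
    by (rule floor_error_bound) (auto intro: gap_number_lower gaps11 gap_number_11_upper)
  show ?thesis
    by (rule exI[of _ "?e 5 5"], rule exI[of _ "?e 7 7"], rule exI[of _ "?e 11 35"]) (use 5 7 11 in auto)
qed

end
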